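(* Let $V$ be a real vector space of dimension $d$ with lattice $\Lambda$, and let $\mathfrak c\subseteq V$ be a full-dimensional (i.e. $d$-dimensional) rational polyhedral cone with vertex $0$. Fix a decomposition $[\mathfrak c]\equiv\sum_{\mathfrak u}\epsilon_{\mathfrak u}[\mathfrak u]$ as in the context and let $\Psi_{\mathfrak c}$ be the associated finite set of dual-basis vectors. Let $m\in\mathbb Z$. Then: (i) the function $(s,\xi)\mapsto M(s,\mathfrak c)_{[m]}(\xi)$ belongs to $\mathcal Q^{\Psi_{\mathfrak c}}_{[\le m+d]}(V)\otimes\mathcal R_{[m]}(V^* )$; (ii) the function $(s,\xi)\mapsto S(s+\mathfrak c)_{[m]}(\xi)$ belongs to $\mathcal Q\mathcal P^{\Psi_{\mathfrak c}}_{[\le m+d]}(V)\otimes\mathcal R_{[m]}(V^* )$; more precisely $$S(s+\mathfrak c)_{[m]}(\xi)=\sum_{r=0}^{m+d}\frac{\langle\xi,s\rangle^r}{r!}\,M(s,\mathfrak c)_{[m-r]}(\xi);$$ (iii) the homogeneous component in $\xi$ of lowest degree has degree $-d$ (i.e. $S(s+\mathfrak c)_{[m]}=0$ for $m<-d$) and does not depend on $s$; it is given by the integral: $$S(s+\mathfrak c)_{[-d]}(\xi)=M(s,\mathfrak c)_{[-d]}(\xi)=I(\mathfrak c)(\xi).$$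
   Context: $V$ is a real vector space of dimension $d$ with a lattice $\Lambda$ (generated by a basis of $V$); $\Lambda^*=\{\gamma\in V^*:\langle\gamma,\Lambda\rangle\subseteq\mathbb Z\}$ is the dual lattice and $V^*_{\mathbb Q}=\Lambda^*\otimes\mathbb Q$. A rational subspace $L$ is one with $L\cap\Lambda$ a lattice in $L$; it carries the Lebesgue measure for which $L/(L\cap\Lambda)$ has volume $1$ (likewise on translates), and $\Lambda_{V/L}$ denotes the image of $\Lambda$ in $V/L$. A semi-rational polyhedron is a finite intersection of closed halfspaces $\{x:\langle\mu,x\rangle\le b\}$ with $\mu\in\Lambda^*$, $b\in\mathbb R$. $\mathcal M_\ell(V^* )$ is the ring of meromorphic functions near $0\in V^*_{\mathbb C}$ of the form $\phi(\xi)/\prod_{j=1}^N\langle\xi,w_j\rangle$ with $\phi$ holomorphic near $0$ and $w_j\in V\setminus\{0\}$. For $\phi\in\mathcal M_\ell(V^* )$ the homogeneous components $\phi_{[m]}$ are defined by the Laurent expansion in one variable $\tau$: $\phi(\tau\xi)=\sum_{m\ge m_0}\tau^m\phi_{[m]}(\xi)$. $\mathcal R_{[m]}(V^* )$ is the space of rational functions $P(\xi)/\prod_{j=1}^N\langle\xi,w_j\rangle$ ($w_j\in V\setminus\{0\}$) with $P$ a homogeneous polynomial of degree $m+N$. For a rational subspace $L$, the intermediate generating function $S^L(\mathfrak p)\in\mathcal M_\ell(V^* )$ of a semi-rational polyhedron $\mathfrak p$ is defined by the unique map $\mathfrak p\mapsto S^L(\mathfrak p)$ which is a valuation (whenever $\sum_i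 r_i[\mathfrak p_i]=0$ for indicator functions, $\sum_i r_iS^L(\mathfrak p_i)=0$), vanishes on polyhedra containing a line, and equals $\sum_{y\in\Lambda_{V/L}}\int_{\mathfrak p\cap(y+L)}e^{\langle\xi,x\rangle}\,dx$ for all $\xi$ where this converges. $S=S^{\{0\}}$ (so $S(\mathfrak p)(\xi)=\sum_{x\in\mathfrak p\cap\Lambda}e^{\langle\xi,x\rangle}$ where convergent) and $I=S^V$ (the integral $\int_{\mathfrak p}e^{\langle\xi,x\rangle}dx$ where convergent). For a cone $\mathfrak c$ and $s\in V$, $M^L(s,\mathfrak c)(\xi)=e^{-\langle\xi,s\rangle}S^L(s+\mathfrak c)(\xi)$ and $M=M^{\{0\}}$. Step-polynomials: $\{t\}\in[0,1)$ denotes the fractional part of $t\in\mathbb R$. For a finite $\Psi\subset V^*_{\mathbb Q}$ and integer $k$, $\mathcal Q^\Psi_{[\le k]}(V)$ is the linear span of products of at most $k$ functions $s\mapsto\{\langle\eta,s\rangle\}$ with $\eta\in\Psi$ (the empty product being the constant $1$; this space is $\{0\}$ if $k<0$). $\mathcal Q\mathcal P^\Psi_{[\le q]}(V)$ is the linear span of functions $f(s)p(s)$ with $f\in\mathcal Q^\Psi_{[\le k]}(V)$ and $p$ a homogeneous polynomial on $V$ of degree $r$, where $k+r\le q$. For spaces $A$ of functions of $s\in V$ and $B$ of functions of $\xi$, $A\otimes B$ denotes the space of finite sums $\sum_i f_i(s)g_i(\xi)$ with $f_i\in A$, $g_i\in B$. A simplicial cone is unimodular if it is generated by lattice vectors forming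 part of a basis of $\Lambda$. The set $\Psi_{\mathfrak c}$: choose a decomposition $[\mathfrak c]\equiv\sum_{\mathfrak u}\epsilon_{\mathfrak u}[\mathfrak u]$ of the indicator function of $\mathfrak c$ into a finite signed sum of indicator functions of full-dimensional unimodular cones $\mathfrak u$, the congruence holding modulo the span of indicator functions of polyhedral cones containing a line. For each $\mathfrak u$ let $v^{\mathfrak u}_1,\dots,v^{\mathfrak u}_d\in\Lambda$ be its primitive edge generators and $\eta^{\mathfrak u}_1,\dots,\eta^{\mathfrak u}_d\in\Lambda^*$ the dual basis; $\Psi_{\mathfrak c}$ is the set of all $\eta^{\mathfrak u}_j$.
   Formalization: With Ψ_c as stated, (i) and (ii) fail (V=ℝ, Λ=ℤ, c=[0,∞): M_[0]=1/2−{−s} is not a+b{s}); the formal theorem replaces Ψ_c by −Ψ_c, so the step functions are {−⟨η,s⟩}. It also takes d≥1. *)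

theory Defs
  imports "HOL-Complex_Analysis.Complex_Analysis"
begin

text \<open>
  The space V is a type of class \<open>euclidean_space\<close>, of which only the linear structure and the
  topology are used. Its dual V* is the type \<open>'a \<Rightarrow>\<^sub>L real\<close> and the complexified dual is the type
  \<open>'a \<Rightarrow>\<^sub>L complex\<close> of real-linear maps from V to the complex numbers; the pairing is
  \<open>blinfun_apply\<close>.
\<close>

definition int_span :: "'a::real_vector set \<Rightarrow> 'a set" where
  "int_span B = range (\<lambda>z :: 'a \<Rightarrow> int. \<Sum>b\<in>B. of_int (z b) *\<^sub>R b)"

definition lattice_basis :: "'a::euclidean_space set \<Rightarrow> 'a set \<Rightarrow> 'a set \<Rightarrow> bool" where
  "lattice_basis L \<Gamma> B \<longleftrightarrow> independent B \<and> span B = L \<and> int_span B = \<Gamma>"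

definition lattice_in :: "'a::euclidean_space set \<Rightarrow> 'a set \<Rightarrow> bool" where
  "lattice_in L \<Gamma> \<longleftrightarrow> (\<exists>B. lattice_basis L \<Gamma> B)"

definition dual_lattice :: "'a::euclidean_space set \<Rightarrow> ('a \<Rightarrow>\<^sub>L real) set" where
  "dual_lattice \<Lambda> = {\<gamma>. \<forall>x\<in>\<Lambda>. blinfun_apply \<gamma> x \<in> \<int>}"

definition rational_subspace :: "'a::euclidean_space set \<Rightarrow> 'a set \<Rightarrow> bool" where
  "rational_subspace \<Lambda> L \<longleftrightarrow> subspace L \<and> lattice_in L (L \<inter> \<Lambda>)"

text \<open>
  Lebesgue measure on L for which the quotient of L by its lattice has volume 1, transported
  from coordinates with respect to a lattice basis. The result does not depend on the basis,
  since two lattice bases differ by an integral matrix of determinant 1 or -1. For the zero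
  subspace the basis is empty and the measure is the unit mass at 0.
\<close>

definition subspace_measure :: "'a::euclidean_space set \<Rightarrow> 'a set \<Rightarrow> 'a measure" where
  "subspace_measure \<Lambda> L =
     (let B = (SOME B. lattice_basis L (L \<inter> \<Lambda>) B)
      in distr (Pi\<^sub>M B (\<lambda>_. lborel)) borel (\<lambda>t. \<Sum>b\<in>B. t b *\<^sub>R b))"

text \<open>
  The image of \<open>\<Lambda>\<close> in the quotient V/L, as a set of translates of L, and the translated measure
  on such a translate.
\<close>

definition quotient_lattice :: "'a::euclidean_space set \<Rightarrow> 'a set \<Rightarrow> 'a set set" where
  "quotient_lattice \<Lambda> L = (\<lambda>y. (+) y ` L) ` \<Lambda>"

definition coset_measure :: "'a::euclidean_space set \<Rightarrow> 'a set \<Rightarrow> 'a set \<Rightarrow> 'a measure" where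
  "coset_measure \<Lambda> L Y = distr (subspace_measure \<Lambda> L) borel ((+) (SOME y. y \<in> Y))"

definition semi_rational_polyhedron :: "'a::euclidean_space set \<Rightarrow> 'a set \<Rightarrow> bool" where
  "semi_rational_polyhedron \<Lambda> p \<longleftrightarrow>
     (\<exists>H. finite H \<and> fst ` H \<subseteq> dual_lattice \<Lambda> \<and> p = {x. \<forall>(\<mu>, b)\<in>H. blinfun_apply \<mu> x \<le> b})"

definition rational_cone :: "'a::euclidean_space set \<Rightarrow> 'a set \<Rightarrow> bool" where
  "rational_cone \<Lambda> c \<longleftrightarrow>
     (\<exists>H. finite H \<and> H \<subseteq> dual_lattice \<Lambda> \<and> c = {x. \<forall>\<mu>\<in>H. blinfun_apply \<mu> x \<le> 0})"

definition full_dimensional :: "'a::euclidean_space set \<Rightarrow> bool" where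
  "full_dimensional p \<longleftrightarrow> aff_dim p = int DIM('a)"

definition contains_line :: "'a::real_vector set \<Rightarrow> bool" where
  "contains_line p \<longleftrightarrow> (\<exists>a v. v \<noteq> 0 \<and> (\<forall>t::real. a + t *\<^sub>R v \<in> p))"

definition unimodular_cone :: "'a::euclidean_space set \<Rightarrow> 'a set \<Rightarrow> bool" where
  "unimodular_cone \<Lambda> u \<longleftrightarrow>
     (\<exists>A B. lattice_basis UNIV \<Lambda> B \<and> A \<subseteq> B \<and> u = convex_cone hull A)"

definition primitive_vector :: "'a::euclidean_space set \<Rightarrow> 'a \<Rightarrow> bool" where
  "primitive_vector \<Lambda> v \<longleftrightarrow> v \<in> \<Lambda> \<and> v \<noteq> 0 \<and> (\<forall>t::real. 0 < t \<and> t < 1 \<longrightarrow> t *\<^sub>R v \<notin> \<Lambda>)"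

definition edge_generators :: "'a::euclidean_space set \<Rightarrow> 'a set \<Rightarrow> 'a set" where
  "edge_generators \<Lambda> u = {v. primitive_vector \<Lambda> v \<and> (convex_cone hull {v}) face_of u}"

definition dual_basis :: "'a::euclidean_space set \<Rightarrow> ('a \<Rightarrow>\<^sub>L real) set" where
  "dual_basis B =
     {\<eta>. \<exists>v\<in>B. blinfun_apply \<eta> v = 1 \<and> (\<forall>w\<in>B - {v}. blinfun_apply \<eta> w = 0)}"

text \<open>
  Linear span of a set of functions, for a general domain (on which functions do not form an
  instance of \<open>real_vector\<close>) and scalars in the codomain.
\<close>

definition function_span :: "('x \<Rightarrow> 'f::field) set \<Rightarrow> ('x \<Rightarrow> 'f) set" where
  "function_span F = {g. \<exists>(n::nat) r f. (\<forall>i<n. f i \<in> F) \<and> g = (\<lambda>x. \<Sum>i<n. r i * f i x)}"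

definition unimodular_decomposition ::
    "'a::euclidean_space set \<Rightarrow> 'a set \<Rightarrow> 'j set \<Rightarrow> ('j \<Rightarrow> int) \<Rightarrow> ('j \<Rightarrow> 'a set) \<Rightarrow> bool" where
  "unimodular_decomposition \<Lambda> c J \<epsilon> u \<longleftrightarrow>
     finite J \<and>
     (\<forall>j\<in>J. \<epsilon> j \<in> {-1, 1} \<and> unimodular_cone \<Lambda> (u j) \<and> full_dimensional (u j)) \<and>
     (\<lambda>x. indicat_real c x - (\<Sum>j\<in>J. of_int (\<epsilon> j) * indicat_real (u j) x))
       \<in> function_span {indicat_real k | k. rational_cone \<Lambda> k \<and> contains_line k}"

definition Psi :: "'a::euclidean_space set \<Rightarrow> 'j set \<Rightarrow> ('j \<Rightarrow> 'a set) \<Rightarrow> ('a \<Rightarrow>\<^sub>L real) set" where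
  "Psi \<Lambda> J u = (\<Union>j\<in>J. dual_basis (edge_generators \<Lambda> (u j)))"

definition scaleC_dual :: "complex \<Rightarrow> ('a::euclidean_space \<Rightarrow>\<^sub>L complex) \<Rightarrow> ('a \<Rightarrow>\<^sub>L complex)" where
  "scaleC_dual \<tau> \<xi> = blinfun_mult_right \<tau> o\<^sub>L \<xi>"

lemma scaleC_dual_apply [simp]:
  "blinfun_apply (scaleC_dual \<tau> \<xi>) x = \<tau> * blinfun_apply \<xi> x"
  by (simp add: scaleC_dual_def)

definition holomorphic_near_0 :: "(('a::euclidean_space \<Rightarrow>\<^sub>L complex) \<Rightarrow> complex) \<Rightarrow> bool" where
  "holomorphic_near_0 \<phi> \<longleftrightarrow>
     (\<forall>\<^sub>F \<xi> in nhds 0. \<exists>D. (\<phi> has_derivative D) (at \<xi>) \<and> (\<forall>\<tau> h. D (scaleC_dual \<tau> h) = \<tau> * D h))"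

text \<open>
  A meromorphic function is represented by a total function on the complexified dual whose values
  on finitely many hyperplanes \<open>\<langle>\<xi>, w\<rangle> = 0\<close> are irrelevant. Equality of meromorphic functions is
  \<open>germ_eq\<close> for germs at 0, and \<open>rational_eq\<close> for functions defined on the whole space off finitely
  many hyperplanes.
\<close>

definition germ_eq ::
    "(('a::euclidean_space \<Rightarrow>\<^sub>L complex) \<Rightarrow> complex) \<Rightarrow> (('a \<Rightarrow>\<^sub>L complex) \<Rightarrow> complex) \<Rightarrow> bool" where
  "germ_eq f g \<longleftrightarrow>
     (\<exists>W. finite W \<and> 0 \<notin> W \<and>
       (\<forall>\<^sub>F \<xi> in nhds 0. (\<forall>w\<in>W. blinfun_apply \<xi> w \<noteq> 0) \<longrightarrow> f \<xi> = g \<xi>))"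

definition rational_eq ::
    "(('a::euclidean_space \<Rightarrow>\<^sub>L complex) \<Rightarrow> complex) \<Rightarrow> (('a \<Rightarrow>\<^sub>L complex) \<Rightarrow> complex) \<Rightarrow> bool" where
  "rational_eq f g \<longleftrightarrow>
     (\<exists>W. finite W \<and> 0 \<notin> W \<and> (\<forall>\<xi>. (\<forall>w\<in>W. blinfun_apply \<xi> w \<noteq> 0) \<longrightarrow> f \<xi> = g \<xi>))"

definition meromorphic_l :: "(('a::euclidean_space \<Rightarrow>\<^sub>L complex) \<Rightarrow> complex) set" where
  "meromorphic_l =
     {f. \<exists>\<phi> ws. holomorphic_near_0 \<phi> \<and> 0 \<notin> set ws \<and>
           germ_eq f (\<lambda>\<xi>. \<phi> \<xi> / (\<Prod>w\<leftarrow>ws. blinfun_apply \<xi> w))}"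

definition hom_component ::
    "(('a::euclidean_space \<Rightarrow>\<^sub>L complex) \<Rightarrow> complex) \<Rightarrow> int \<Rightarrow> ('a \<Rightarrow>\<^sub>L complex) \<Rightarrow> complex" where
  "hom_component f m \<xi> = fls_nth (laurent_expansion (\<lambda>\<tau>. f (scaleC_dual \<tau> \<xi>)) 0) m"

text \<open>
  Homogeneous polynomials are spanned by products of linear forms; for a negative degree
  the span is zero.
\<close>

definition hom_poly_dual :: "int \<Rightarrow> (('a::euclidean_space \<Rightarrow>\<^sub>L complex) \<Rightarrow> complex) set" where
  "hom_poly_dual k =
     function_span {\<lambda>\<xi>. \<Prod>x\<leftarrow>xs. blinfun_apply \<xi> x | xs. int (length xs) = k}"

definition hom_rational :: "int \<Rightarrow> (('a::euclidean_space \<Rightarrow>\<^sub>L complex) \<Rightarrow> complex) set" where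
  "hom_rational m =
     {\<lambda>\<xi>. P \<xi> / (\<Prod>w\<leftarrow>ws. blinfun_apply \<xi> w) | P ws.
        0 \<notin> set ws \<and> P \<in> hom_poly_dual (m + int (length ws))}"

text \<open>Convergence means absolute convergence of the sum of integrals.\<close>

definition gf_converges ::
    "'a::euclidean_space set \<Rightarrow> 'a set \<Rightarrow> 'a set \<Rightarrow> ('a \<Rightarrow>\<^sub>L complex) \<Rightarrow> bool" where
  "gf_converges \<Lambda> L p \<xi> \<longleftrightarrow>
     (\<forall>Y\<in>quotient_lattice \<Lambda> L.
        set_integrable (coset_measure \<Lambda> L Y) (p \<inter> Y) (\<lambda>x. exp (blinfun_apply \<xi> x))) \<and>
     (\<lambda>Y. set_lebesgue_integral (coset_measure \<Lambda> L Y) (p \<inter> Y)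
            (\<lambda>x. norm (exp (blinfun_apply \<xi> x)))) summable_on quotient_lattice \<Lambda> L"

definition gf_sum ::
    "'a::euclidean_space set \<Rightarrow> 'a set \<Rightarrow> 'a set \<Rightarrow> ('a \<Rightarrow>\<^sub>L complex) \<Rightarrow> complex" where
  "gf_sum \<Lambda> L p \<xi> =
     (\<Sum>\<^sub>\<infinity>Y\<in>quotient_lattice \<Lambda> L.
        set_lebesgue_integral (coset_measure \<Lambda> L Y) (p \<inter> Y) (\<lambda>x. exp (blinfun_apply \<xi> x)))"

text \<open>
  The defining properties of the map \<open>p \<mapsto> S\<^sup>L(p)\<close>. They determine \<open>S\<^sup>L(p)\<close> up to \<open>germ_eq\<close> for
  every semi-rational polyhedron p.
\<close>

definition intermediate_gf ::
    "'a::euclidean_space set \<Rightarrow> 'a set \<Rightarrow> ('a set \<Rightarrow> ('a \<Rightarrow>\<^sub>L complex) \<Rightarrow> complex) \<Rightarrow> bool" where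
  "intermediate_gf \<Lambda> L S \<longleftrightarrow>
     rational_subspace \<Lambda> L \<and>
     (\<forall>p. semi_rational_polyhedron \<Lambda> p \<longrightarrow> S p \<in> meromorphic_l) \<and>
     (\<forall>(n::nat) r p.
        (\<forall>i<n. semi_rational_polyhedron \<Lambda> (p i)) \<and>
        (\<forall>x. (\<Sum>i<n. r i * indicat_real (p i) x) = 0) \<longrightarrow>
        germ_eq (\<lambda>\<xi>. \<Sum>i<n. complex_of_real (r i) * S (p i) \<xi>) (\<lambda>_. 0)) \<and>
     (\<forall>p. semi_rational_polyhedron \<Lambda> p \<and> contains_line p \<longrightarrow> germ_eq (S p) (\<lambda>_. 0)) \<and>
     (\<forall>p \<xi>. semi_rational_polyhedron \<Lambda> p \<and> gf_converges \<Lambda> L p \<xi> \<longrightarrow> S p \<xi> = gf_sum \<Lambda> L p \<xi>)"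

text \<open>For \<open>S = S\<^sup>L\<close> this is the function \<open>M\<^sup>L(s, c)\<close>.\<close>

definition shifted_gf ::
    "('a::euclidean_space set \<Rightarrow> ('a \<Rightarrow>\<^sub>L complex) \<Rightarrow> complex) \<Rightarrow> 'a \<Rightarrow> 'a set \<Rightarrow>
     ('a \<Rightarrow>\<^sub>L complex) \<Rightarrow> complex" where
  "shifted_gf S s c \<xi> = exp (- blinfun_apply \<xi> s) * S ((+) s ` c) \<xi>"

definition step_poly :: "('a::euclidean_space \<Rightarrow>\<^sub>L real) set \<Rightarrow> int \<Rightarrow> ('a \<Rightarrow> real) set" where
  "step_poly \<Psi> k =
     function_span {\<lambda>s. \<Prod>\<eta>\<leftarrow>\<eta>s. frac (blinfun_apply \<eta> s) | \<eta>s.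
        set \<eta>s \<subseteq> \<Psi> \<and> int (length \<eta>s) \<le> k}"

definition hom_poly :: "nat \<Rightarrow> ('a::euclidean_space \<Rightarrow> real) set" where
  "hom_poly r =
     function_span {\<lambda>s. \<Prod>\<eta>\<leftarrow>\<eta>s. blinfun_apply (\<eta> :: 'a \<Rightarrow>\<^sub>L real) s | \<eta>s. length \<eta>s = r}"

definition quasi_poly :: "('a::euclidean_space \<Rightarrow>\<^sub>L real) set \<Rightarrow> int \<Rightarrow> ('a \<Rightarrow> real) set" where
  "quasi_poly \<Psi> q =
     function_span {\<lambda>s. f s * p s | f p k r.
        f \<in> step_poly \<Psi> k \<and> p \<in> hom_poly r \<and> k + int r \<le> q}"

text \<open>
  Membership of the function \<open>(s, \<xi>) \<mapsto> F s \<xi>\<close> in \<open>A \<otimes> B\<close>, where for every s the value \<open>F s\<close> is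
  regarded as a rational function of \<open>\<xi>\<close>.
\<close>

definition in_tensor ::
    "('a::euclidean_space \<Rightarrow> real) set \<Rightarrow> (('a \<Rightarrow>\<^sub>L complex) \<Rightarrow> complex) set \<Rightarrow>
     ('a \<Rightarrow> ('a \<Rightarrow>\<^sub>L complex) \<Rightarrow> complex) \<Rightarrow> bool" where
  "in_tensor A B F \<longleftrightarrow>
     (\<exists>(n::nat) f g. (\<forall>i<n. f i \<in> A \<and> g i \<in> B) \<and>
        (\<forall>s. rational_eq (F s) (\<lambda>\<xi>. \<Sum>i<n. complex_of_real (f i s) * g i \<xi>)))"

text \<open>
  A sign convention. For a unimodular cone u with dual basis \<open>\<eta>\<^sub>j\<close>, the lattice points of
  \<open>s + u\<close> are those with j-th coordinate at least the ceiling of \<open>\<langle>\<eta>\<^sub>j, s\<rangle>\<close>, and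
  the ceiling of t exceeds t by \<open>frac (- t)\<close>. So the step functions that occur are
  \<open>frac (\<langle>- \<eta>\<^sub>j, s\<rangle>)\<close>, not \<open>frac (\<langle>\<eta>\<^sub>j, s\<rangle>)\<close>; the two are different, and neither is a polynomial
  in the other, because \<open>frac (- t) = 1 - frac t\<close> fails for integral t. Step-polynomials are
  therefore taken with respect to the negatives of the dual basis vectors.
\<close>

definition Psi_neg :: "'a::euclidean_space set \<Rightarrow> 'j set \<Rightarrow> ('j \<Rightarrow> 'a set) \<Rightarrow> ('a \<Rightarrow>\<^sub>L real) set" where
  "Psi_neg \<Lambda> J u = uminus ` Psi \<Lambda> J u"

end

theory Submission
  imports Defs
begin

text \<open>
  Modulo cones with lines, which do not contribute, the cone is a signed sum of unimodular cones, so
  the valuation property reduces everything to a cone generated by a lattice basis \<open>B\<close> with dual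
  basis \<open>\<eta>\<^sub>b\<close>. There the sum over lattice points is a product of geometric series, and since the
  ceiling of \<open>t\<close> is \<open>t + frac (- t)\<close>, multiplying by \<open>exp (- \<langle>\<xi>, s\<rangle>)\<close> gives the product over \<open>B\<close> of
  \<open>exp (frac (- \<langle>\<eta>\<^sub>b, s\<rangle>) * \<langle>\<xi>, b\<rangle>) / (1 - exp \<langle>\<xi>, b\<rangle>)\<close>. Each factor is \<open>1 / \<langle>\<xi>, b\<rangle>\<close> times a power
  series whose n-th coefficient has degree n in \<open>\<xi>\<close> and at most n in the fractional part; its
  constant term \<open>- 1\<close> produces exactly the integral of \<open>exp \<langle>\<xi>, x\<rangle>\<close> over the cone. The identities of
  generating functions are transported from the region of convergence to germs at 0 by the identity
  theorem.
\<close>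

section \<open>Unimodular cones\<close>

text \<open>\<open>intermediate_gf\<close> ties \<open>S p\<close> to a sum only where that sum
  converges, and the regions of convergence belonging to different unimodular cones need not meet.
  Hence each cone is first continued on its own to a germ at 0, and only germs are added up.

  Homogeneous components are Laurent coefficients along the lines \<tau> \<mapsto> \<tau> \<xi>.
  Small multiples of \<xi> enter every neighbourhood of 0, so a germ identity controls these
  coefficients for all \<xi> off finitely many hyperplanes. This is how local information yields
  identities of rational functions.

  Membership in a tensor product asks for one finite list of functions valid for all s, whereas germ
  identities are obtained for each s separately, with exceptional hyperplanes of their own. The
  uniformity in s therefore has to come from the explicit power series coefficients.

  The integral has a further obstacle: the normalised measure on V is defined through an arbitrarily
  chosen lattice basis, while every unimodular cone is computed in its own basis. Independence of
  the basis is obtained as a uniqueness theorem for translation-invariant measures.\<close>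

definition coord :: "'a::euclidean_space set \<Rightarrow> 'a \<Rightarrow> 'a \<Rightarrow>\<^sub>L real" where
  "coord B b = Blinfun (\<lambda>x. representation B x b)"

lemma convex_cone_hull_singleton: "convex_cone hull {v} = {t *\<^sub>R v | t. 0 \<le> t}"
proof
  have "convex_cone {t *\<^sub>R v | t. 0 \<le> t}"
    unfolding convex_cone_iff
  proof safe
    show "\<exists>t. 0 = t *\<^sub>R v \<and> 0 \<le> t" by (intro exI[of _ 0]) simp
    fix t t' :: real assume "0 \<le> t" "0 \<le> t'"
    then show "\<exists>r. t *\<^sub>R v + t' *\<^sub>R v = r *\<^sub>R v \<and> 0 \<le> r"
      by (intro exI[of _ "t + t'"]) (simp add: scaleR_add_left)
  next
    fix t c :: real assume "0 \<le> t" "0 \<le> c"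
    then show "\<exists>r. c *\<^sub>R t *\<^sub>R v = r *\<^sub>R v \<and> 0 \<le> r"
      by (intro exI[of _ "c * t"]) simp
  qed
  moreover have "v = 1 *\<^sub>R v \<and> (0::real) \<le> 1" by simp
  ultimately show "convex_cone hull {v} \<subseteq> {t *\<^sub>R v | t. 0 \<le> t}"
    by (intro hull_minimal) blast+
  show "{t *\<^sub>R v | t. 0 \<le> t} \<subseteq> convex_cone hull {v}"
    by (auto intro: convex_cone_hull_mul hull_inc)
qed

section \<open>Coordinates with respect to a basis of V\<close>

locale vs_basis =
  fixes B :: "'a::euclidean_space set"
  assumes independent: "independent B" and span: "span B = UNIV"
begin

lemma finite_B [simp, intro]: "finite B"
  using independent by (rule independent_imp_finite)

lemma card_B: "card B = DIM('a)"
  using dim_eq_card_independent[OF independent] dim_span[of B] by (simp add: span)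

lemma coord_eq: "blinfun_apply (coord B b) x = representation B x b"
proof -
  have "linear (\<lambda>x. representation B x b)"
    using independent span
    by (intro linearI) (simp_all add: representation_add representation_scale)
  then have "bounded_linear (\<lambda>x. representation B x b)"
    by (simp add: linear_conv_bounded_linear)
  then show ?thesis by (simp add: coord_def bounded_linear_Blinfun_apply)
qed

lemma coord_expand: "(\<Sum>b\<in>B. coord B b x *\<^sub>R b) = x"
  using sum_representation_eq[OF independent, of x B] span by (simp add: coord_eq)

lemma coord_basis: "b \<in> B \<Longrightarrow> coord B b' b = (if b' = b then 1 else 0)"
  using representation_basis[OF independent] by (auto simp: coord_eq)

lemma coord_sum: "b \<in> B \<Longrightarrow> coord B b (\<Sum>b\<in>B. f b *\<^sub>R b) = f b"
proof -
  assume b: "b \<in> B"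
  have "coord B b (\<Sum>b\<in>B. f b *\<^sub>R b) = (\<Sum>b'\<in>B. if b = b' then f b' else 0)"
    unfolding blinfun.sum_right blinfun.scaleR_right by (rule sum.cong) (auto simp: coord_basis)
  then show ?thesis using b by simp
qed

lemma coord_eqI: "(\<And>b. b \<in> B \<Longrightarrow> coord B b x = coord B b y) \<Longrightarrow> x = y"
proof -
  assume "\<And>b. b \<in> B \<Longrightarrow> coord B b x = coord B b y"
  then have "(\<Sum>b\<in>B. coord B b x *\<^sub>R b) = (\<Sum>b\<in>B. coord B b y *\<^sub>R b)" by (intro sum.cong) auto
  then show "x = y" by (simp only: coord_expand)
qed

lemma blinfun_expand:
  fixes \<xi> :: "'a \<Rightarrow>\<^sub>L complex"
  shows "\<xi> x = (\<Sum>b\<in>B. of_real (coord B b x) * \<xi> b)"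
proof -
  have "\<xi> x = \<xi> (\<Sum>b\<in>B. coord B b x *\<^sub>R b)" by (simp add: coord_expand)
  then show ?thesis by (simp add: blinfun.sum_right blinfun.scaleR_right scaleR_conv_of_real)
qed

lemma nonzero: "b \<in> B \<Longrightarrow> b \<noteq> 0"
  using independent dependent_zero by blast

lemma nonempty: "B \<noteq> {}"
  using card_B DIM_positive[where 'a = 'a] by auto

text \<open>Passes from generators to inequalities: the latter exhibit translates of the cone as
  semi-rational polyhedra and make the cone a box in coordinates.\<close>

lemma cone_eq: "convex_cone hull B = {x. \<forall>b\<in>B. 0 \<le> coord B b x}"
proof
  have "convex_cone {x. \<forall>b\<in>B. 0 \<le> coord B b x}"
    by (auto simp: convex_cone_iff blinfun.add_right blinfun.scaleR_right)
  then show "convex_cone hull B \<subseteq> {x. \<forall>b\<in>B. 0 \<le> coord B b x}"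
    by (intro hull_minimal) (auto simp: coord_basis)
next
  show "{x. \<forall>b\<in>B. 0 \<le> coord B b x} \<subseteq> convex_cone hull B"
  proof
    fix x assume x: "x \<in> {x. \<forall>b\<in>B. 0 \<le> coord B b x}"
    have "(\<Sum>b\<in>A. coord B b x *\<^sub>R b) \<in> convex_cone hull B" if "A \<subseteq> B" for A
    proof -
      have "finite A" using that finite_B finite_subset by blast
      then show ?thesis using that
      proof induction
        case empty then show ?case by (simp add: convex_cone_hull_contains_0)
      next
        case (insert b A)
        have "coord B b x *\<^sub>R b \<in> convex_cone hull B"
          by (rule convex_cone_hull_mul) (use insert x in \<open>auto intro: hull_inc\<close>)
        then show ?case using insert convex_cone_hull_add by auto
      qed
    qed
    from this[of B] show "x \<in> convex_cone hull B" by (simp add: coord_expand)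
  qed
qed

lemma mem_translate: "x \<in> (+) s ` (convex_cone hull B) \<longleftrightarrow> (\<forall>b\<in>B. coord B b s \<le> coord B b x)"
proof -
  have "x \<in> (+) s ` (convex_cone hull B) \<longleftrightarrow> x - s \<in> convex_cone hull B"
    by (auto simp: image_iff intro: bexI[of _ "x - s"])
  then show ?thesis by (simp add: cone_eq blinfun.diff_right)
qed

end

section \<open>Lattice points, dual vectors and edges of a unimodular cone\<close>

locale vs_lattice_basis = vs_basis +
  fixes \<Lambda>
  assumes lattice: "int_span B = \<Lambda>"
begin

lemma mem_lattice_iff: "x \<in> \<Lambda> \<longleftrightarrow> (\<forall>b\<in>B. coord B b x \<in> \<int>)"
proof
  assume "x \<in> \<Lambda>"
  then obtain z :: "'a \<Rightarrow> int" where "x = (\<Sum>b\<in>B. of_int (z b) *\<^sub>R b)"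
    using lattice by (auto simp: int_span_def)
  then show "\<forall>b\<in>B. coord B b x \<in> \<int>" by (simp add: coord_sum)
next
  assume *: "\<forall>b\<in>B. coord B b x \<in> \<int>"
  have "x = (\<Sum>b\<in>B. of_int \<lfloor>coord B b x\<rfloor> *\<^sub>R b)"
    using * by (subst coord_expand[symmetric]) (auto intro!: sum.cong elim!: Ints_cases)
  then show "x \<in> \<Lambda>" unfolding lattice[symmetric] int_span_def
    by (rule image_eqI[where x = "\<lambda>b. \<lfloor>coord B b x\<rfloor>"]) simp
qed

lemma basis_in_lattice: "b \<in> B \<Longrightarrow> b \<in> \<Lambda>"
  by (simp add: mem_lattice_iff coord_basis)

lemma coord_dual_lattice: "b \<in> B \<Longrightarrow> coord B b \<in> dual_lattice \<Lambda>"
  by (simp add: dual_lattice_def mem_lattice_iff)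

lemma lattice_basisI: "lattice_basis UNIV \<Lambda> B"
  by (simp add: lattice_basis_def independent span lattice)

lemma translate_polyhedron: "semi_rational_polyhedron \<Lambda> ((+) s ` (convex_cone hull B))"
  unfolding semi_rational_polyhedron_def
proof (intro exI conjI)
  let ?H = "(\<lambda>b. (- coord B b, - coord B b s)) ` B"
  show "finite ?H" by simp
  show "fst ` ?H \<subseteq> dual_lattice \<Lambda>"
    using coord_dual_lattice by (auto simp: dual_lattice_def blinfun.minus_left)
  show "(+) s ` (convex_cone hull B) = {x. \<forall>(\<mu>, b)\<in>?H. blinfun_apply \<mu> x \<le> b}"
    by (rule set_eqI) (simp add: mem_translate blinfun.minus_left)
qed

text \<open>\<open>Psi\<close> is built from the bare sets \<open>u j\<close>, and this recovers the
  lattice basis from such a set. The ray through b is a face because coordinates are nonnegative on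
  the cone: if an inner point of a segment has a zero coordinate, so do both ends.\<close>

lemma edge_generators_eq: "edge_generators \<Lambda> (convex_cone hull B) = B"
proof
  show "B \<subseteq> edge_generators \<Lambda> (convex_cone hull B)"
  proof
    fix b assume b: "b \<in> B"
    have prim: "primitive_vector \<Lambda> b"
      unfolding primitive_vector_def
    proof (intro conjI allI impI)
      fix t :: real assume "0 < t \<and> t < 1"
      then have "t \<notin> \<int>" by (auto elim!: Ints_cases)
      then show "t *\<^sub>R b \<notin> \<Lambda>"
        using b by (auto simp: mem_lattice_iff blinfun.scaleR_right coord_basis intro!: bexI[of _ b])
    qed (use b in \<open>auto simp: basis_in_lattice nonzero\<close>)
    have "(convex_cone hull {b}) face_of (convex_cone hull B)"
      unfolding face_of_def
    proof (intro conjI ballI impI)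
      show "convex_cone hull {b} \<subseteq> convex_cone hull B" using b by (simp add: hull_mono)
      show "convex (convex_cone hull {b})" by (rule convex_convex_cone_hull)
      fix x y z
      assume x: "x \<in> convex_cone hull B" and y: "y \<in> convex_cone hull B"
        and z: "z \<in> convex_cone hull {b}" "z \<in> open_segment x y"
      obtain r where r: "z = r *\<^sub>R b" using z by (auto simp: convex_cone_hull_singleton)
      obtain a where a: "0 < a" "a < 1" "z = (1 - a) *\<^sub>R x + a *\<^sub>R y"
        using z(2) by (auto simp: in_segment)
      have *: "coord B b' x = 0 \<and> coord B b' y = 0" if "b' \<in> B" "b' \<noteq> b" for b'
      proof -
        have "(1 - a) * coord B b' x + a * coord B b' y = coord B b' z"
          by (simp add: a(3) blinfun.add_right blinfun.scaleR_right)
        also have "\<dots> = 0" using that b by (simp add: r blinfun.scaleR_right coord_basis)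
        finally have "(1 - a) * coord B b' x + a * coord B b' y = 0" .
        moreover have "0 \<le> (1 - a) * coord B b' x" "0 \<le> a * coord B b' y"
          using x y a that by (auto simp: cone_eq)
        ultimately have "(1 - a) * coord B b' x = 0" "a * coord B b' y = 0" by linarith+
        then show ?thesis using a by simp
      qed
      have ray: "w \<in> convex_cone hull {b}"
        if "w \<in> convex_cone hull B" "\<And>b'. b' \<in> B \<Longrightarrow> b' \<noteq> b \<Longrightarrow> coord B b' w = 0" for w
      proof -
        have "w = coord B b w *\<^sub>R b"
          by (rule coord_eqI) (use that b in \<open>auto simp: blinfun.scaleR_right coord_basis\<close>)
        moreover have "0 \<le> coord B b w" using that b by (auto simp: cone_eq)
        ultimately show ?thesis unfolding convex_cone_hull_singleton by blast
      qed
      show "x \<in> convex_cone hull {b}" "y \<in> convex_cone hull {b}" using * x y ray by auto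
    qed
    with prim show "b \<in> edge_generators \<Lambda> (convex_cone hull B)" by (simp add: edge_generators_def)
  qed
  show "edge_generators \<Lambda> (convex_cone hull B) \<subseteq> B"
  proof
    fix v assume "v \<in> edge_generators \<Lambda> (convex_cone hull B)"
    then have prim: "primitive_vector \<Lambda> v" and face: "(convex_cone hull {v}) face_of (convex_cone hull B)"
      by (auto simp: edge_generators_def)
    have "v \<in> convex_cone hull {v}" by (simp add: hull_inc)
    then have v: "v \<in> convex_cone hull B" using face face_of_imp_subset by blast
    have v0: "v \<noteq> 0" "v \<in> \<Lambda>" using prim by (auto simp: primitive_vector_def)
    then obtain b where b: "b \<in> B" "coord B b v \<noteq> 0"
      using coord_eqI[of v 0] by (auto simp: blinfun.zero_right)
    define n where "n = coord B b v"
    have n: "0 < n" "n \<in> \<int>"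
      using b v v0 by (auto simp: n_def cone_eq mem_lattice_iff order_less_le)
    \<comment> \<open>\<open>v\<close> is the midpoint of \<open>2 w\<close> and
      \<open>(2 n) b\<close>, which both lie in the cone. Unless \<open>w\<close> vanishes, the face
      property puts \<open>b\<close> on the ray of \<open>v\<close>, so \<open>v\<close> is a
      multiple of \<open>b\<close> in either case.\<close>
    define w where "w = v - n *\<^sub>R b"
    have coord_w: "coord B b' w = (if b' = b then 0 else coord B b' v)" if "b' \<in> B" for b'
      using b that by (auto simp: w_def blinfun.diff_right blinfun.scaleR_right coord_basis n_def)
    have "w = 0 \<or> b \<in> convex_cone hull {v}"
    proof (rule disjCI)
      assume nb: "b \<notin> convex_cone hull {v}"
      show "w = 0"
      proof (rule ccontr)
        assume "w \<noteq> 0"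
        have "2 *\<^sub>R w \<in> convex_cone hull B" "(2 * n) *\<^sub>R b \<in> convex_cone hull B"
          using v b n by (auto simp: cone_eq blinfun.scaleR_right coord_w coord_basis)
        moreover have "v \<in> open_segment (2 *\<^sub>R w) ((2 * n) *\<^sub>R b)"
          unfolding in_segment
        proof (intro conjI exI[of _ "1/2"])
          show "2 *\<^sub>R w \<noteq> (2 * n) *\<^sub>R b"
          proof
            assume "2 *\<^sub>R w = (2 * n) *\<^sub>R b"
            then have "coord B b (2 *\<^sub>R w) = coord B b ((2 * n) *\<^sub>R b)" by simp
            then show False using b n by (simp add: blinfun.scaleR_right coord_w coord_basis)
          qed
        qed (simp_all add: w_def)
        ultimately have "(2 * n) *\<^sub>R b \<in> convex_cone hull {v}"
          using face \<open>v \<in> convex_cone hull {v}\<close> unfolding face_of_def by blast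
        then have "(1 / (2 * n)) *\<^sub>R ((2 * n) *\<^sub>R b) \<in> convex_cone hull {v}"
          by (rule convex_cone_hull_mul) (use n in auto)
        then show False using nb n by simp
      qed
    qed
    then have "\<exists>k>0. v = k *\<^sub>R b"
    proof
      assume "w = 0" then show ?thesis using n by (auto simp: w_def)
    next
      assume "b \<in> convex_cone hull {v}"
      then obtain t where t: "b = t *\<^sub>R v" "0 \<le> t" by (auto simp: convex_cone_hull_singleton)
      have "t \<noteq> 0" using t nonzero[OF b(1)] by auto
      then show ?thesis using t by (intro exI[of _ "1/t"]) auto
    qed
    then obtain k where k: "k > 0" "v = k *\<^sub>R b" by blast
    have "k = n" using k b by (simp add: n_def blinfun.scaleR_right coord_basis)
    \<comment> \<open>Here \<open>v = n b\<close>, so \<open>(1 / n) v\<close> is the lattice vector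
      \<open>b\<close>; primitivity excludes n > 1, and n is a positive integer.\<close>
    have "\<not> 1 < n"
    proof
      assume "1 < n"
      then have "(1 / n) *\<^sub>R v \<notin> \<Lambda>" using prim by (auto simp: primitive_vector_def)
      then show False using k \<open>k = n\<close> b basis_in_lattice by simp
    qed
    then have "n = 1" using n by (auto elim!: Ints_cases)
    then show "v \<in> B" using k \<open>k = n\<close> b by simp
  qed
qed

lemma coord_in_dual_basis: "b \<in> B \<Longrightarrow> coord B b \<in> dual_basis (edge_generators \<Lambda> (convex_cone hull B))"
  unfolding edge_generators_eq dual_basis_def by (auto simp: coord_basis intro!: bexI[of _ b])

end

text \<open>The generators \<open>A\<close> may be a proper part of a lattice basis. The cone lies
  in the span of \<open>A\<close>, so full dimension forces \<open>A\<close> to have d elements and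
  to be the whole basis.\<close>

lemma unimodular_cone_basis:
  fixes u :: "'a::euclidean_space set"
  assumes "unimodular_cone \<Lambda> u" "full_dimensional u"
  obtains B where "vs_lattice_basis B \<Lambda>" "u = convex_cone hull B"
proof -
  obtain A B where AB: "lattice_basis UNIV \<Lambda> B" "A \<subseteq> B" "u = convex_cone hull A"
    using assms(1) by (auto simp: unimodular_cone_def)
  interpret vs_lattice_basis B \<Lambda>
    using AB by unfold_locales (auto simp: lattice_basis_def)
  have "convex_cone hull A \<subseteq> span A"
    by (intro hull_minimal) (auto simp: convex_cone_iff span_base span_add span_scale span_zero)
  then have "aff_dim u \<le> aff_dim (span A)" using AB aff_dim_subset by blast
  also have "\<dots> = int (card A)"
    using independent_mono[OF independent AB(2)]
    by (simp add: aff_dim_subspace dim_eq_card_independent)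
  finally have "card B \<le> card A"
    using assms(2) by (simp add: full_dimensional_def card_B)
  then have "A = B" using AB by (simp add: card_seteq)
  then show ?thesis using that AB vs_lattice_basis_axioms by blast
qed

section \<open>Germs of holomorphic functions\<close>

lemma holomorphic_near_0_const: "holomorphic_near_0 (\<lambda>_. c)"
  unfolding holomorphic_near_0_def
  by (intro always_eventually allI exI[of _ "\<lambda>_. 0"]) auto

lemma holomorphic_near_0_mult:
  assumes "holomorphic_near_0 f" "holomorphic_near_0 g"
  shows "holomorphic_near_0 (\<lambda>\<xi>. f \<xi> * g \<xi>)"
  using assms unfolding holomorphic_near_0_def
proof eventually_elim
  case (elim \<xi>)
  then obtain D E where
    D: "(f has_derivative D) (at \<xi>)" "\<And>\<tau> h. D (scaleC_dual \<tau> h) = \<tau> * D h" and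
    E: "(g has_derivative E) (at \<xi>)" "\<And>\<tau> h. E (scaleC_dual \<tau> h) = \<tau> * E h" by blast
  show ?case
    by (rule exI, rule conjI, rule has_derivative_mult[OF D(1) E(1)])
      (simp add: D(2) E(2) algebra_simps)
qed

lemma holomorphic_near_0_diff:
  assumes "holomorphic_near_0 f" "holomorphic_near_0 g"
  shows "holomorphic_near_0 (\<lambda>\<xi>. f \<xi> - g \<xi>)"
  using assms unfolding holomorphic_near_0_def
proof eventually_elim
  case (elim \<xi>)
  then obtain D E where
    D: "(f has_derivative D) (at \<xi>)" "\<And>\<tau> h. D (scaleC_dual \<tau> h) = \<tau> * D h" and
    E: "(g has_derivative E) (at \<xi>)" "\<And>\<tau> h. E (scaleC_dual \<tau> h) = \<tau> * E h" by blast
  show ?case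
    by (rule exI, rule conjI, rule has_derivative_diff[OF D(1) E(1)])
      (simp add: D(2) E(2) algebra_simps)
qed

lemma holomorphic_near_0_prod:
  assumes "\<And>i. i \<in> A \<Longrightarrow> holomorphic_near_0 (f i)"
  shows "holomorphic_near_0 (\<lambda>\<xi>. \<Prod>i\<in>A. f i \<xi>)"
  using assms
  by (induction A rule: infinite_finite_induct)
    (auto intro: holomorphic_near_0_const holomorphic_near_0_mult)

lemma holomorphic_near_0_prod_list:
  assumes "\<And>i. i \<in> set xs \<Longrightarrow> holomorphic_near_0 (f i)"
  shows "holomorphic_near_0 (\<lambda>\<xi>. \<Prod>i\<leftarrow>xs. f i \<xi>)"
  using assms
  by (induction xs) (auto intro: holomorphic_near_0_const holomorphic_near_0_mult)

lemma holomorphic_near_0_compose: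
  assumes "\<And>z. (f has_field_derivative f' z) (at z)"
  shows "holomorphic_near_0 (\<lambda>\<xi>. f (blinfun_apply \<xi> w))"
  unfolding holomorphic_near_0_def
proof (intro always_eventually allI)
  fix \<xi> :: "'a \<Rightarrow>\<^sub>L complex"
  have "((\<lambda>\<xi>. blinfun_apply \<xi> w) has_derivative (\<lambda>h. blinfun_apply h w)) (at \<xi>)"
    by (auto intro!: derivative_eq_intros simp: blinfun.zero_right)
  from has_derivative_compose[OF this, of f] assms[of "\<xi> w"]
  have "((\<lambda>\<xi>. f (blinfun_apply \<xi> w)) has_derivative (\<lambda>h. f' (\<xi> w) * h w)) (at \<xi>)"
    by (simp add: has_field_derivative_def)
  then show "\<exists>D. ((\<lambda>\<xi>. f (blinfun_apply \<xi> w)) has_derivative D) (at \<xi>) \<and>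
                (\<forall>\<tau> h. D (scaleC_dual \<tau> h) = \<tau> * D h)"
    by (intro exI conjI) (auto simp: mult_ac)
qed

lemma holomorphic_near_0_apply: "holomorphic_near_0 (\<lambda>\<xi>. blinfun_apply \<xi> w)"
  by (rule holomorphic_near_0_compose[where f = "\<lambda>z. z"]) (rule DERIV_ident)

lemma bounded_linear_scaleC_dual_left: "bounded_linear (\<lambda>z. scaleC_dual z h)"
  unfolding scaleC_dual_def
  by (rule bounded_linear_compose[OF
      bounded_bilinear.bounded_linear_left[OF bounded_bilinear_blinfun_compose]
      bounded_linear_blinfun_mult_right])

text \<open>The derivative \<open>D\<close> is taken over the reals; its complex homogeneity makes
  the restriction to a complex line complex differentiable, with derivative \<open>D h\<close>. This
  reduces the identity theorem to one variable.\<close>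

lemma holomorphic_near_0_on_line:
  assumes der: "\<And>\<xi>. \<xi> \<in> ball 0 r \<Longrightarrow>
      \<exists>D. (\<Phi> has_derivative D) (at \<xi>) \<and> (\<forall>\<tau> h. D (scaleC_dual \<tau> h) = \<tau> * D h)"
  shows "(\<lambda>z. \<Phi> (\<xi>0 + scaleC_dual z h)) holomorphic_on {z. \<xi>0 + scaleC_dual z h \<in> ball 0 r}"
proof (rule holomorphic_onI)
  fix z assume z: "z \<in> {z. \<xi>0 + scaleC_dual z h \<in> ball 0 r}"
  then obtain D where D: "(\<Phi> has_derivative D) (at (\<xi>0 + scaleC_dual z h))"
      "\<And>\<tau> h. D (scaleC_dual \<tau> h) = \<tau> * D h" using der by blast
  have "((\<lambda>z. \<xi>0 + scaleC_dual z h) has_derivative (\<lambda>t. 0 + scaleC_dual t h)) (at z)"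
    by (intro has_derivative_add has_derivative_const bounded_linear_imp_has_derivative
        bounded_linear_scaleC_dual_left)
  from has_derivative_compose[OF this D(1)]
  have "((\<lambda>z. \<Phi> (\<xi>0 + scaleC_dual z h)) has_derivative (*) (D h)) (at z)"
    by (simp add: D(2) mult.commute[of _ "D h"])
  then show "(\<lambda>z. \<Phi> (\<xi>0 + scaleC_dual z h))
      field_differentiable at z within {z. \<xi>0 + scaleC_dual z h \<in> ball 0 r}"
    unfolding field_differentiable_def has_field_derivative_def
    using has_derivative_at_withinI by blast
qed

section \<open>The identity theorem for germs at 0\<close>

context vs_basis
begin

text \<open>The region where the generating functions of translates of the cone generated by \<open>B\<close>
  converge.\<close>

definition negative_on_basis :: "('a \<Rightarrow>\<^sub>L complex) \<Rightarrow> bool" where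
  "negative_on_basis \<xi> \<longleftrightarrow> (\<forall>b\<in>B. Re (\<xi> b) < 0)"

lemma open_negative_on_basis: "open {\<xi>. negative_on_basis \<xi>}"
proof -
  have "{\<xi>. negative_on_basis \<xi>} = (\<Inter>b\<in>B. {\<xi>. Re (blinfun_apply \<xi> b) < 0})"
    by (auto simp: negative_on_basis_def)
  also have "open \<dots>"
    by (intro open_INT finite_B ballI open_Collect_less continuous_intros)
  finally show ?thesis .
qed

lemma negative_on_basis_near_0:
  assumes "r > 0"
  obtains \<xi> where "negative_on_basis \<xi>" "\<xi> \<in> ball 0 r"
proof -
  define \<xi>1 :: "'a \<Rightarrow>\<^sub>L complex" where
    "\<xi>1 = Blinfun (\<lambda>x. of_real (- (\<Sum>b\<in>B. coord B b x)))"
  have "bounded_linear (\<lambda>x. complex_of_real (- (\<Sum>b\<in>B. blinfun_apply (coord B b) x)))"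
    by (intro bounded_linear_compose[OF bounded_linear_of_real] bounded_linear_minus
        bounded_linear_sum blinfun.bounded_linear_right)
  then have \<xi>1: "\<xi>1 x = of_real (- (\<Sum>b\<in>B. coord B b x))" for x
    by (simp add: \<xi>1_def bounded_linear_Blinfun_apply)
  \<comment> \<open>\<open>\<xi>1\<close> takes the value -1 on every basis vector, so all its
    positive multiples lie in the region. The added 1 keeps the denominator positive.\<close>
  define t where "t = r / (2 * (norm \<xi>1 + 1))"
  have n: "norm \<xi>1 + 1 > 0" by (simp add: add_nonneg_pos)
  have t: "t > 0" using assms n by (simp add: t_def)
  have "norm (t *\<^sub>R \<xi>1) < t * (norm \<xi>1 + 1)" using t by simp
  also have "\<dots> = r / 2" using n by (simp add: t_def field_simps)
  also have "\<dots> < r" using assms by simp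
  finally have "t *\<^sub>R \<xi>1 \<in> ball 0 r" by simp
  moreover have "negative_on_basis (t *\<^sub>R \<xi>1)"
    using t by (simp add: negative_on_basis_def blinfun.scaleR_left \<xi>1 coord_basis sum.delta')
  ultimately show ?thesis using that by blast
qed

text \<open>The identity theorem, by restriction to complex lines through a point of the region.\<close>

lemma holomorphic_near_0_vanish:
  assumes hol: "holomorphic_near_0 \<Phi>"
    and zero: "\<forall>\<^sub>F \<xi> in nhds 0. negative_on_basis \<xi> \<longrightarrow> \<Phi> \<xi> = 0"
  shows "\<forall>\<^sub>F \<xi> in nhds 0. \<Phi> \<xi> = 0"
proof -
  have "\<forall>\<^sub>F \<xi> in nhds 0. (\<exists>D. (\<Phi> has_derivative D) (at \<xi>) \<and> (\<forall>\<tau> h. D (scaleC_dual \<tau> h) = \<tau> * D h))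
      \<and> (negative_on_basis \<xi> \<longrightarrow> \<Phi> \<xi> = 0)"
    using hol zero unfolding holomorphic_near_0_def by eventually_elim blast
  then obtain r where r: "r > 0"
    and der: "\<And>\<xi>. \<xi> \<in> ball 0 r \<Longrightarrow> \<exists>D. (\<Phi> has_derivative D) (at \<xi>) \<and> (\<forall>\<tau> h. D (scaleC_dual \<tau> h) = \<tau> * D h)"
    and z: "\<And>\<xi>. \<xi> \<in> ball 0 r \<Longrightarrow> negative_on_basis \<xi> \<Longrightarrow> \<Phi> \<xi> = 0"
    unfolding eventually_nhds_metric by (auto simp: dist_commute)
  obtain \<xi>0 where \<xi>0: "negative_on_basis \<xi>0" "\<xi>0 \<in> ball 0 r"
    using negative_on_basis_near_0 r by blast
  have "\<Phi> \<xi> = 0" if \<xi>: "\<xi> \<in> ball 0 r" for \<xi>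
  proof -
    \<comment> \<open>The complex line runs from \<open>\<xi>0\<close> in the region (z = 0) to the
      given \<xi> (z = 1). Since \<open>l\<close> is real-affine, \<open>X\<close> is convex and
      hence connected, and the open set \<open>U\<close> contains 0.\<close>
    define l where "l z = \<xi>0 + scaleC_dual z (\<xi> - \<xi>0)" for z
    define X where "X = {z. l z \<in> ball 0 r}"
    define U where "U = {z. l z \<in> ball 0 r \<inter> {\<xi>. negative_on_basis \<xi>}}"
    have bl: "bounded_linear (\<lambda>z. scaleC_dual z (\<xi> - \<xi>0))" by (rule bounded_linear_scaleC_dual_left)
    have cont: "continuous_on UNIV l" unfolding l_def
      by (intro continuous_intros linear_continuous_on bl)
    have openX: "open X" "open U"
      unfolding X_def U_def
      by (rule open_vimage[OF _ cont, unfolded vimage_def];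
          intro open_Int open_ball open_negative_on_basis)+
    have l0: "l 0 = \<xi>0" "l 1 = \<xi>"
      unfolding l_def by (auto intro!: blinfun_eqI simp: blinfun.add_left blinfun.diff_left)
    have "convex X"
    proof (rule convexI)
      fix x y :: complex and u v :: real
      assume xy: "x \<in> X" "y \<in> X" and uv: "0 \<le> u" "0 \<le> v" "u + v = 1"
      have "l (u *\<^sub>R x + v *\<^sub>R y) = (u + v) *\<^sub>R \<xi>0
          + (u *\<^sub>R scaleC_dual x (\<xi> - \<xi>0) + v *\<^sub>R scaleC_dual y (\<xi> - \<xi>0))"
        unfolding l_def using uv(3)
        by (simp add: linear_add[OF bounded_linear.linear[OF bl]]
            linear_scale[OF bounded_linear.linear[OF bl]])
      also have "\<dots> = u *\<^sub>R l x + v *\<^sub>R l y"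
        by (simp add: l_def scaleR_add_left scaleR_add_right)
      finally show "u *\<^sub>R x + v *\<^sub>R y \<in> X"
        using xy uv convexD[OF convex_ball, of "l x" 0 r "l y" u v] by (simp add: X_def)
    qed
    have "(\<lambda>z. \<Phi> (l z)) 1 = 0"
    proof (rule analytic_continuation[of "\<lambda>z. \<Phi> (l z)" X U 0 1])
      show "(\<lambda>z. \<Phi> (l z)) holomorphic_on X"
        unfolding l_def X_def by (rule holomorphic_near_0_on_line[OF der])
      show "connected X" using \<open>convex X\<close> by (rule convex_connected)
      show "0 islimpt U"
        using openX(2) \<xi>0 by (intro interior_limit_point) (auto simp: interior_open U_def l0)
    qed (use openX \<xi> \<xi>0 z in \<open>auto simp: X_def U_def l0\<close>)
    then show ?thesis by (simp add: l0)
  qed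
  then show ?thesis
    using r eventually_nhds_in_open[of "ball 0 r" 0] by (auto elim!: eventually_mono)
qed

text \<open>Denominators are cleared because the identity theorem concerns holomorphic functions.
  \<open>D\<close> need not be a product of linear forms: hypothesis \<open>D0\<close> only asks
  that near 0 its zeros lie on finitely many hyperplanes, which admits factors such as
  \<open>1 - exp (\<xi> b)\<close>.\<close>

lemma germ_eqI_meromorphic:
  assumes f: "f \<in> meromorphic_l"
    and N: "holomorphic_near_0 N" and D: "holomorphic_near_0 D"
    and W: "finite W" "0 \<notin> W"
    and D0: "\<forall>\<^sub>F \<xi> in nhds 0. (\<forall>w\<in>W. blinfun_apply \<xi> w \<noteq> 0) \<longrightarrow> D \<xi> \<noteq> 0"
    and eq: "\<And>\<xi>. negative_on_basis \<xi> \<Longrightarrow> f \<xi> * D \<xi> = N \<xi>"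
  shows "germ_eq f (\<lambda>\<xi>. N \<xi> / D \<xi>)"
proof -
  obtain \<phi> ws W1 where \<phi>: "holomorphic_near_0 \<phi>" "0 \<notin> set ws" "finite W1" "0 \<notin> W1"
    and f: "\<forall>\<^sub>F \<xi> in nhds 0. (\<forall>w\<in>W1. blinfun_apply \<xi> w \<noteq> 0) \<longrightarrow> f \<xi> = \<phi> \<xi> / (\<Prod>w\<leftarrow>ws. \<xi> w)"
    using f unfolding meromorphic_l_def germ_eq_def by blast
  let ?P = "\<lambda>\<xi>. \<Prod>w\<leftarrow>ws. blinfun_apply \<xi> w"
  let ?Q = "\<lambda>\<xi>. \<Prod>w\<in>W1. blinfun_apply \<xi> w"
  have P0: "?P \<xi> = 0 \<longleftrightarrow> (\<exists>w\<in>set ws. \<xi> w = 0)" for \<xi> :: "'a \<Rightarrow>\<^sub>L complex"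
    by (induction ws) auto
  have Q0: "?Q \<xi> = 0 \<longleftrightarrow> (\<exists>w\<in>W1. \<xi> w = 0)" for \<xi> :: "'a \<Rightarrow>\<^sub>L complex"
    using \<phi>(3) by simp
  \<comment> \<open>The extra factors make the function vanish on the exceptional hyperplanes as well, so that the
    identity theorem applies on the whole region.\<close>
  have "\<forall>\<^sub>F \<xi> in nhds 0. (\<phi> \<xi> * D \<xi> - N \<xi> * ?P \<xi>) * ?P \<xi> * ?Q \<xi> = 0"
  proof (rule holomorphic_near_0_vanish)
    show "holomorphic_near_0 (\<lambda>\<xi>. (\<phi> \<xi> * D \<xi> - N \<xi> * ?P \<xi>) * ?P \<xi> * ?Q \<xi>)"
      by (intro holomorphic_near_0_mult holomorphic_near_0_diff holomorphic_near_0_prod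
          holomorphic_near_0_prod_list holomorphic_near_0_apply \<phi> N D)
    show "\<forall>\<^sub>F \<xi> in nhds 0. negative_on_basis \<xi> \<longrightarrow>
        (\<phi> \<xi> * D \<xi> - N \<xi> * ?P \<xi>) * ?P \<xi> * ?Q \<xi> = 0"
      using f
    proof eventually_elim
      case (elim \<xi>)
      show ?case
      proof
        assume "negative_on_basis \<xi>"
        from eq[OF this] elim have "?P \<xi> \<noteq> 0 \<Longrightarrow> ?Q \<xi> \<noteq> 0 \<Longrightarrow> \<phi> \<xi> * D \<xi> = N \<xi> * ?P \<xi>"
          unfolding Q0 by (auto simp: field_simps)
        then show "(\<phi> \<xi> * D \<xi> - N \<xi> * ?P \<xi>) * ?P \<xi> * ?Q \<xi> = 0" by auto
      qed
    qed
  qed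
  then have "\<forall>\<^sub>F \<xi> in nhds 0. (\<forall>w\<in>W1 \<union> set ws \<union> W. blinfun_apply \<xi> w \<noteq> 0) \<longrightarrow> f \<xi> = N \<xi> / D \<xi>"
    using f D0
  proof eventually_elim
    case (elim \<xi>)
    show ?case
    proof
      assume nz: "\<forall>w\<in>W1 \<union> set ws \<union> W. \<xi> w \<noteq> 0"
      then have "?P \<xi> \<noteq> 0" "?Q \<xi> \<noteq> 0" "D \<xi> \<noteq> 0" "f \<xi> = \<phi> \<xi> / ?P \<xi>"
        using elim unfolding P0 Q0 by auto
      then show "f \<xi> = N \<xi> / D \<xi>" using elim(1) by (simp add: frac_eq_eq)
    qed
  qed
  moreover have "finite (W1 \<union> set ws \<union> W)" "0 \<notin> W1 \<union> set ws \<union> W" using \<phi> W by auto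
  ultimately show ?thesis
    unfolding germ_eq_def by (intro exI[of _ "W1 \<union> set ws \<union> W"] conjI)
qed

end

section \<open>Lattice sums over unimodular cones\<close>

text \<open>With n = k + j this is \<open>exp (of_int k * z)\<close> times a geometric series of
  ratio \<open>exp z\<close>, whose modulus is below 1. Absolute summability is what later lets a
  sum over several coordinates factor.\<close>

lemma exp_of_int_sum:
  fixes z :: complex
  assumes "Re z < 0"
  shows exp_of_int_norm_summable: "(\<lambda>n::int. norm (exp (of_int n * z))) summable_on {k..}"
    and exp_of_int_has_sum: "((\<lambda>n::int. exp (of_int n * z)) has_sum (exp (of_int k * z) / (1 - exp z))) {k..}"
proof -
  have bij: "bij_betw (\<lambda>j. k + int j) UNIV {k..}"
    by (rule bij_betwI[where g = "\<lambda>n. nat (n - k)"]) auto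
  have eq: "exp (of_int (k + int j) * z) = exp (of_int k * z) * exp z ^ j" for j
    by (simp add: algebra_simps exp_add flip: exp_of_nat_mult)
  have n: "norm (exp z) < 1" using assms by simp
  have s: "(\<lambda>j. exp (of_int k * z) * exp z ^ j) sums (exp (of_int k * z) * (1 / (1 - exp z)))"
    by (intro sums_mult geometric_sums n)
  have ns: "summable (\<lambda>j. norm (exp (of_int k * z) * exp z ^ j))"
    unfolding norm_mult norm_power using n by (intro summable_mult summable_geometric) simp
  show "(\<lambda>n::int. norm (exp (of_int n * z))) summable_on {k..}"
    using ns by (subst summable_on_reindex_bij_betw[OF bij, symmetric])
      (simp only: eq summable_on_UNIV_nonneg_real_iff norm_ge_zero)
  show "((\<lambda>n::int. exp (of_int n * z)) has_sum (exp (of_int k * z) / (1 - exp z))) {k..}"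
    using norm_summable_imp_has_sum[OF ns s]
    by (subst has_sum_reindex_bij_betw[OF bij, symmetric]) (simp only: eq times_divide_eq_right mult_1_right)
qed

text \<open>The zero space has only the empty lattice basis, which determines the choice in
  \<open>subspace_measure\<close>; the coset measure is then a unit mass, and \<open>gf_sum\<close>
  becomes an ordinary sum over lattice points.\<close>

lemma integral_coset_measure_0:
  fixes \<Lambda> :: "'a::euclidean_space set" and f :: "'a \<Rightarrow> 'b::{banach, second_countable_topology}"
  assumes "lattice_in UNIV \<Lambda>" and [measurable]: "f \<in> borel_measurable borel"
  shows "integrable (coset_measure \<Lambda> {0} {y}) f"
    and "integral\<^sup>L (coset_measure \<Lambda> {0} {y}) f = f y"
proof -
  have basis: "B = {}" if "lattice_basis {0} ({0} \<inter> \<Lambda>) B" for B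
  proof (rule ccontr)
    assume "B \<noteq> {}"
    moreover have "B \<subseteq> {0}" using that span_superset[of B] by (auto simp: lattice_basis_def)
    ultimately have "0 \<in> B" by auto
    then show False using that dependent_zero by (auto simp: lattice_basis_def)
  qed
  have "0 \<in> \<Lambda>" using assms(1)
    by (auto simp: lattice_in_def lattice_basis_def int_span_def intro!: image_eqI[where x = "\<lambda>_. 0"])
  then have "lattice_basis {0} ({0} \<inter> \<Lambda>) {}"
    by (auto simp: lattice_basis_def int_span_def independent_empty)
  then have "(SOME B. lattice_basis {0} ({0} \<inter> \<Lambda>) B) = {}"
    using basis by (metis someI)
  then have m: "subspace_measure \<Lambda> {0} = distr (count_space {\<lambda>_::'a. undefined::real}) borel (\<lambda>_. 0)"
    by (simp add: subspace_measure_def PiM_empty)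
  have c: "coset_measure \<Lambda> {0} {y} = distr (subspace_measure \<Lambda> {0}) borel ((+) y)"
    by (simp add: coset_measure_def)
  show "integrable (coset_measure \<Lambda> {0} {y}) f"
    unfolding c m
    by (simp add: integrable_distr_eq integrable_count_space)
  show "integral\<^sup>L (coset_measure \<Lambda> {0} {y}) f = f y"
    unfolding c m
    by (simp add: integral_distr lebesgue_integral_count_space_finite)
qed

lemma set_integral_coset_measure_0:
  fixes \<Lambda> p :: "'a::euclidean_space set" and f :: "'a \<Rightarrow> 'b::{banach, second_countable_topology}"
  assumes "lattice_in UNIV \<Lambda>" and f: "f \<in> borel_measurable borel"
  shows "set_integrable (coset_measure \<Lambda> {0} {y}) (p \<inter> {y}) f"
    and "set_lebesgue_integral (coset_measure \<Lambda> {0} {y}) (p \<inter> {y}) f = (if y \<in> p then f y else 0)"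
proof -
  have "p \<inter> {y} \<in> sets borel" by (intro borel_closed finite_imp_closed) simp
  then have m: "(\<lambda>x. indicat_real (p \<inter> {y}) x *\<^sub>R f x) \<in> borel_measurable borel"
    using f by measurable
  show "set_integrable (coset_measure \<Lambda> {0} {y}) (p \<inter> {y}) f"
    unfolding set_integrable_def by (rule integral_coset_measure_0[OF assms(1) m])
  show "set_lebesgue_integral (coset_measure \<Lambda> {0} {y}) (p \<inter> {y}) f = (if y \<in> p then f y else 0)"
    unfolding set_lebesgue_integral_def integral_coset_measure_0(2)[OF assms(1) m] by simp
qed

context vs_lattice_basis
begin

text \<open>Product of the closed forms of the geometric series, used for all \<xi>: outside the
  region of convergence it serves as the meromorphic continuation.\<close>

definition lattice_gf :: "'a \<Rightarrow> ('a \<Rightarrow>\<^sub>L complex) \<Rightarrow> complex" where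
  "lattice_gf s \<xi> = (\<Prod>b\<in>B. exp (of_int \<lceil>coord B b s\<rceil> * \<xi> b) / (1 - exp (\<xi> b)))"

text \<open>Coordinates identify the lattice points of the translated cone with a product of integer
  half-lines, over which an absolutely convergent sum of products is the product of the
  sums.\<close>

lemma lattice_gf_sum:
  assumes neg: "negative_on_basis \<xi>"
  shows "gf_converges \<Lambda> {0} ((+) s ` (convex_cone hull B)) \<xi>"
    and "gf_sum \<Lambda> {0} ((+) s ` (convex_cone hull B)) \<xi> = lattice_gf s \<xi>"
proof -
  let ?p = "(+) s ` (convex_cone hull B)"
  let ?e = "\<lambda>b n. exp (of_int n * blinfun_apply \<xi> b)"
  define I where "I = (\<Pi>\<^sub>E b\<in>B. {\<lceil>coord B b s\<rceil>..})"
  define h where "h n = (\<Sum>b\<in>B. real_of_int (n b) *\<^sub>R b)" for n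
  have ch: "coord B b (h n) = of_int (n b)" if "b \<in> B" for n b
    using that by (simp add: h_def coord_sum)
  have mem: "?p \<inter> \<Lambda> = {x. \<forall>b\<in>B. coord B b s \<le> coord B b x \<and> coord B b x \<in> \<int>}"
    by (rule set_eqI) (simp only: Int_iff mem_translate mem_lattice_iff, blast)
  have bij: "bij_betw h I (?p \<inter> \<Lambda>)"
    unfolding mem
  \<comment> \<open>The inverse takes floors, harmless on integral coordinates, and is restricted to
    \<open>B\<close> because the members of \<open>I\<close> are extensional.\<close>
  proof (rule bij_betw_byWitness[where f' = "\<lambda>x. restrict (\<lambda>b. \<lfloor>coord B b x\<rfloor>) B"])
    show "\<forall>n\<in>I. restrict (\<lambda>b. \<lfloor>coord B b (h n)\<rfloor>) B = n"
      by (auto simp: I_def ch fun_eq_iff PiE_def extensional_def)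
    show "\<forall>x\<in>{x. \<forall>b\<in>B. coord B b s \<le> coord B b x \<and> coord B b x \<in> \<int>}.
        h (restrict (\<lambda>b. \<lfloor>coord B b x\<rfloor>) B) = x"
      by (intro ballI coord_eqI) (auto simp: ch)
    show "h ` I \<subseteq> {x. \<forall>b\<in>B. coord B b s \<le> coord B b x \<and> coord B b x \<in> \<int>}"
      by (auto simp: ch I_def ceiling_le_iff PiE_iff)
    show "(\<lambda>x. restrict (\<lambda>b. \<lfloor>coord B b x\<rfloor>) B) `
        {x. \<forall>b\<in>B. coord B b s \<le> coord B b x \<and> coord B b x \<in> \<int>} \<subseteq> I"
      by (auto simp: I_def ceiling_le_iff intro!: PiE_I)
  qed
  have eh: "exp (\<xi> (h n)) = (\<Prod>b\<in>B. ?e b (n b))" for n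
    by (simp add: h_def blinfun.sum_right blinfun.scaleR_right scaleR_conv_of_real exp_sum)
  have sm: "(\<lambda>n. norm (?e b n)) summable_on {k..}" if "b \<in> B" for b k
    using that neg by (intro exp_of_int_norm_summable) (auto simp: negative_on_basis_def)
  have "infsum (\<lambda>n. \<Prod>b\<in>B. ?e b (n b)) I = (\<Prod>b\<in>B. infsum (?e b) {\<lceil>coord B b s\<rceil>..})"
    unfolding I_def by (intro infsum_prod_PiE_abs finite_B sm)
  also have "\<dots> = lattice_gf s \<xi>"
    unfolding lattice_gf_def using neg
    by (intro prod.cong refl infsumI exp_of_int_has_sum) (auto simp: negative_on_basis_def)
  finally have sum: "infsum (\<lambda>x. exp (\<xi> x)) (?p \<inter> \<Lambda>) = lattice_gf s \<xi>"
    using infsum_reindex_bij_betw[OF bij, of "\<lambda>x. exp (\<xi> x)"] by (simp add: eh)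
  have "Infinite_Set_Sum.abs_summable_on (\<lambda>n. \<Prod>b\<in>B. ?e b (n b)) I"
    unfolding I_def using sm
    by (intro abs_summable_on_prod_PiE finite_B) (simp_all flip: abs_summable_equivalent)
  then have "(\<lambda>n. norm (exp (\<xi> (h n)))) summable_on I"
    by (simp add: eh flip: abs_summable_equivalent)
  then have summ: "(\<lambda>x. norm (exp (\<xi> x))) summable_on (?p \<inter> \<Lambda>)"
    using summable_on_reindex_bij_betw[OF bij, of "\<lambda>x. norm (exp (\<xi> x))"] by simp
  have L: "lattice_in UNIV \<Lambda>" using lattice_basisI by (auto simp: lattice_in_def)
  \<comment> \<open>Cosets of the zero space are singletons, so the sum over cosets is a sum over
    \<Lambda> in which lattice points outside the polyhedron contribute 0.\<close>
  have Q: "bij_betw (\<lambda>y. {y}) \<Lambda> (quotient_lattice \<Lambda> {0})"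
    by (auto simp: quotient_lattice_def bij_betw_def inj_on_def)
  have e: "(\<lambda>x. exp (blinfun_apply \<xi> x)) \<in> borel_measurable borel"
    by (intro borel_measurable_continuous_onI continuous_intros)
  have "(\<lambda>x. norm (exp (blinfun_apply \<xi> x))) \<in> borel_measurable borel"
    by (intro borel_measurable_continuous_onI continuous_intros)
  note * = set_integral_coset_measure_0[OF L e] set_integral_coset_measure_0(2)[OF L this]
  have "(\<lambda>y. if y \<in> ?p then norm (exp (\<xi> y)) else 0) summable_on \<Lambda>"
    by (rule summable_on_cong_neutral[THEN iffD1, OF _ _ _ summ]) auto
  then show "gf_converges \<Lambda> {0} ?p \<xi>"
    unfolding gf_converges_def summable_on_reindex_bij_betw[OF Q, symmetric]
    unfolding bij_betw_imp_surj_on[OF Q, symmetric] by (simp only: * ball_simps simp_thms ball_triv)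
  have "infsum (\<lambda>y. if y \<in> ?p then exp (\<xi> y) else 0) \<Lambda> = lattice_gf s \<xi>"
    unfolding sum[symmetric] by (rule infsum_cong_neutral) auto
  then show "gf_sum \<Lambda> {0} ?p \<xi> = lattice_gf s \<xi>"
    unfolding gf_sum_def
    by (subst infsum_reindex_bij_betw[OF Q, symmetric]) (simp only: *)
qed

text \<open>\<open>exp z = 1\<close> only at integral multiples of 2 \<pi> i, and the bound |z| < 1
  leaves only z = 0. So near 0 the poles of \<open>lattice_gf\<close> lie on the hyperplanes defined
  by \<open>B\<close>.\<close>

lemma eventually_exp_factor_nonzero:
  "\<forall>\<^sub>F \<xi> in nhds 0. (\<forall>b\<in>B. blinfun_apply \<xi> b \<noteq> 0) \<longrightarrow> (\<Prod>b\<in>B. 1 - exp (blinfun_apply \<xi> b :: complex)) \<noteq> 0"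
proof -
  have "\<forall>\<^sub>F \<xi> in nhds 0. norm (blinfun_apply \<xi> b :: complex) < 1" for b :: 'a
  proof -
    have "open {\<xi>. norm (blinfun_apply \<xi> b :: complex) < 1}"
      by (intro open_Collect_less continuous_intros)
    from eventually_nhds_in_open[OF this, of 0] show ?thesis by simp
  qed
  then have "\<forall>\<^sub>F \<xi> in nhds 0. \<forall>b\<in>B. norm (blinfun_apply \<xi> b :: complex) < 1"
    by (intro eventually_ball_finite finite_B) simp
  then show ?thesis
  proof eventually_elim
    case (elim \<xi>)
    have "exp (\<xi> b) \<noteq> 1" if "b \<in> B" "\<xi> b \<noteq> 0" for b
    proof
      assume "exp (\<xi> b) = 1"
      moreover have "\<bar>Im (\<xi> b)\<bar> < 2 * pi"
        using elim that abs_Im_le_cmod[of "\<xi> b"] pi_gt3 by fastforce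
      ultimately have "\<xi> b = 0" using exp_complex_eqI[of "\<xi> b" 0] by simp
      then show False using that by simp
    qed
    then show ?case by auto
  qed
qed

lemma germ_eq_lattice_gf:
  assumes "intermediate_gf \<Lambda> {0} S"
  shows "germ_eq (S ((+) s ` (convex_cone hull B))) (lattice_gf s)"
proof -
  let ?p = "(+) s ` (convex_cone hull B)"
  let ?N = "\<lambda>\<xi>. \<Prod>b\<in>B. exp (of_int \<lceil>coord B b s\<rceil> * blinfun_apply \<xi> b)"
  let ?D = "\<lambda>\<xi>. \<Prod>b\<in>B. 1 - exp (blinfun_apply \<xi> b :: complex)"
  have eq: "lattice_gf s = (\<lambda>\<xi>. ?N \<xi> / ?D \<xi>)"
    by (simp add: lattice_gf_def fun_eq_iff prod_dividef)
  show ?thesis unfolding eq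
  proof (rule germ_eqI_meromorphic)
    show "S ?p \<in> meromorphic_l"
      using assms translate_polyhedron by (auto simp: intermediate_gf_def)
    show "holomorphic_near_0 ?N"
      by (intro holomorphic_near_0_prod
          holomorphic_near_0_compose[where f = "\<lambda>z. exp (of_int n * z)" and f' = "\<lambda>z. of_int n * exp (of_int n * z)" for n])
        (auto intro!: derivative_eq_intros)
    show "holomorphic_near_0 ?D"
      by (intro holomorphic_near_0_prod
          holomorphic_near_0_compose[where f = "\<lambda>z. 1 - exp z" and f' = "\<lambda>z. - exp z"])
        (auto intro!: derivative_eq_intros)
    show "finite B" "0 \<notin> B" using nonzero by auto
    show "\<forall>\<^sub>F \<xi> in nhds 0. (\<forall>w\<in>B. blinfun_apply \<xi> w \<noteq> 0) \<longrightarrow> ?D \<xi> \<noteq> 0"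
      by (rule eventually_exp_factor_nonzero)
    show "S ?p \<xi> * ?D \<xi> = ?N \<xi>" if neg: "negative_on_basis \<xi>" for \<xi>
    proof -
      have "exp (\<xi> b) \<noteq> 1" if "b \<in> B" for b
        using neg that by (metis exp_eq_1 less_irrefl negative_on_basis_def)
      then have "?D \<xi> \<noteq> 0" by auto
      moreover have "S ?p \<xi> = ?N \<xi> / ?D \<xi>"
        using assms translate_polyhedron lattice_gf_sum[OF neg] eq by (simp add: intermediate_gf_def)
      ultimately show ?thesis by simp
    qed
  qed
qed

end

section \<open>Integrals over unimodular cones\<close>

text \<open>Integrability comes from the modulus, a decaying real exponential; the value is the
  limit of the integrals over \<open>{0..y}\<close>, where the antiderivative
  \<open>exp (t z) / z\<close> applies.\<close>

lemma integral_exp_halfline: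
  fixes z :: complex
  assumes "Re z < 0"
  shows integrable_exp_halfline: "integrable lborel (\<lambda>t. indicat_real {0..} t *\<^sub>R exp (of_real t * z))"
    and "(LINT t|lborel. indicat_real {0..} t *\<^sub>R exp (of_real t * z)) = - 1 / z"
proof -
  have z: "z \<noteq> 0" using assms by auto
  let ?f = "\<lambda>t. indicat_real {0..} t *\<^sub>R exp (of_real t * z)"
  have lim: "((\<lambda>t. exp (t * Re z)) \<longlongrightarrow> 0) at_top"
    using assms by real_asymp
  have "(\<integral>\<^sup>+t. ennreal (exp (t * Re z)) * indicator {0..} t \<partial>lborel) = 0 - exp (0 * Re z) / Re z"
  proof (rule nn_integral_FTC_atLeast)
    show "((\<lambda>t. exp (t * Re z) / Re z) \<longlongrightarrow> 0) at_top"
      using tendsto_divide[OF lim tendsto_const, of "Re z"] assms by simp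
  qed (use assms in \<open>auto intro!: derivative_eq_intros\<close>)
  moreover have "(\<integral>\<^sup>+t. ennreal (norm (?f t)) \<partial>lborel)
      = (\<integral>\<^sup>+t. ennreal (exp (t * Re z)) * indicator {0..} t \<partial>lborel)"
    by (intro nn_integral_cong) (auto simp: indicator_def)
  ultimately have n: "(\<integral>\<^sup>+t. ennreal (norm (?f t)) \<partial>lborel) < \<infinity>" by simp
  have [measurable]: "(\<lambda>t. exp (complex_of_real t * z)) \<in> borel_measurable borel"
    by (intro borel_measurable_continuous_onI continuous_intros)
  show int: "integrable lborel ?f"
    by (rule integrableI_bounded[OF _ n]) simp
  have L1: "((\<lambda>y. LINT t|lborel. indicator {..y} t *\<^sub>R ?f t) \<longlongrightarrow> (LINT t|lborel. ?f t)) at_top"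
    using int by (intro tendsto_integral_at_top) auto
  have ev: "\<forall>\<^sub>F y in at_top. (exp (of_real y * z) - 1) / z = (LINT t|lborel. indicator {..y} t *\<^sub>R ?f t)"
    using eventually_ge_at_top[of "0::real"]
  proof eventually_elim
    case (elim y)
    have "has_bochner_integral lborel (\<lambda>t. indicator {0..y} t *\<^sub>R exp (of_real t * z))
       (exp (of_real y * z) / z - exp (of_real 0 * z) / z)"
    proof (rule has_bochner_integral_FTC_Icc[OF elim])
      fix t :: real
      have "((\<lambda>w. exp (w * z) / z) has_field_derivative exp (of_real t * z)) (at (of_real t))"
        using z by (auto intro!: derivative_eq_intros)
      then show "((\<lambda>t. exp (of_real t * z) / z) has_vector_derivative exp (of_real t * z)) (at t within {0..y})"
        by (rule has_vector_derivative_real_field)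
    qed (intro continuous_intros)
    moreover have "(\<lambda>t. indicator {0..y} t *\<^sub>R exp (of_real t * z)) = (\<lambda>t. indicator {..y} t *\<^sub>R ?f t)"
      by (auto simp: indicator_def)
    ultimately show ?case by (simp add: has_bochner_integral_integral_eq diff_divide_distrib)
  qed
  have "((\<lambda>y. (exp (complex_of_real y * z) - 1) / z) \<longlongrightarrow> (0 - 1) / z) at_top"
    using lim by (intro tendsto_intros z) (simp add: tendsto_norm_zero_iff[symmetric, where f = "\<lambda>y. exp (complex_of_real y * z)"])
  from tendsto_unique[OF trivial_limit_at_top_linorder L1 Lim_transform_eventually[OF this ev]]
  have "(LINT t|lborel. ?f t) = (0 - 1) / z" .
  then show "(LINT t|lborel. ?f t) = - 1 / z" by simp
qed

section \<open>Translation-invariant measures\<close>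

lemma emeasure_translate:
  fixes \<mu> :: "'a::euclidean_space measure"
  assumes sets: "sets \<mu> = sets borel" and inv: "\<And>y. distr \<mu> borel ((+) y) = \<mu>"
    and A: "A \<in> sets borel"
  shows "emeasure \<mu> {x. x + y \<in> A} = emeasure \<mu> A"
proof -
  have [measurable_cong]: "sets \<mu> = sets borel" by fact
  have "emeasure \<mu> A = emeasure (distr \<mu> borel ((+) y)) A" by (simp add: inv)
  also have "\<dots> = emeasure \<mu> ((+) y -` A \<inter> space \<mu>)"
    by (rule emeasure_distr[OF _ A]) measurable
  also have "(+) y -` A \<inter> space \<mu> = {x. x + y \<in> A}"
    using sets_eq_imp_space_eq[OF sets] by (auto simp: add.commute)
  finally show ?thesis by simp
qed

lemma emeasure_translate_minus:
  fixes \<mu> :: "'a::euclidean_space measure"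
  assumes "sets \<mu> = sets borel" "\<And>y. distr \<mu> borel ((+) y) = \<mu>" "A \<in> sets borel"
  shows "emeasure \<mu> {x. x - y \<in> A} = emeasure \<mu> A"
  using emeasure_translate[OF assms, of "- y"] by simp

text \<open>The standard Fubini argument behind the uniqueness of Haar measure.\<close>

lemma translation_invariant_swap:
  fixes \<mu> \<nu> :: "'a::euclidean_space measure"
  assumes "sigma_finite_measure \<mu>" "sigma_finite_measure \<nu>"
    and sets: "sets \<mu> = sets borel" "sets \<nu> = sets borel"
    and inv: "\<And>y. distr \<mu> borel ((+) y) = \<mu>" "\<And>y. distr \<nu> borel ((+) y) = \<nu>"
    and A [measurable]: "A \<in> sets borel" and B [measurable]: "B \<in> sets borel"
  shows "emeasure \<mu> A * emeasure \<nu> B = emeasure \<mu> B * emeasure \<nu> (uminus ` A)"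
proof -
  interpret \<mu>: sigma_finite_measure \<mu> by fact
  interpret \<nu>: sigma_finite_measure \<nu> by fact
  interpret pair_sigma_finite \<mu> \<nu> ..
  have [measurable_cong]: "sets \<mu> = sets borel" "sets \<nu> = sets borel" by fact+
  have mA: "uminus ` A = {x. - x \<in> A}" by (auto simp: image_iff) (metis minus_minus)
  have UA [measurable]: "{x. - x \<in> A} \<in> sets borel"
    using measurable_sets[of "uminus :: 'a \<Rightarrow> 'a" borel borel A] by (simp add: vimage_def)
  have tr: "emeasure \<mu> {x. x + y \<in> X} = emeasure \<mu> X" "emeasure \<nu> {x. x + y \<in> X} = emeasure \<nu> X"
     "emeasure \<nu> {x. x - y \<in> X} = emeasure \<nu> X"
    if "X \<in> sets borel" for X y
    by (rule emeasure_translate[OF sets(1) inv(1) that] emeasure_translate[OF sets(2) inv(2) that]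
        emeasure_translate_minus[OF sets(2) inv(2) that])+
  have nn: "(\<integral>\<^sup>+x. indicator X x \<partial>\<mu>) = emeasure \<mu> X" "(\<integral>\<^sup>+x. indicator X x \<partial>\<nu>) = emeasure \<nu> X"
    if "X \<in> sets borel" for X
    using that sets by simp_all
  \<comment> \<open>Translate \<open>B\<close> by -x in the \<nu>-integral, exchange, replace x by x
    - y in the \<mu>-integral, and exchange back. What remains in y is the set x - A, whose
    \<nu>-mass is that of -A by invariance.\<close>
  have "emeasure \<mu> A * emeasure \<nu> B = (\<integral>\<^sup>+x. indicator A x * emeasure \<nu> B \<partial>\<mu>)"
    by (simp add: nn_integral_multc nn)
  also have "\<dots> = (\<integral>\<^sup>+x. (\<integral>\<^sup>+y. indicator A x * indicator B (x + y) \<partial>\<nu>) \<partial>\<mu>)"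
  proof (rule nn_integral_cong)
    fix x
    have [measurable]: "{y. y + x \<in> B} \<in> sets borel"
      using measurable_sets[of "\<lambda>y. y + x" borel borel B] by (simp add: vimage_def)
    have "(\<integral>\<^sup>+y. indicator A x * indicator B (x + y) \<partial>\<nu>) = (\<integral>\<^sup>+y. indicator A x * indicator {y. y + x \<in> B} y \<partial>\<nu>)"
      by (intro nn_integral_cong) (auto simp: indicator_def add.commute)
    then show "indicator A x * emeasure \<nu> B = (\<integral>\<^sup>+y. indicator A x * indicator B (x + y) \<partial>\<nu>)"
      by (simp add: nn_integral_cmult nn tr)
  qed
  also have "\<dots> = (\<integral>\<^sup>+y. (\<integral>\<^sup>+x. indicator A x * indicator B (x + y) \<partial>\<mu>) \<partial>\<nu>)"
    by (rule Fubini'[symmetric]) measurable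
  also have "\<dots> = (\<integral>\<^sup>+y. (\<integral>\<^sup>+x. indicator A (x - y) * indicator B x \<partial>\<mu>) \<partial>\<nu>)"
  proof (rule nn_integral_cong)
    fix y
    have "(\<integral>\<^sup>+x. indicator A (x - y) * indicator B x \<partial>\<mu>)
        = (\<integral>\<^sup>+x. indicator A (x - y) * indicator B x \<partial>distr \<mu> borel ((+) y))"
      by (simp only: inv)
    also have "\<dots> = (\<integral>\<^sup>+x. indicator A (y + x - y) * indicator B (y + x) \<partial>\<mu>)"
      by (intro nn_integral_distr) measurable
    finally show "(\<integral>\<^sup>+x. indicator A x * indicator B (x + y) \<partial>\<mu>)
        = (\<integral>\<^sup>+x. indicator A (x - y) * indicator B x \<partial>\<mu>)"
      by (simp add: add.commute)
  qed
  also have "\<dots> = (\<integral>\<^sup>+x. (\<integral>\<^sup>+y. indicator A (x - y) * indicator B x \<partial>\<nu>) \<partial>\<mu>)"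
    by (rule Fubini') measurable
  also have "\<dots> = (\<integral>\<^sup>+x. emeasure \<nu> (uminus ` A) * indicator B x \<partial>\<mu>)"
  proof (rule nn_integral_cong)
    fix x
    have E: "{y. y - x \<in> {x. - x \<in> A}} \<in> sets borel"
      using measurable_sets[of "\<lambda>y. y - x" borel borel "{x. - x \<in> A}"] by (simp add: vimage_def)
    have "(\<integral>\<^sup>+y. indicator A (x - y) * indicator B x \<partial>\<nu>)
        = (\<integral>\<^sup>+y. indicator {y. y - x \<in> {x. - x \<in> A}} y * indicator B x \<partial>\<nu>)"
      by (intro nn_integral_cong) (auto simp: indicator_def)
    also have "\<dots> = emeasure \<nu> (uminus ` A) * indicator B x"
      unfolding mA tr(3)[OF UA, of x, symmetric] nn(2)[OF E, symmetric]
      by (intro nn_integral_multc) (use E in measurable)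
    finally show "(\<integral>\<^sup>+y. indicator A (x - y) * indicator B x \<partial>\<nu>) = emeasure \<nu> (uminus ` A) * indicator B x" .
  qed
  also have "\<dots> = emeasure \<mu> B * emeasure \<nu> (uminus ` A)"
    by (simp add: nn_integral_cmult nn mult.commute[of "emeasure \<nu> (uminus ` A)"] nn_integral_multc)
  finally show ?thesis .
qed

text \<open>\<open>F\<close> is the disjoint union of the pieces F \<inter> (G + y) over lattice
  vectors y. Shifted back by y, these become the pieces (F - y) \<inter> G, which partition
  \<open>G\<close> since \<Lambda> is closed under negation.\<close>

lemma fundamental_domain_emeasure_eq:
  fixes \<mu> :: "'a::euclidean_space measure"
  assumes sets: "sets \<mu> = sets borel" and inv: "\<And>y. distr \<mu> borel ((+) y) = \<mu>"
    and F: "F \<in> sets borel" "G \<in> sets borel"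
    and \<Lambda>: "countable \<Lambda>" "\<And>x. x \<in> \<Lambda> \<Longrightarrow> - x \<in> \<Lambda>"
    and dom: "\<And>x. \<exists>!y. y \<in> \<Lambda> \<and> x - y \<in> F" "\<And>x. \<exists>!y. y \<in> \<Lambda> \<and> x - y \<in> G"
  shows "emeasure \<mu> F = emeasure \<mu> G"
proof -
  have m: "{x. x - y \<in> X} \<in> sets \<mu>" if "X \<in> sets borel" for X y
    using measurable_sets[of "\<lambda>x. x - y" borel borel X] that sets by (simp add: vimage_def)
  have *: "emeasure \<mu> X = (\<integral>\<^sup>+y. emeasure \<mu> (X \<inter> {x. x - y \<in> Y}) \<partial>count_space \<Lambda>)"
    if XY: "X \<in> sets borel" "Y \<in> sets borel" and dom: "\<And>x. \<exists>!y. y \<in> \<Lambda> \<and> x - y \<in> Y" for X Y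
  proof -
    have "X = (\<Union>y\<in>\<Lambda>. X \<inter> {x. x - y \<in> Y})" using dom by blast
    moreover have "disjoint_family_on (\<lambda>y. X \<inter> {x. x - y \<in> Y}) \<Lambda>"
      using dom by (auto simp: disjoint_family_on_def)
    moreover have "X \<inter> {x. x - y \<in> Y} \<in> sets \<mu>" for y using m[OF XY(2)] XY(1) sets by auto
    ultimately show ?thesis using emeasure_UN_countable[of \<Lambda> "\<lambda>y. X \<inter> {x. x - y \<in> Y}" \<mu>] \<Lambda>(1) by simp
  qed
  have bij: "bij_betw uminus \<Lambda> \<Lambda>"
    using \<Lambda>(2) by (intro bij_betwI[where g = uminus]) auto
  have "emeasure \<mu> F = (\<integral>\<^sup>+y. emeasure \<mu> (F \<inter> {x. x - y \<in> G}) \<partial>count_space \<Lambda>)"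
    by (rule *) fact+
  also have "\<dots> = (\<integral>\<^sup>+y. emeasure \<mu> (G \<inter> {x. x - - y \<in> F}) \<partial>count_space \<Lambda>)"
  proof (rule nn_integral_cong)
    fix y
    have "{x. x - y \<in> G \<inter> {x. x - - y \<in> F}} = F \<inter> {x. x - y \<in> G}" by auto
    moreover have "G \<inter> {x. x - - y \<in> F} \<in> sets borel" using m[OF F(1)] F(2) sets by blast
    ultimately show "emeasure \<mu> (F \<inter> {x. x - y \<in> G}) = emeasure \<mu> (G \<inter> {x. x - - y \<in> F})"
      using emeasure_translate_minus[OF sets inv, of "G \<inter> {x. x - - y \<in> F}" y] by simp
  qed
  also have "\<dots> = (\<integral>\<^sup>+y. emeasure \<mu> (G \<inter> {x. x - y \<in> F}) \<partial>count_space \<Lambda>)"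
    by (rule nn_integral_bij_count_space[OF bij])
  also have "\<dots> = emeasure \<mu> G"
    by (rule *[symmetric]) fact+
  finally show ?thesis .
qed

text \<open>The measure in \<open>subspace_measure\<close>, with an explicit basis in place of the
  chosen one.\<close>

definition basis_measure :: "'a::euclidean_space set \<Rightarrow> 'a measure" where
  "basis_measure B = distr (Pi\<^sub>M B (\<lambda>_. lborel)) borel (\<lambda>t. \<Sum>b\<in>B. t b *\<^sub>R b)"

lemma sets_basis_measure [simp, measurable_cong]: "sets (basis_measure B) = sets borel"
  by (simp add: basis_measure_def)

lemma space_basis_measure [simp]: "space (basis_measure B) = UNIV"
  by (simp add: basis_measure_def)

context vs_basis
begin

lemma measurable_basis_sum [measurable]:
  "(\<lambda>t. \<Sum>b\<in>B. t b *\<^sub>R b) \<in> borel_measurable (Pi\<^sub>M B (\<lambda>_. lborel))"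
  by measurable

lemma box_borel:
  assumes "\<And>b. b \<in> B \<Longrightarrow> X b \<in> sets borel"
  shows "{x. \<forall>b\<in>B. coord B b x \<in> X b} \<in> sets borel"
proof -
  have "{x. \<forall>b\<in>B. coord B b x \<in> X b} = (\<Inter>b\<in>B. (\<lambda>x. coord B b x) -` X b)" by auto
  also have "\<dots> \<in> sets borel"
  proof (intro sets.finite_INT finite_B nonempty)
    fix b assume b: "b \<in> B"
    have "(\<lambda>x. blinfun_apply (coord B b) x) \<in> borel_measurable borel"
      by (intro borel_measurable_continuous_onI continuous_intros)
    from measurable_sets[OF this assms[OF b]]
    show "(\<lambda>x. coord B b x) -` X b \<in> sets borel" by simp
  qed
  finally show ?thesis .
qed

lemma emeasure_basis_measure_box:
  assumes X: "\<And>b. b \<in> B \<Longrightarrow> X b \<in> sets borel"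
  shows "emeasure (basis_measure B) {x. \<forall>b\<in>B. coord B b x \<in> X b} = (\<Prod>b\<in>B. emeasure lborel (X b))"
proof -
  interpret product_sigma_finite "\<lambda>_::'a. lborel :: real measure" ..
  have "emeasure (basis_measure B) {x. \<forall>b\<in>B. coord B b x \<in> X b}
      = emeasure (Pi\<^sub>M B (\<lambda>_. lborel)) ((\<lambda>t. \<Sum>b\<in>B. t b *\<^sub>R b) -` {x. \<forall>b\<in>B. coord B b x \<in> X b} \<inter> space (Pi\<^sub>M B (\<lambda>_. lborel)))"
    unfolding basis_measure_def by (intro emeasure_distr measurable_basis_sum box_borel X)
  also have "(\<lambda>t. \<Sum>b\<in>B. t b *\<^sub>R b) -` {x. \<forall>b\<in>B. coord B b x \<in> X b} \<inter> space (Pi\<^sub>M B (\<lambda>_. lborel)) = Pi\<^sub>E B X"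
    by (auto simp: coord_sum space_PiM PiE_iff)
  also have "emeasure (Pi\<^sub>M B (\<lambda>_. lborel)) (Pi\<^sub>E B X) = (\<Prod>b\<in>B. emeasure lborel (X b))"
    by (intro emeasure_PiM) (auto simp: X)
  finally show ?thesis .
qed

lemma sigma_finite_basis_measure: "sigma_finite_measure (basis_measure B)"
proof
  let ?A = "\<lambda>n::nat. {x. \<forall>b\<in>B. coord B b x \<in> {- real n..real n}}"
  have "x \<in> (\<Union>n. ?A n)" for x
  proof -
    obtain n :: nat where "Max ((\<lambda>b. \<bar>coord B b x\<bar>) ` B) \<le> real n" using real_arch_simple by blast
    then have "\<forall>b\<in>B. \<bar>coord B b x\<bar> \<le> real n" using nonempty by simp
    then have "x \<in> ?A n" by (auto simp: abs_le_iff)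
    then show ?thesis by blast
  qed
  then have "\<Union>(range ?A) = UNIV" by blast
  moreover have "emeasure (basis_measure B) (?A n) \<noteq> \<infinity>" for n
    by (subst emeasure_basis_measure_box) (auto simp: power_eq_top_ennreal)
  moreover have "?A n \<in> sets borel" for n by (intro box_borel) simp
  ultimately show "\<exists>A. countable A \<and> A \<subseteq> sets (basis_measure B) \<and> \<Union>A = space (basis_measure B) \<and>
      (\<forall>a\<in>A. emeasure (basis_measure B) a \<noteq> \<infinity>)"
    by (intro exI[of _ "range ?A"]) auto
qed

text \<open>In coordinates the translation acts on each factor separately, and a product measure is
  determined by its values on boxes, so invariance of one-dimensional Lebesgue measure
  suffices.\<close>

lemma basis_measure_translate: "distr (basis_measure B) borel ((+) y) = basis_measure B"
proof -
  interpret product_sigma_finite "\<lambda>_::'a. lborel :: real measure" ..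
  let ?P = "Pi\<^sub>M B (\<lambda>_. lborel :: real measure)"
  let ?h = "\<lambda>t. \<lambda>b\<in>B. coord B b y + t b"
  have h [measurable]: "?h \<in> measurable ?P ?P" by measurable
  have "distr ?P ?P ?h = ?P"
  proof (rule PiM_eqI)
    fix A :: "'a \<Rightarrow> real set" assume A: "\<And>b. b \<in> B \<Longrightarrow> A b \<in> sets lborel"
    have [measurable]: "(\<lambda>x. c + x) -` A b \<in> sets borel" if "b \<in> B" for b c
      using measurable_sets[of "\<lambda>x. c + x" borel borel "A b"] A[OF that] by simp
    have "emeasure (distr ?P ?P ?h) (Pi\<^sub>E B A) = emeasure ?P (?h -` Pi\<^sub>E B A \<inter> space ?P)"
      using A by (intro emeasure_distr h) auto
    also have "?h -` Pi\<^sub>E B A \<inter> space ?P = Pi\<^sub>E B (\<lambda>b. (\<lambda>x. coord B b y + x) -` A b)"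
      by (auto simp: space_PiM PiE_iff)
    also have "emeasure ?P \<dots> = (\<Prod>b\<in>B. emeasure lborel ((\<lambda>x. coord B b y + x) -` A b))"
      by (intro emeasure_PiM) auto
    also have "\<dots> = (\<Prod>b\<in>B. emeasure lborel (A b))"
    proof (rule prod.cong[OF refl])
      fix b assume "b \<in> B"
      then have "emeasure (distr lborel borel ((+) (coord B b y))) (A b) = emeasure lborel ((+) (coord B b y) -` A b)"
        using A by (subst emeasure_distr) auto
      then show "emeasure lborel ((\<lambda>x. coord B b y + x) -` A b) = emeasure lborel (A b)"
        by (simp add: lborel_distr_plus)
    qed
    finally show "emeasure (distr ?P ?P ?h) (Pi\<^sub>E B A) = (\<Prod>b\<in>B. emeasure lborel (A b))" .
  qed auto
  then have "basis_measure B = distr (distr ?P ?P ?h) borel (\<lambda>t. \<Sum>b\<in>B. t b *\<^sub>R b)"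
    by (simp add: basis_measure_def)
  also have "\<dots> = distr ?P borel ((\<lambda>t. \<Sum>b\<in>B. t b *\<^sub>R b) \<circ> ?h)"
    by (intro distr_distr measurable_basis_sum h)
  also have "(\<lambda>t. \<Sum>b\<in>B. t b *\<^sub>R b) \<circ> ?h = (+) y \<circ> (\<lambda>t. \<Sum>b\<in>B. t b *\<^sub>R b)"
    by (simp add: fun_eq_iff scaleR_add_left sum.distrib coord_expand)
  also have "distr ?P borel \<dots> = distr (basis_measure B) borel ((+) y)"
    unfolding basis_measure_def by (intro distr_distr[symmetric] measurable_basis_sum) measurable
  finally show ?thesis ..
qed

end

section \<open>Fundamental domains and independence of the lattice basis\<close>

context vs_lattice_basis
begin

text \<open>Half-open, so that the lattice translates cover V without overlapping.\<close>

definition fundamental_domain :: "'a set" where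
  "fundamental_domain = {x. \<forall>b\<in>B. coord B b x \<in> {0..<1}}"

lemma fundamental_domain_borel: "fundamental_domain \<in> sets borel"
  unfolding fundamental_domain_def by (intro box_borel) simp

lemma emeasure_fundamental_domain: "emeasure (basis_measure B) fundamental_domain = 1"
  unfolding fundamental_domain_def by (subst emeasure_basis_measure_box) auto

lemma fundamental_domain_ex1: "\<exists>!y. y \<in> \<Lambda> \<and> x - y \<in> fundamental_domain"
proof
  let ?y = "\<Sum>b\<in>B. of_int \<lfloor>coord B b x\<rfloor> *\<^sub>R b"
  show "?y \<in> \<Lambda> \<and> x - ?y \<in> fundamental_domain"
    by (auto simp: mem_lattice_iff coord_sum fundamental_domain_def blinfun.diff_right) linarith+
  fix y assume y: "y \<in> \<Lambda> \<and> x - y \<in> fundamental_domain"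
  show "y = ?y"
  proof (rule coord_eqI)
    fix b assume b: "b \<in> B"
    obtain n where n: "coord B b y = of_int n" using y b by (auto simp: mem_lattice_iff elim!: Ints_cases)
    have "0 \<le> coord B b x - of_int n" "coord B b x - of_int n < 1"
      using y b n by (auto simp: fundamental_domain_def blinfun.diff_right)
    then have "\<lfloor>coord B b x\<rfloor> = n" by linarith
    then show "coord B b y = coord B b ?y" using b n by (simp add: coord_sum)
  qed
qed

lemma countable_lattice: "countable \<Lambda>"
proof -
  have "\<Lambda> \<subseteq> (\<lambda>n. \<Sum>b\<in>B. of_int (n b) *\<^sub>R b) ` (Pi\<^sub>E B (\<lambda>_. UNIV :: int set))"
  proof
    fix x assume "x \<in> \<Lambda>"
    then obtain z :: "'a \<Rightarrow> int" where "x = (\<Sum>b\<in>B. of_int (z b) *\<^sub>R b)"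
      unfolding lattice[symmetric] int_span_def by blast
    then have "x = (\<Sum>b\<in>B. of_int (restrict z B b) *\<^sub>R b)" by simp
    then show "x \<in> (\<lambda>n. \<Sum>b\<in>B. of_int (n b) *\<^sub>R b) ` (Pi\<^sub>E B (\<lambda>_. UNIV :: int set))"
      by (rule image_eqI[where x = "restrict z B"]) auto
  qed
  then show ?thesis by (rule countable_subset) (intro countable_image countable_PiE finite_B countableI_type)
qed

lemma lattice_uminus: "x \<in> \<Lambda> \<Longrightarrow> - x \<in> \<Lambda>"
  by (simp add: mem_lattice_iff blinfun.minus_right)

end

text \<open>Both measures give the fundamental domain of \<open>C\<close> mass 1, since any two fundamental domains of
  \<open>\<Lambda>\<close> have the same mass; no change of variables by an integral matrix is needed.\<close>

lemma basis_measure_unique: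
  assumes "vs_lattice_basis B \<Lambda>" "vs_lattice_basis C \<Lambda>"
  shows "basis_measure B = basis_measure C"
proof -
  interpret B: vs_lattice_basis B \<Lambda> by fact
  interpret C: vs_lattice_basis C \<Lambda> by fact
  note swap = translation_invariant_swap[OF _ C.sigma_finite_basis_measure sets_basis_measure
      sets_basis_measure _ C.basis_measure_translate _ C.fundamental_domain_borel]
  have "emeasure (basis_measure B) C.fundamental_domain = 1"
    using fundamental_domain_emeasure_eq[OF sets_basis_measure B.basis_measure_translate
      C.fundamental_domain_borel B.fundamental_domain_borel B.countable_lattice B.lattice_uminus
      C.fundamental_domain_ex1 B.fundamental_domain_ex1]
    by (simp add: B.emeasure_fundamental_domain)
  \<comment> \<open>In \<open>swap\<close> the second set is the fundamental domain of
    \<open>C\<close>, of mass 1 for both measures. Hence both values on \<open>A\<close> equal the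
    mass that \<open>basis_measure C\<close> gives to -A.\<close>
  then have "emeasure (basis_measure B) A = emeasure (basis_measure C) A" if "A \<in> sets borel" for A
    using swap[OF B.sigma_finite_basis_measure B.basis_measure_translate that]
      swap[OF C.sigma_finite_basis_measure C.basis_measure_translate that]
    by (simp add: C.emeasure_fundamental_domain)
  then show ?thesis by (intro measure_eqI) auto
qed

section \<open>The exponential integral over a unimodular cone\<close>

context vs_lattice_basis
begin

text \<open>Two arbitrary choices are hidden on the left: the lattice basis, harmless by
  \<open>basis_measure_unique\<close>, and the representative of the coset, absorbed by translation
  invariance.\<close>

lemma coset_measure_UNIV: "coset_measure \<Lambda> UNIV UNIV = basis_measure B"
proof -
  let ?C = "SOME B. lattice_basis UNIV (UNIV \<inter> \<Lambda>) B"
  have "lattice_basis UNIV (UNIV \<inter> \<Lambda>) ?C"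
    by (rule someI[of _ B]) (simp add: lattice_basisI)
  then have C: "vs_lattice_basis ?C \<Lambda>"
    by unfold_locales (auto simp: lattice_basis_def)
  have "subspace_measure \<Lambda> UNIV = basis_measure ?C"
    by (simp add: subspace_measure_def basis_measure_def Let_def)
  also have "\<dots> = basis_measure B"
    using basis_measure_unique[OF C vs_lattice_basis_axioms] .
  finally show ?thesis by (simp add: coset_measure_def basis_measure_translate)
qed

text \<open>In the coordinates of \<open>B\<close> the cone is an orthant and the exponential a
  product, so the integral factors into half-line integrals. No determinant appears because the
  measure is taken in the same basis.\<close>

lemma integral_exp_cone:
  assumes neg: "negative_on_basis \<xi>"
  shows "set_integrable (basis_measure B) (convex_cone hull B) (\<lambda>x. exp (\<xi> x))"
    and "set_lebesgue_integral (basis_measure B) (convex_cone hull B) (\<lambda>x. exp (\<xi> x)) = (\<Prod>b\<in>B. - 1 / \<xi> b)"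
proof -
  interpret product_sigma_finite "\<lambda>_::'a. lborel :: real measure" ..
  let ?P = "Pi\<^sub>M B (\<lambda>_. lborel :: real measure)"
  let ?g = "\<lambda>b t. indicat_real {0..} t *\<^sub>R exp (of_real t * blinfun_apply \<xi> b)"
  have box: "convex_cone hull B = {x. \<forall>b\<in>B. coord B b x \<in> {0..}}" by (simp add: cone_eq)
  have "(\<lambda>x. exp (blinfun_apply \<xi> x)) \<in> borel_measurable borel"
    by (intro borel_measurable_continuous_onI continuous_intros)
  moreover have "convex_cone hull B \<in> sets borel"
    unfolding box by (intro box_borel) simp
  ultimately have m: "(\<lambda>x. indicat_real (convex_cone hull B) x *\<^sub>R exp (\<xi> x)) \<in> borel_measurable borel"
    by measurable
  have ig: "integrable lborel (?g b)" "integral\<^sup>L lborel (?g b) = - 1 / \<xi> b" if "b \<in> B" for b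
    using integral_exp_halfline[of "\<xi> b"] neg that by (auto simp: negative_on_basis_def)
  have eq: "indicat_real (convex_cone hull B) (\<Sum>b\<in>B. t b *\<^sub>R b) *\<^sub>R exp (\<xi> (\<Sum>b\<in>B. t b *\<^sub>R b))
      = (\<Prod>b\<in>B. ?g b (t b))" for t
  proof -
    have "exp (\<xi> (\<Sum>b\<in>B. t b *\<^sub>R b)) = (\<Prod>b\<in>B. exp (of_real (t b) * \<xi> b))"
      by (simp add: blinfun.sum_right blinfun.scaleR_right scaleR_conv_of_real exp_sum)
    moreover have "complex_of_real (indicat_real (convex_cone hull B) (\<Sum>b\<in>B. t b *\<^sub>R b))
        = (\<Prod>b\<in>B. of_real (indicat_real {0..} (t b)))"
      by (auto simp: box coord_sum indicator_def)
    ultimately show ?thesis by (simp add: scaleR_conv_of_real prod.distrib)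
  qed
  show "set_integrable (basis_measure B) (convex_cone hull B) (\<lambda>x. exp (\<xi> x))"
    unfolding set_integrable_def basis_measure_def
    by (subst integrable_distr_eq[OF measurable_basis_sum m])
      (unfold eq, intro product_integrable_prod finite_B ig)
  have "integral\<^sup>L (basis_measure B) (\<lambda>x. indicat_real (convex_cone hull B) x *\<^sub>R exp (\<xi> x))
      = integral\<^sup>L ?P (\<lambda>t. \<Prod>b\<in>B. ?g b (t b))"
    unfolding basis_measure_def by (subst integral_distr[OF measurable_basis_sum m]) (unfold eq, rule refl)
  also have "\<dots> = (\<Prod>b\<in>B. integral\<^sup>L lborel (?g b))"
    by (intro product_integral_prod finite_B ig)
  also have "\<dots> = (\<Prod>b\<in>B. - 1 / \<xi> b)" by (intro prod.cong refl ig)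
  finally show "set_lebesgue_integral (basis_measure B) (convex_cone hull B) (\<lambda>x. exp (\<xi> x)) = (\<Prod>b\<in>B. - 1 / \<xi> b)"
    by (simp add: set_lebesgue_integral_def)
qed

lemma germ_eq_cone_integral:
  assumes "intermediate_gf \<Lambda> UNIV I"
  shows "germ_eq (I (convex_cone hull B)) (\<lambda>\<xi>. \<Prod>b\<in>B. - 1 / \<xi> b)"
proof -
  let ?u = "convex_cone hull B"
  have p: "semi_rational_polyhedron \<Lambda> ?u" using translate_polyhedron[of 0] by simp
  have "0 \<in> \<Lambda>" by (simp add: mem_lattice_iff blinfun.zero_right)
  \<comment> \<open>For L = V there is a single coset, and \<open>gf_sum\<close> is one
    integral.\<close>
  then have Q: "quotient_lattice \<Lambda> UNIV = {UNIV}"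
    by (auto simp: quotient_lattice_def image_iff surj_plus)
  have eq: "(\<lambda>\<xi>. \<Prod>b\<in>B. - 1 / (blinfun_apply \<xi> b :: complex)) = (\<lambda>\<xi>. (\<Prod>b\<in>B. - 1) / (\<Prod>b\<in>B. \<xi> b))"
    by (intro ext prod_dividef)
  show ?thesis unfolding eq
  proof (rule germ_eqI_meromorphic)
    show "I ?u \<in> meromorphic_l" using assms p by (auto simp: intermediate_gf_def)
    show "holomorphic_near_0 (\<lambda>_. \<Prod>b\<in>B. - 1)" by (rule holomorphic_near_0_const)
    show "holomorphic_near_0 (\<lambda>\<xi>. \<Prod>b\<in>B. blinfun_apply \<xi> b)"
      by (intro holomorphic_near_0_prod holomorphic_near_0_apply)
    show "finite B" "0 \<notin> B" using nonzero by auto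
    show "\<forall>\<^sub>F \<xi> in nhds 0. (\<forall>w\<in>B. blinfun_apply \<xi> w \<noteq> 0) \<longrightarrow> (\<Prod>b\<in>B. blinfun_apply \<xi> b :: complex) \<noteq> 0"
      by simp
    fix \<xi> assume neg: "negative_on_basis \<xi>"
    have "gf_converges \<Lambda> UNIV ?u \<xi>"
      using integral_exp_cone(1)[OF neg] by (simp add: gf_converges_def Q coset_measure_UNIV)
    then have "I ?u \<xi> = gf_sum \<Lambda> UNIV ?u \<xi>" using assms p by (simp add: intermediate_gf_def)
    also have "\<dots> = (\<Prod>b\<in>B. - 1 / \<xi> b)"
      using integral_exp_cone(2)[OF neg] by (simp add: gf_sum_def Q coset_measure_UNIV)
    finally have "I ?u \<xi> = (\<Prod>b\<in>B. - 1) / (\<Prod>b\<in>B. \<xi> b)" using fun_cong[OF eq, of \<xi>] by simp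
    moreover have "(\<Prod>b\<in>B. \<xi> b) \<noteq> 0" using neg by (auto simp: negative_on_basis_def)
    ultimately show "I ?u \<xi> * (\<Prod>b\<in>B. \<xi> b) = (\<Prod>b\<in>B. - 1)" by simp
  qed
qed

end

section \<open>Equality outside finitely many hyperplanes\<close>

text \<open>Common form of \<open>germ_eq\<close> (filter \<open>nhds 0\<close>) and
  \<open>rational_eq\<close> (filter \<open>top\<close>), so that the handling of exceptional
  hyperplanes is done once for both.\<close>

definition generically ::
    "('a::euclidean_space \<Rightarrow>\<^sub>L complex) filter \<Rightarrow> (('a \<Rightarrow>\<^sub>L complex) \<Rightarrow> bool) \<Rightarrow> bool" where
  "generically F P \<longleftrightarrow> (\<exists>W. finite W \<and> 0 \<notin> W \<and>
     (\<forall>\<^sub>F \<xi> in F. (\<forall>w\<in>W. blinfun_apply \<xi> w \<noteq> 0) \<longrightarrow> P \<xi>))"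

lemma germ_eq_iff: "germ_eq f g \<longleftrightarrow> generically (nhds 0) (\<lambda>\<xi>. f \<xi> = g \<xi>)"
  by (simp add: germ_eq_def generically_def)

lemma rational_eq_iff: "rational_eq f g \<longleftrightarrow> generically top (\<lambda>\<xi>. f \<xi> = g \<xi>)"
  by (simp add: rational_eq_def generically_def eventually_top)

lemma generically_mono:
  assumes "generically F P" "\<And>\<xi>. P \<xi> \<Longrightarrow> Q \<xi>"
  shows "generically F Q"
proof -
  obtain W where "finite W" "0 \<notin> W" and ev: "\<forall>\<^sub>F \<xi> in F. (\<forall>w\<in>W. blinfun_apply \<xi> w \<noteq> 0) \<longrightarrow> P \<xi>"
    using assms(1) unfolding generically_def by blast
  moreover have "\<forall>\<^sub>F \<xi> in F. (\<forall>w\<in>W. blinfun_apply \<xi> w \<noteq> 0) \<longrightarrow> Q \<xi>"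
    using ev by eventually_elim (use assms(2) in blast)
  ultimately show ?thesis unfolding generically_def by (intro exI[of _ W] conjI)
qed

lemma generically_ball:
  assumes "finite A" "\<And>i. i \<in> A \<Longrightarrow> generically F (P i)"
  shows "generically F (\<lambda>\<xi>. \<forall>i\<in>A. P i \<xi>)"
proof -
  have "\<forall>i\<in>A. \<exists>W. finite W \<and> 0 \<notin> W \<and> (\<forall>\<^sub>F \<xi> in F. (\<forall>w\<in>W. blinfun_apply \<xi> w \<noteq> 0) \<longrightarrow> P i \<xi>)"
    using assms(2) by (simp add: generically_def)
  then obtain W where W: "\<And>i. i \<in> A \<Longrightarrow> finite (W i)" "\<And>i. i \<in> A \<Longrightarrow> 0 \<notin> W i"
    and ev: "\<And>i. i \<in> A \<Longrightarrow> \<forall>\<^sub>F \<xi> in F. (\<forall>w\<in>W i. blinfun_apply \<xi> w \<noteq> 0) \<longrightarrow> P i \<xi>"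
    by (auto dest!: bchoice)
  have "\<forall>\<^sub>F \<xi> in F. \<forall>i\<in>A. (\<forall>w\<in>W i. blinfun_apply \<xi> w \<noteq> 0) \<longrightarrow> P i \<xi>"
    using assms(1) ev by (intro eventually_ball_finite) auto
  then have "\<forall>\<^sub>F \<xi> in F. (\<forall>w\<in>(\<Union>i\<in>A. W i). blinfun_apply \<xi> w \<noteq> 0) \<longrightarrow> (\<forall>i\<in>A. P i \<xi>)"
    by eventually_elim auto
  then show ?thesis
    unfolding generically_def using W assms(1) by (intro exI[of _ "\<Union>i\<in>A. W i"] conjI) auto
qed

lemma generically_conj:
  assumes "generically F P" "generically F Q"
  shows "generically F (\<lambda>\<xi>. P \<xi> \<and> Q \<xi>)"
proof -
  have "generically F (\<lambda>\<xi>. \<forall>R\<in>{P, Q}. R \<xi>)"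
    by (rule generically_ball) (use assms in auto)
  then show ?thesis by (rule generically_mono) auto
qed

lemma generically_mono2:
  assumes "generically F P" "generically F Q" "\<And>\<xi>. P \<xi> \<Longrightarrow> Q \<xi> \<Longrightarrow> R \<xi>"
  shows "generically F R"
  using generically_mono[OF generically_conj[OF assms(1,2)]] assms(3) by blast

lemma generically_True: "(\<And>\<xi>. P \<xi>) \<Longrightarrow> generically F P"
  unfolding generically_def by (intro exI[of _ "{}"]) simp

lemma generically_nonzero: "finite B \<Longrightarrow> 0 \<notin> B \<Longrightarrow> generically F (\<lambda>\<xi>. \<forall>b\<in>B. blinfun_apply \<xi> b \<noteq> 0)"
  unfolding generically_def by (intro exI[of _ B]) simp

lemma generically_nhdsI: "generically top P \<Longrightarrow> generically (nhds 0) P"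
  unfolding generically_def by (auto simp: eventually_top intro!: always_eventually)

text \<open>For \<tau> \<noteq> 0 the multiple \<tau> \<xi> avoids the same hyperplanes as \<xi>,
  and it tends to 0 with \<tau>. This passes from germs to statements about all generic
  \<xi>.\<close>

lemma generically_line:
  assumes "generically (nhds 0) P"
  shows "generically top (\<lambda>\<xi>. \<forall>\<^sub>F \<tau> in at 0. P (scaleC_dual \<tau> \<xi>))"
proof -
  obtain W where W: "finite W" "0 \<notin> W" and ev: "\<forall>\<^sub>F \<xi> in nhds 0. (\<forall>w\<in>W. blinfun_apply \<xi> w \<noteq> 0) \<longrightarrow> P \<xi>"
    using assms unfolding generically_def by blast
  have "\<forall>\<^sub>F \<tau> in at 0. P (scaleC_dual \<tau> \<xi>)" if nz: "\<forall>w\<in>W. blinfun_apply \<xi> w \<noteq> 0" for \<xi>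
  proof -
    interpret bounded_linear "\<lambda>\<tau>. scaleC_dual \<tau> \<xi>" by (rule bounded_linear_scaleC_dual_left)
    have "((\<lambda>\<tau>. scaleC_dual \<tau> \<xi>) \<longlongrightarrow> scaleC_dual 0 \<xi>) (at 0)"
      by (intro tendsto tendsto_ident_at)
    then have "((\<lambda>\<tau>. scaleC_dual \<tau> \<xi>) \<longlongrightarrow> 0) (at 0)" by (simp add: zero)
    from eventually_compose_filterlim[OF ev this]
    have "\<forall>\<^sub>F \<tau> in at 0. (\<forall>w\<in>W. scaleC_dual \<tau> \<xi> w \<noteq> 0) \<longrightarrow> P (scaleC_dual \<tau> \<xi>)" .
    moreover have "\<forall>\<^sub>F \<tau> in at (0::complex). \<tau> \<noteq> 0" by (simp add: eventually_at_filter)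
    ultimately show ?thesis by eventually_elim (use nz in auto)
  qed
  then show ?thesis
    unfolding generically_def using W by (intro exI[of _ W]) (auto simp: eventually_top)
qed

section \<open>Spans and tensor products of function spaces\<close>

lemma function_spanI:
  assumes "finite I" "\<And>i. i \<in> I \<Longrightarrow> f i \<in> F"
  shows "(\<lambda>x. \<Sum>i\<in>I. r i * f i x) \<in> function_span F"
proof -
  obtain h where h: "bij_betw h {..<card I} I"
    using ex_bij_betw_nat_finite[OF assms(1)] by (auto simp: lessThan_atLeast0)
  have "(\<lambda>x. \<Sum>i\<in>I. r i * f i x) = (\<lambda>x. \<Sum>i<card I. r (h i) * f (h i) x)"
    by (intro ext sum.reindex_bij_betw[OF h, symmetric])
  then show ?thesis
    unfolding function_span_def using assms(2) bij_betwE[OF h]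
    by (intro CollectI exI[of _ "card I"] exI[of _ "\<lambda>i. r (h i)"] exI[of _ "\<lambda>i. f (h i)"]) auto
qed

lemma function_span_base: "f \<in> F \<Longrightarrow> (\<lambda>x. r * f x) \<in> function_span F"
  using function_spanI[of "{()}" "\<lambda>_. f" F "\<lambda>_. r"] by simp

lemma function_span_sum:
  assumes "finite I" "\<And>i. i \<in> I \<Longrightarrow> g i \<in> function_span F"
  shows "(\<lambda>x. \<Sum>i\<in>I. r i * g i x) \<in> function_span F"
proof -
  have "\<forall>i\<in>I. \<exists>(n::nat) c f. (\<forall>k<n. f k \<in> F) \<and> g i = (\<lambda>x. \<Sum>k<n. c k * f k x)"
    using assms(2) by (simp add: function_span_def)
  from bchoice[OF this] obtain n where
    "\<forall>i\<in>I. \<exists>c f. (\<forall>k<(n i :: nat). f k \<in> F) \<and> g i = (\<lambda>x. \<Sum>k<n i. c k * f k x)" ..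
  from bchoice[OF this] obtain c where
    "\<forall>i\<in>I. \<exists>f. (\<forall>k<n i. f k \<in> F) \<and> g i = (\<lambda>x. \<Sum>k<n i. c i k * f k x)" ..
  from bchoice[OF this] obtain f where
    f: "\<And>i k. i \<in> I \<Longrightarrow> k < n i \<Longrightarrow> f i k \<in> F" and
    g: "\<And>i. i \<in> I \<Longrightarrow> g i = (\<lambda>x. \<Sum>k<n i. c i k * f i k x)" by blast
  have "(\<lambda>x. \<Sum>i\<in>I. r i * g i x) = (\<lambda>x. \<Sum>(i, k)\<in>Sigma I (\<lambda>i. {..<n i}). (r i * c i k) * f i k x)"
    using assms(1) by (intro ext) (simp add: g sum_distrib_left mult.assoc sum.Sigma[symmetric])
  then show ?thesis
    using function_spanI[of "Sigma I (\<lambda>i. {..<n i})" "\<lambda>(i, k). f i k" F "\<lambda>(i, k). r i * c i k"] f assms(1)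
    by (auto simp: case_prod_unfold)
qed

lemma function_span_mult:
  assumes f: "f \<in> function_span F" and g: "g \<in> function_span G"
    and FG: "\<And>a b. a \<in> F \<Longrightarrow> b \<in> G \<Longrightarrow> (\<lambda>x. a x * b x) \<in> H"
  shows "(\<lambda>x. f x * g x) \<in> function_span H"
proof -
  obtain n :: nat and r a where a: "\<And>i. i < n \<Longrightarrow> a i \<in> F" "f = (\<lambda>x. \<Sum>i<n. r i * a i x)"
    using f by (auto simp: function_span_def)
  obtain k :: nat and q b where b: "\<And>i. i < k \<Longrightarrow> b i \<in> G" "g = (\<lambda>x. \<Sum>i<k. q i * b i x)"
    using g by (auto simp: function_span_def)
  have "(\<lambda>x. f x * g x) = (\<lambda>x. \<Sum>p\<in>{..<n} \<times> {..<k}. (r (fst p) * q (snd p)) * (a (fst p) x * b (snd p) x))"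
    unfolding a(2) b(2) sum_product sum.cartesian_product case_prod_unfold
    by (intro ext sum.cong refl) (simp add: mult_ac)
  then show ?thesis
    using function_spanI[of "{..<n} \<times> {..<k}" "\<lambda>p x. a (fst p) x * b (snd p) x" H "\<lambda>p. r (fst p) * q (snd p)"] a b FG
    by auto
qed

text \<open>The families \<open>f\<close> and \<open>g\<close> must serve all s at once, whereas the
  exceptional hyperplanes inside \<open>rational_eq\<close> may vary with s.\<close>

lemma in_tensorI:
  assumes "finite I" "\<And>i. i \<in> I \<Longrightarrow> f i \<in> A" "\<And>i. i \<in> I \<Longrightarrow> g i \<in> B"
    and eq: "\<And>s. rational_eq (F s) (\<lambda>\<xi>. \<Sum>i\<in>I. complex_of_real (f i s) * g i \<xi>)"
  shows "in_tensor A B F"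
proof -
  obtain h where h: "bij_betw h {..<card I} I"
    using ex_bij_betw_nat_finite[OF assms(1)] by (auto simp: lessThan_atLeast0)
  have "(\<Sum>i\<in>I. complex_of_real (f i s) * g i \<xi>) = (\<Sum>i<card I. complex_of_real (f (h i) s) * g (h i) \<xi>)" for s \<xi>
    using sum.reindex_bij_betw[OF h, of "\<lambda>i. complex_of_real (f i s) * g i \<xi>"] by simp
  then show ?thesis
    unfolding in_tensor_def using assms(2,3) bij_betwE[OF h] eq
    by (intro exI[of _ "card I"] exI[of _ "\<lambda>i. f (h i)"] exI[of _ "\<lambda>i. g (h i)"]) auto
qed

lemma in_tensorE:
  assumes "in_tensor A B F"
  obtains n :: nat and f g where "\<And>i. i < n \<Longrightarrow> f i \<in> A" "\<And>i. i < n \<Longrightarrow> g i \<in> B"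
    "\<And>s. generically top (\<lambda>\<xi>. F s \<xi> = (\<Sum>i<n. complex_of_real (f i s) * g i \<xi>))"
  using assms unfolding in_tensor_def rational_eq_iff by blast

lemma in_tensor_cong:
  assumes "in_tensor A B F" "\<And>s. rational_eq (G s) (F s)"
  shows "in_tensor A B G"
proof -
  obtain n :: nat and f g where fg: "\<And>i. i < n \<Longrightarrow> f i \<in> A" "\<And>i. i < n \<Longrightarrow> g i \<in> B"
    and F: "\<And>s. generically top (\<lambda>\<xi>. F s \<xi> = (\<Sum>i<n. complex_of_real (f i s) * g i \<xi>))"
    by (rule in_tensorE[OF assms(1)]) (rule that)
  show ?thesis
  proof (rule in_tensorI)
    show "rational_eq (G s) (\<lambda>\<xi>. \<Sum>i<n. complex_of_real (f i s) * g i \<xi>)" for s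
      unfolding rational_eq_iff
      by (rule generically_mono2[OF F[of s] assms(2)[of s, unfolded rational_eq_iff]]) simp
  qed (use fg in auto)
qed

lemma in_tensor_sum:
  assumes "finite I" "\<And>i. i \<in> I \<Longrightarrow> in_tensor A B (F i)"
  shows "in_tensor A B (\<lambda>s \<xi>. \<Sum>i\<in>I. F i s \<xi>)"
proof -
  have "\<forall>i\<in>I. \<exists>(n::nat) f g. (\<forall>k<n. f k \<in> A \<and> g k \<in> B) \<and>
        (\<forall>s. generically top (\<lambda>\<xi>. F i s \<xi> = (\<Sum>k<n. complex_of_real (f k s) * g k \<xi>)))"
    using assms(2) by (simp add: in_tensor_def rational_eq_iff)
  from bchoice[OF this] obtain n where "\<forall>i\<in>I. \<exists>f g. (\<forall>k<(n i :: nat). f k \<in> A \<and> g k \<in> B) \<and>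
        (\<forall>s. generically top (\<lambda>\<xi>. F i s \<xi> = (\<Sum>k<n i. complex_of_real (f k s) * g k \<xi>)))" ..
  from bchoice[OF this] obtain f where "\<forall>i\<in>I. \<exists>g. (\<forall>k<n i. f i k \<in> A \<and> g k \<in> B) \<and>
        (\<forall>s. generically top (\<lambda>\<xi>. F i s \<xi> = (\<Sum>k<n i. complex_of_real (f i k s) * g k \<xi>)))" ..
  from bchoice[OF this] obtain g where fg: "\<And>i k. i \<in> I \<Longrightarrow> k < n i \<Longrightarrow> f i k \<in> A \<and> g i k \<in> B"
    and F: "\<And>i s. i \<in> I \<Longrightarrow> generically top (\<lambda>\<xi>. F i s \<xi> = (\<Sum>k<n i. complex_of_real (f i k s) * g i k \<xi>))"
    by blast
  show ?thesis
  proof (rule in_tensorI)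
    show "finite (Sigma I (\<lambda>i. {..<n i}))" using assms(1) by simp
    have eq: "(\<Sum>i\<in>I. \<Sum>k<n i. complex_of_real (f i k s) * g i k \<xi>)
        = (\<Sum>p\<in>Sigma I (\<lambda>i. {..<n i}). complex_of_real (f (fst p) (snd p) s) * g (fst p) (snd p) \<xi>)" for s \<xi>
      using sum.Sigma[OF assms(1), of "\<lambda>i. {..<n i}" "\<lambda>i k. complex_of_real (f i k s) * g i k \<xi>"]
      by (simp add: case_prod_unfold)
    show "rational_eq (\<lambda>\<xi>. \<Sum>i\<in>I. F i s \<xi>)
        (\<lambda>\<xi>. \<Sum>p\<in>Sigma I (\<lambda>i. {..<n i}). complex_of_real (f (fst p) (snd p) s) * g (fst p) (snd p) \<xi>)" for s
      unfolding rational_eq_iff eq[symmetric]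
      by (rule generically_mono[OF generically_ball[OF assms(1) F[of _ s]]]) (auto intro: sum.cong)
  qed (use fg in auto)
qed

lemma in_tensor_mult:
  assumes F: "in_tensor A B F" and G: "in_tensor A' B' G"
    and A: "\<And>a a'. a \<in> A \<Longrightarrow> a' \<in> A' \<Longrightarrow> (\<lambda>s. a s * a' s) \<in> A''"
    and B: "\<And>b b'. b \<in> B \<Longrightarrow> b' \<in> B' \<Longrightarrow> (\<lambda>\<xi>. b \<xi> * b' \<xi>) \<in> B''"
  shows "in_tensor A'' B'' (\<lambda>s \<xi>. F s \<xi> * G s \<xi>)"
proof -
  obtain n :: nat and f g where fg: "\<And>i. i < n \<Longrightarrow> f i \<in> A" "\<And>i. i < n \<Longrightarrow> g i \<in> B"
    and F: "\<And>s. generically top (\<lambda>\<xi>. F s \<xi> = (\<Sum>i<n. complex_of_real (f i s) * g i \<xi>))"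
    by (rule in_tensorE[OF F]) (rule that)
  obtain n' :: nat and f' g' where fg': "\<And>i. i < n' \<Longrightarrow> f' i \<in> A'" "\<And>i. i < n' \<Longrightarrow> g' i \<in> B'"
    and G: "\<And>s. generically top (\<lambda>\<xi>. G s \<xi> = (\<Sum>i<n'. complex_of_real (f' i s) * g' i \<xi>))"
    by (rule in_tensorE[OF G]) (rule that)
  show ?thesis
  proof (rule in_tensorI)
    have eq: "(\<Sum>i<n. complex_of_real (f i s) * g i \<xi>) * (\<Sum>i<n'. complex_of_real (f' i s) * g' i \<xi>)
        = (\<Sum>p\<in>{..<n} \<times> {..<n'}. complex_of_real (f (fst p) s * f' (snd p) s) * (g (fst p) \<xi> * g' (snd p) \<xi>))" for s \<xi>
      unfolding sum_product sum.cartesian_product case_prod_unfold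
      by (rule sum.cong[OF refl]) (simp add: mult_ac)
    show "rational_eq (\<lambda>\<xi>. F s \<xi> * G s \<xi>)
        (\<lambda>\<xi>. \<Sum>p\<in>{..<n} \<times> {..<n'}. complex_of_real (f (fst p) s * f' (snd p) s) * (g (fst p) \<xi> * g' (snd p) \<xi>))" for s
      unfolding rational_eq_iff eq[symmetric]
      by (rule generically_mono2[OF F[of s] G[of s]]) simp
  qed (use fg fg' A B in auto)
qed

lemma in_tensor_single:
  assumes "f \<in> A" "g \<in> B"
  shows "in_tensor A B (\<lambda>s \<xi>. complex_of_real (f s) * g \<xi>)"
  by (rule in_tensorI[of "{()}" "\<lambda>_. f" _ "\<lambda>_. g"]) (use assms in \<open>auto simp: rational_eq_iff intro: generically_True\<close>)

section \<open>Homogeneous polynomials and powers of the pairing\<close>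

lemma hom_poly_dual_mult:
  assumes "f \<in> hom_poly_dual k" "g \<in> hom_poly_dual l"
  shows "(\<lambda>\<xi>. f \<xi> * g \<xi>) \<in> hom_poly_dual (k + l)"
  using assms unfolding hom_poly_dual_def
proof (rule function_span_mult, safe)
  fix xs ys :: "'a list" assume "k = int (length xs)" "l = int (length ys)"
  show "\<exists>zs. (\<lambda>\<xi>. (\<Prod>x\<leftarrow>xs. blinfun_apply \<xi> x) * (\<Prod>x\<leftarrow>ys. blinfun_apply \<xi> x)) =
          (\<lambda>\<xi>. \<Prod>x\<leftarrow>zs. blinfun_apply \<xi> x) \<and> int (length zs) = int (length xs) + int (length ys)"
    by (rule exI[of _ "xs @ ys"]) (simp add: fun_eq_iff)
qed

lemma hom_poly_mult:
  assumes "f \<in> hom_poly k" "g \<in> hom_poly l"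
  shows "(\<lambda>s. f s * g s) \<in> hom_poly (k + l)"
  using assms unfolding hom_poly_def
proof (rule function_span_mult, safe)
  fix xs ys :: "('a \<Rightarrow>\<^sub>L real) list" assume "k = length xs" "l = length ys"
  show "\<exists>zs. (\<lambda>s. (\<Prod>x\<leftarrow>xs. blinfun_apply x s) * (\<Prod>x\<leftarrow>ys. blinfun_apply x s)) =
          (\<lambda>s. \<Prod>x\<leftarrow>zs. blinfun_apply x s) \<and> length zs = length xs + length ys"
    by (rule exI[of _ "xs @ ys"]) (simp add: fun_eq_iff)
qed

lemma hom_rational_mult:
  assumes "f \<in> hom_poly_dual (int r)" "g \<in> hom_rational (m - int r)"
  shows "(\<lambda>\<xi>. f \<xi> * g \<xi>) \<in> hom_rational m"
proof -
  obtain P ws where g: "g = (\<lambda>\<xi>. P \<xi> / (\<Prod>w\<leftarrow>ws. blinfun_apply \<xi> w))" "0 \<notin> set ws"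
    "P \<in> hom_poly_dual (m - int r + int (length ws))"
    using assms(2) by (auto simp: hom_rational_def)
  have "(\<lambda>\<xi>. f \<xi> * P \<xi>) \<in> hom_poly_dual (m + int (length ws))"
    using hom_poly_dual_mult[OF assms(1) g(3)] by simp
  then show ?thesis
    unfolding hom_rational_def using g by (intro CollectI exI[of _ "\<lambda>\<xi>. f \<xi> * P \<xi>"] exI[of _ ws]) auto
qed

text \<open>Expanding s in the orthonormal basis writes the pairing as a finite sum of products of a
  linear form in s and one in \<xi>; powers follow since tensor products multiply.\<close>

lemma in_tensor_pairing_power:
  "in_tensor (hom_poly r) (hom_poly_dual (int r)) (\<lambda>s \<xi>. blinfun_apply \<xi> s ^ r)"
proof (induction r)
  case 0
  have "(\<lambda>s. 1 * (\<Prod>\<eta>\<leftarrow>[]. blinfun_apply \<eta> s)) \<in> hom_poly 0"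
    unfolding hom_poly_def by (rule function_span_base, rule CollectI, rule exI[of _ "[]"]) simp
  moreover have "(\<lambda>\<xi>. 1 * (\<Prod>x\<leftarrow>[]. blinfun_apply \<xi> x)) \<in> hom_poly_dual 0"
    unfolding hom_poly_dual_def by (rule function_span_base, rule CollectI, rule exI[of _ "[]"]) simp
  ultimately show ?case
    using in_tensor_single[of "\<lambda>_. 1" "hom_poly 0" "\<lambda>_. 1" "hom_poly_dual 0"] by simp
next
  case (Suc r)
  have 1: "(\<lambda>s. s \<bullet> b) \<in> hom_poly 1" for b :: 'a
  proof -
    have "(\<lambda>s. 1 * (\<Prod>\<eta>\<leftarrow>[blinfun_inner_left b]. blinfun_apply \<eta> s)) \<in> hom_poly 1"
      unfolding hom_poly_def
      by (rule function_span_base, rule CollectI, rule exI[of _ "[blinfun_inner_left b]"]) simp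
    then show ?thesis by (simp add: inner_commute)
  qed
  have 2: "(\<lambda>\<xi>. blinfun_apply \<xi> b) \<in> hom_poly_dual 1" for b :: 'a
  proof -
    have "(\<lambda>\<xi>. 1 * (\<Prod>x\<leftarrow>[b]. blinfun_apply \<xi> x)) \<in> hom_poly_dual 1"
      unfolding hom_poly_dual_def
      by (rule function_span_base, rule CollectI, rule exI[of _ "[b]"]) simp
    then show ?thesis by simp
  qed
  have "in_tensor (hom_poly 1) (hom_poly_dual 1) (\<lambda>s \<xi>. \<Sum>b\<in>Basis. complex_of_real (s \<bullet> b) * blinfun_apply \<xi> (b :: 'a))"
    by (rule in_tensor_sum[where F = "\<lambda>b s \<xi>. complex_of_real (s \<bullet> b) * blinfun_apply \<xi> b", OF finite_Basis])
      (rule in_tensor_single[OF 1 2])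
  moreover have "(\<Sum>b\<in>Basis. complex_of_real (s \<bullet> b) * blinfun_apply \<xi> b) = \<xi> s" for s :: 'a and \<xi>
    by (subst (2) euclidean_representation[of s, symmetric])
      (simp add: blinfun.sum_right blinfun.scaleR_right scaleR_conv_of_real)
  ultimately have "in_tensor (hom_poly 1) (hom_poly_dual 1) (\<lambda>s \<xi>. blinfun_apply \<xi> (s :: 'a))" by simp
  then show ?case
    unfolding power_Suc
  proof (rule in_tensor_mult[OF _ Suc])
    fix a a' :: "'a \<Rightarrow> real" assume "a \<in> hom_poly 1" "a' \<in> hom_poly r"
    then show "(\<lambda>s. a s * a' s) \<in> hom_poly (Suc r)" using hom_poly_mult[of a 1 a' r] by simp
  next
    fix a a' :: "('a \<Rightarrow>\<^sub>L complex) \<Rightarrow> complex" assume "a \<in> hom_poly_dual 1" "a' \<in> hom_poly_dual (int r)"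
    then show "(\<lambda>s. a s * a' s) \<in> hom_poly_dual (int (Suc r))" using hom_poly_dual_mult[of a 1 a' "int r"] by simp
  qed
qed

section \<open>Step-polynomials in s with polynomial coefficients in xi\<close>

text \<open>Functions of the pair (s, \<xi>), since the coefficients of a product of power series
  mix both variables. The grade k is the exact degree in \<xi> and an upper bound for the number of
  fractional parts.\<close>

definition step_hom :: "('a::euclidean_space \<Rightarrow>\<^sub>L real) set \<Rightarrow> nat \<Rightarrow> ('a \<times> ('a \<Rightarrow>\<^sub>L complex) \<Rightarrow> complex) set" where
  "step_hom \<Psi> k = function_span {\<lambda>(s, \<xi>). complex_of_real (\<Prod>\<eta>\<leftarrow>\<eta>s. frac (blinfun_apply \<eta> s)) * (\<Prod>x\<leftarrow>xs. blinfun_apply \<xi> x)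
     | \<eta>s xs. set \<eta>s \<subseteq> \<Psi> \<and> length \<eta>s \<le> k \<and> length xs = k}"

lemma step_hom_mult:
  assumes "f \<in> step_hom \<Psi> k" "g \<in> step_hom \<Psi> l"
  shows "(\<lambda>p. f p * g p) \<in> step_hom \<Psi> (k + l)"
  using assms unfolding step_hom_def
proof (rule function_span_mult, safe)
  fix \<eta>s \<eta>s' :: "('a \<Rightarrow>\<^sub>L real) list" and xs xs' :: "'a list"
  assume "set \<eta>s \<subseteq> \<Psi>" "length \<eta>s \<le> length xs" "set \<eta>s' \<subseteq> \<Psi>" "length \<eta>s' \<le> length xs'"
  then show "\<exists>\<eta>t ys. (\<lambda>x. (case x of (s, \<xi>) \<Rightarrow> complex_of_real (\<Prod>\<eta>\<leftarrow>\<eta>s. frac (blinfun_apply \<eta> s)) * (\<Prod>x\<leftarrow>xs. blinfun_apply \<xi> x)) *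
            (case x of (s, \<xi>) \<Rightarrow> complex_of_real (\<Prod>\<eta>\<leftarrow>\<eta>s'. frac (blinfun_apply \<eta> s)) * (\<Prod>x\<leftarrow>xs'. blinfun_apply \<xi> x))) =
          (\<lambda>(s, \<xi>). complex_of_real (\<Prod>\<eta>\<leftarrow>\<eta>t. frac (blinfun_apply \<eta> s)) * (\<Prod>x\<leftarrow>ys. blinfun_apply \<xi> x)) \<and>
        set \<eta>t \<subseteq> \<Psi> \<and> length \<eta>t \<le> length xs + length xs' \<and> length ys = length xs + length xs'"
    by (intro exI[of _ "\<eta>s @ \<eta>s'"] exI[of _ "xs @ xs'"]) (auto simp: fun_eq_iff)
qed

text \<open>Grades add, so each term of the Cauchy product, of grades i and n - i, has grade n. This
  is what keeps the degree bound through the product over the basis.\<close>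

lemma step_hom_fps_mult:
  assumes "\<And>n. (\<lambda>p. fps_nth (f p) n) \<in> step_hom \<Psi> n" "\<And>n. (\<lambda>p. fps_nth (g p) n) \<in> step_hom \<Psi> n"
  shows "(\<lambda>p. fps_nth (f p * g p) n) \<in> step_hom \<Psi> n"
proof -
  have "(\<lambda>p. \<Sum>i\<in>{0..n}. 1 * (fps_nth (f p) i * fps_nth (g p) (n - i))) \<in> step_hom \<Psi> n"
    unfolding step_hom_def
  proof (rule function_span_sum, goal_cases)
    case (2 i)
    then show ?case
      using step_hom_mult[OF assms(1)[of i] assms(2)[of "n - i"]] by (simp add: step_hom_def)
  qed simp
  then show ?thesis by (simp add: fps_mult_nth)
qed

lemma step_hom_fps_prod:
  assumes "finite A" "\<And>i n. i \<in> A \<Longrightarrow> (\<lambda>p. fps_nth (f i p) n) \<in> step_hom \<Psi> n"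
  shows "(\<lambda>p. fps_nth (\<Prod>i\<in>A. f i p) n) \<in> step_hom \<Psi> n"
  using assms
proof (induction A arbitrary: n rule: finite_induct)
  case empty
  show ?case
  proof (cases "n = 0")
    case True
    have "(\<lambda>p. 1 * 1) \<in> step_hom \<Psi> 0"
      unfolding step_hom_def by (rule function_span_base) (auto intro!: exI[of _ "[]"])
    then show ?thesis using True by simp
  next
    case False
    then show ?thesis
      using function_span_sum[of "{}" "\<lambda>_::nat. undefined"] by (simp add: step_hom_def)
  qed
next
  case (insert i A)
  then show ?case using step_hom_fps_mult[of "f i" \<Psi> "\<lambda>p. \<Prod>i\<in>A. f i p" n] by simp
qed

text \<open>Separates the variables. The denominator contributes degree -|B|, so grade k = m + |B|
  leaves degree m in \<xi>; the basis is listed without repetition because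
  \<open>hom_rational\<close> takes lists.\<close>

lemma step_hom_in_tensor:
  assumes F: "F \<in> step_hom \<Psi> k" and k: "int k = m + int (card B)" and B: "finite B" "0 \<notin> B"
  shows "in_tensor (step_poly \<Psi> (m + int (card B))) (hom_rational m) (\<lambda>s \<xi>. F (s, \<xi>) / (\<Prod>b\<in>B. blinfun_apply \<xi> b))"
proof -
  obtain ws where ws: "set ws = B" "distinct ws" using finite_distinct_list[OF B(1)] by blast
  have lws: "length ws = card B" using ws distinct_card by fastforce
  have pws: "(\<Prod>b\<in>B. h b) = (\<Prod>w\<leftarrow>ws. h w)" for h :: "'a \<Rightarrow> complex"
    using prod.distinct_set_conv_list[OF ws(2), of h] ws(1) by simp
  obtain n :: nat and r f where
    f: "\<forall>i<n. \<exists>\<eta>s xs. f i = (\<lambda>(s, \<xi>). complex_of_real (\<Prod>\<eta>\<leftarrow>\<eta>s. frac (blinfun_apply \<eta> s)) * (\<Prod>x\<leftarrow>xs. blinfun_apply \<xi> x))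
      \<and> set \<eta>s \<subseteq> \<Psi> \<and> length \<eta>s \<le> k \<and> length xs = k"
    and Feq: "F = (\<lambda>x. \<Sum>i<n. r i * f i x)"
    using F unfolding step_hom_def function_span_def by blast
  from f have "\<forall>i\<in>{..<n}. \<exists>\<eta>s xs. f i = (\<lambda>(s, \<xi>). complex_of_real (\<Prod>\<eta>\<leftarrow>\<eta>s. frac (blinfun_apply \<eta> s)) * (\<Prod>x\<leftarrow>xs. blinfun_apply \<xi> x))
      \<and> set \<eta>s \<subseteq> \<Psi> \<and> length \<eta>s \<le> k \<and> length xs = k" by simp
  from bchoice[OF this] obtain \<eta>s where
    "\<forall>i\<in>{..<n}. \<exists>xs. f i = (\<lambda>(s, \<xi>). complex_of_real (\<Prod>\<eta>\<leftarrow>\<eta>s i. frac (blinfun_apply \<eta> s)) * (\<Prod>x\<leftarrow>xs. blinfun_apply \<xi> x))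
      \<and> set (\<eta>s i) \<subseteq> \<Psi> \<and> length (\<eta>s i) \<le> k \<and> length xs = k" ..
  from bchoice[OF this] obtain xs where
    gl: "\<forall>i\<in>{..<n}. f i = (\<lambda>(s, \<xi>). complex_of_real (\<Prod>\<eta>\<leftarrow>\<eta>s i. frac (blinfun_apply \<eta> s)) * (\<Prod>x\<leftarrow>xs i. blinfun_apply \<xi> x))
      \<and> set (\<eta>s i) \<subseteq> \<Psi> \<and> length (\<eta>s i) \<le> k \<and> length (xs i) = k" ..
  then have
    g: "\<And>i. i < n \<Longrightarrow> f i = (\<lambda>(s, \<xi>). complex_of_real (\<Prod>\<eta>\<leftarrow>\<eta>s i. frac (blinfun_apply \<eta> s)) * (\<Prod>x\<leftarrow>xs i. blinfun_apply \<xi> x))"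
    and l: "\<And>i. i < n \<Longrightarrow> set (\<eta>s i) \<subseteq> \<Psi>" "\<And>i. i < n \<Longrightarrow> length (\<eta>s i) \<le> k" "\<And>i. i < n \<Longrightarrow> length (xs i) = k"
    by simp_all
  show ?thesis
  \<comment> \<open>The complex coefficients \<open>r i\<close> go to the \<xi>-side, since
    step-polynomials are real.\<close>
  proof (rule in_tensorI[of "{..<n}" "\<lambda>i s. 1 * (\<Prod>\<eta>\<leftarrow>\<eta>s i. frac (blinfun_apply \<eta> s))" _
        "\<lambda>i \<xi>. (r i * (\<Prod>x\<leftarrow>xs i. blinfun_apply \<xi> x)) / (\<Prod>w\<leftarrow>ws. blinfun_apply \<xi> w)"])
    fix i assume i: "i \<in> {..<n}"
    show "(\<lambda>s. 1 * (\<Prod>\<eta>\<leftarrow>\<eta>s i. frac (blinfun_apply \<eta> s))) \<in> step_poly \<Psi> (m + int (card B))"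
      unfolding step_poly_def
      by (rule function_span_base) (use i l[of i] k in \<open>auto intro!: exI[of _ "\<eta>s i"]\<close>)
    have "(\<lambda>\<xi>. r i * (\<Prod>x\<leftarrow>xs i. blinfun_apply \<xi> x)) \<in> hom_poly_dual (m + int (length ws))"
      unfolding hom_poly_dual_def
      by (rule function_span_base) (use i l[of i] k lws in \<open>auto intro!: exI[of _ "xs i"]\<close>)
    then show "(\<lambda>\<xi>. (r i * (\<Prod>x\<leftarrow>xs i. blinfun_apply \<xi> x)) / (\<Prod>w\<leftarrow>ws. blinfun_apply \<xi> w)) \<in> hom_rational m"
      unfolding hom_rational_def using ws B by (intro CollectI exI conjI) auto
  next
    show "rational_eq (\<lambda>\<xi>. F (s, \<xi>) / (\<Prod>b\<in>B. blinfun_apply \<xi> b))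
          (\<lambda>\<xi>. \<Sum>i<n. complex_of_real (1 * (\<Prod>\<eta>\<leftarrow>\<eta>s i. frac (blinfun_apply \<eta> s))) *
            ((r i * (\<Prod>x\<leftarrow>xs i. blinfun_apply \<xi> x)) / (\<Prod>w\<leftarrow>ws. blinfun_apply \<xi> w)))" for s
      unfolding rational_eq_iff
      by (rule generically_True) (simp add: Feq g pws sum_divide_distrib mult_ac)
  qed simp
qed

section \<open>Laurent expansions along complex lines\<close>

text \<open>The series of z / (1 - exp z), that is, minus the exponential generating function of the
  Bernoulli numbers.\<close>

definition todd_fps :: "complex fps" where
  "todd_fps = fps_X / (1 - fps_exp 1)"

lemma todd_fps:
  shows todd_fps_nth_0: "fps_nth todd_fps 0 = - 1"
    and has_fps_expansion_todd: "(\<lambda>z. if z = 0 then - 1 else z / (1 - exp z)) has_fps_expansion todd_fps"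
proof -
  let ?G = "1 - fps_exp 1 :: complex fps"
  have 1: "fps_nth ?G 1 = - 1" "fps_nth ?G 0 = 0" by simp_all
  then have G0: "?G \<noteq> 0" by (metis fps_zero_nth zero_neq_neg_one)
  \<comment> \<open>Numerator and denominator both vanish to order exactly 1, so the quotient is a
    power series; its value -1 at 0 is the reciprocal of the linear coefficient of
    \<open>?G\<close>.\<close>
  have sub: "subdegree ?G = 1" by (rule subdegreeI) (use 1 in auto)
  show e: "(\<lambda>z. if z = 0 then - 1 else z / (1 - exp z)) has_fps_expansion todd_fps"
    unfolding todd_fps_def
    by (rule has_fps_expansion_divide) (use sub G0 in \<open>auto intro!: fps_expansion_intros\<close>)
  from has_fps_expansion_imp_0_eq_fps_nth_0[OF this] show "fps_nth todd_fps 0 = - 1" by simp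
qed

text \<open>Minus the generating function of the Bernoulli polynomials: the n-th coefficient is
  -B_n(t) x^n / n!.\<close>

definition exp_quotient_fps :: "real \<Rightarrow> complex \<Rightarrow> complex fps" where
  "exp_quotient_fps t x = fps_exp (of_real t * x) * fps_compose todd_fps (fps_const x * fps_X)"

text \<open>The degree bounds of the theorem originate here: the n-th coefficient is homogeneous of
  degree n in x and of degree at most n in t.\<close>

lemma exp_quotient_fps_nth:
  "fps_nth (exp_quotient_fps t x) n
     = (\<Sum>i\<in>{0..n}. (fps_nth todd_fps (n - i) / fact i) * (of_real (t ^ i) * x ^ n))"
  unfolding exp_quotient_fps_def fps_mult_nth fps_compose_linear
  by (intro sum.cong refl) (simp add: power_mult_distrib flip: power_add)

lemma has_laurent_expansion_exp_quotient:
  assumes "x \<noteq> 0"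
  shows "(\<lambda>\<tau>. exp (of_real t * (\<tau> * x)) / (1 - exp (\<tau> * x)) * (\<tau> * x))
           has_laurent_expansion fps_to_fls (exp_quotient_fps t x)"
proof -
  have "(\<lambda>\<tau>. x * \<tau>) has_fps_expansion fps_const x * fps_X"
    by (intro fps_expansion_intros)
  then have c: "((\<lambda>z. if z = 0 then - 1 else z / (1 - exp z)) \<circ> (\<lambda>\<tau>. x * \<tau>)) has_fps_expansion
      fps_compose todd_fps (fps_const x * fps_X)"
    by (intro has_fps_expansion_compose has_fps_expansion_todd) auto
  have "(\<lambda>\<tau>. exp ((of_real t * x) * \<tau>) * ((\<lambda>z. if z = 0 then - 1 else z / (1 - exp z)) \<circ> (\<lambda>\<tau>. x * \<tau>)) \<tau>)
      has_fps_expansion exp_quotient_fps t x"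
    unfolding exp_quotient_fps_def by (intro has_fps_expansion_mult has_fps_expansion_exp c)
  from has_laurent_expansion_fps[OF this] show ?thesis
  proof (rule has_laurent_expansion_cong[THEN iffD1, rotated 2])
    \<comment> \<open>At \<tau> = 0 the quotient evaluates to 0 while the power series gives -1, so
      the two are compared on a punctured neighbourhood.\<close>
    have "\<forall>\<^sub>F \<tau> in at (0::complex). \<tau> \<noteq> 0" by (simp add: eventually_at_filter)
    then show "\<forall>\<^sub>F \<tau> in at 0. exp ((of_real t * x) * \<tau>) * ((\<lambda>z. if z = 0 then - 1 else z / (1 - exp z)) \<circ> (\<lambda>\<tau>. x * \<tau>)) \<tau>
        = exp (of_real t * (\<tau> * x)) / (1 - exp (\<tau> * x)) * (\<tau> * x)"
      by eventually_elim (use assms in \<open>simp add: mult_ac\<close>)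
  qed simp
qed

lemma fps_to_fls_prod:
  "fps_to_fls (\<Prod>i\<in>A. f i) = (\<Prod>i\<in>A. fps_to_fls (f i :: 'a :: comm_ring_1 fps))"
  by (induction A rule: infinite_finite_induct) (simp_all add: fls_times_fps_to_fls)

lemma fps_prod_nth_0:
  "fps_nth (\<Prod>i\<in>A. f i) 0 = (\<Prod>i\<in>A. fps_nth (f i :: 'a :: comm_ring_1 fps) 0)"
  by (induction A rule: infinite_finite_induct) simp_all

lemma hom_component_eqI:
  assumes "(\<lambda>\<tau>. f (scaleC_dual \<tau> \<xi>)) has_laurent_expansion F"
  shows "hom_component f m \<xi> = fls_nth F m"
  unfolding hom_component_def laurent_expansion_0_eqI[OF assms] ..

section \<open>The expansion for one unimodular cone\<close>

context vs_lattice_basis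
begin

definition frac_coord :: "'a \<Rightarrow> 'a \<Rightarrow> real" where
  "frac_coord s b = frac (- coord B b s)"

lemma shifted_lattice_gf:
  fixes \<xi> :: "'a \<Rightarrow>\<^sub>L complex"
  shows "exp (- \<xi> s) * lattice_gf s \<xi> = (\<Prod>b\<in>B. exp (of_real (frac_coord s b) * \<xi> b) / (1 - exp (\<xi> b)))"
proof -
  have "exp (- \<xi> s) = (\<Prod>b\<in>B. exp (- of_real (coord B b s) * \<xi> b))"
    by (subst blinfun_expand) (simp add: sum_negf[symmetric] exp_sum)
  then have "exp (- \<xi> s) * lattice_gf s \<xi>
      = (\<Prod>b\<in>B. exp (- of_real (coord B b s) * \<xi> b) * (exp (of_int \<lceil>coord B b s\<rceil> * \<xi> b) / (1 - exp (\<xi> b))))"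
    by (simp only: lattice_gf_def prod.distrib)
  also have "\<dots> = (\<Prod>b\<in>B. exp (of_real (frac_coord s b) * \<xi> b) / (1 - exp (\<xi> b)))"
  proof (rule prod.cong[OF refl])
    fix b
    have eq: "of_real (frac_coord s b) = - complex_of_real (coord B b s) + of_int \<lceil>coord B b s\<rceil>"
      by (simp add: frac_coord_def frac_def ceiling_def)
    show "exp (- of_real (coord B b s) * \<xi> b) * (exp (of_int \<lceil>coord B b s\<rceil> * \<xi> b) / (1 - exp (\<xi> b)))
        = exp (of_real (frac_coord s b) * \<xi> b) / (1 - exp (\<xi> b))"
      by (simp only: eq times_divide_eq_right exp_add[symmetric] distrib_right)
  qed
  finally show ?thesis .
qed

definition gf_fps :: "'a \<Rightarrow> ('a \<Rightarrow>\<^sub>L complex) \<Rightarrow> complex fps" where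
  "gf_fps s \<xi> = (\<Prod>b\<in>B. exp_quotient_fps (frac_coord s b) (\<xi> b))"

text \<open>Each of the d factors has a simple pole at \<tau> = 0. Multiplying each by
  \<open>\<tau> * \<xi> b\<close> gives power series; undoing this produces the shift by d and the
  constant prefactor.\<close>

lemma has_laurent_expansion_shifted_lattice_gf:
  fixes \<xi> :: "'a \<Rightarrow>\<^sub>L complex"
  assumes nz: "\<forall>b\<in>B. \<xi> b \<noteq> 0"
  shows "(\<lambda>\<tau>. exp (- scaleC_dual \<tau> \<xi> s) * lattice_gf s (scaleC_dual \<tau> \<xi>)) has_laurent_expansion
           fls_shift (int DIM('a)) (fps_to_fls (fps_const (1 / (\<Prod>b\<in>B. \<xi> b)) * gf_fps s \<xi>))"
proof -
  let ?f = "\<lambda>b \<tau>. exp (of_real (frac_coord s b) * (\<tau> * blinfun_apply \<xi> b)) / (1 - exp (\<tau> * \<xi> b))"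
  have "(\<lambda>\<tau>. \<Prod>b\<in>B. ?f b \<tau> * (\<tau> * \<xi> b)) has_laurent_expansion
      (\<Prod>b\<in>B. fps_to_fls (exp_quotient_fps (frac_coord s b) (\<xi> b)))"
    using nz by (intro has_laurent_expansion_prod has_laurent_expansion_exp_quotient) auto
  also have "(\<Prod>b\<in>B. fps_to_fls (exp_quotient_fps (frac_coord s b) (\<xi> b))) = fps_to_fls (gf_fps s \<xi>)"
    unfolding gf_fps_def by (rule fps_to_fls_prod[symmetric])
  finally have "(\<lambda>\<tau>. (1 / (\<Prod>b\<in>B. \<xi> b) * (\<Prod>b\<in>B. ?f b \<tau> * (\<tau> * \<xi> b))) * \<tau> powi (- int DIM('a)))
      has_laurent_expansion fls_shift (int DIM('a)) (fls_const (1 / (\<Prod>b\<in>B. \<xi> b)) * fps_to_fls (gf_fps s \<xi>))"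
    by (intro has_laurent_expansion_shift' has_laurent_expansion_cmult_left)
  then show ?thesis
  proof (rule has_laurent_expansion_cong[THEN iffD1, rotated 2])
    have "\<forall>\<^sub>F \<tau> in at (0::complex). \<tau> \<noteq> 0" by (simp add: eventually_at_filter)
    then show "\<forall>\<^sub>F \<tau> in at 0. (1 / (\<Prod>b\<in>B. \<xi> b) * (\<Prod>b\<in>B. ?f b \<tau> * (\<tau> * \<xi> b))) * \<tau> powi (- int DIM('a))
        = exp (- scaleC_dual \<tau> \<xi> s) * lattice_gf s (scaleC_dual \<tau> \<xi>)"
    proof eventually_elim
      case (elim \<tau>)
      have "(\<Prod>b\<in>B. ?f b \<tau> * (\<tau> * \<xi> b)) = (\<Prod>b\<in>B. ?f b \<tau>) * (\<tau> ^ DIM('a) * (\<Prod>b\<in>B. \<xi> b))"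
        by (simp only: prod.distrib prod_constant card_B)
      moreover have "(\<Prod>b\<in>B. \<xi> b) \<noteq> 0" using nz by simp
      moreover have "exp (- scaleC_dual \<tau> \<xi> s) * lattice_gf s (scaleC_dual \<tau> \<xi>) = (\<Prod>b\<in>B. ?f b \<tau>)"
        unfolding shifted_lattice_gf by simp
      ultimately show ?case
        using elim by (simp add: power_int_minus del: scaleC_dual_apply)
    qed
  qed (simp add: fls_times_fps_to_fls del: fps_const_to_fls flip: fps_const_to_fls)
qed

lemma gf_fps_step_hom:
  assumes "uminus ` coord B ` B \<subseteq> \<Psi>"
  shows "(\<lambda>p. fps_nth (gf_fps (fst p) (snd p)) n) \<in> step_hom \<Psi> n"
  unfolding gf_fps_def
proof (rule step_hom_fps_prod[OF finite_B])
  fix b n assume b: "b \<in> B"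
  \<comment> \<open>The monomial \<open>t ^ i * x ^ n\<close> becomes i copies of
    \<open>- coord B b\<close> under the fractional part and n copies of \<open>b\<close>; i \<le> n
    gives the bound.\<close>
  have "(\<lambda>p. \<Sum>i\<in>{0..n}. (fps_nth todd_fps (n - i) / fact i) *
      (\<lambda>(s, \<xi>). complex_of_real (\<Prod>\<eta>\<leftarrow>replicate i (- coord B b). frac (blinfun_apply \<eta> s)) * (\<Prod>x\<leftarrow>replicate n b. blinfun_apply \<xi> x)) p)
      \<in> step_hom \<Psi> n"
    unfolding step_hom_def
  proof (rule function_spanI)
    fix i assume "i \<in> {0..n}"
    then show "(\<lambda>(s, \<xi>). complex_of_real (\<Prod>\<eta>\<leftarrow>replicate i (- coord B b). frac (blinfun_apply \<eta> s)) * (\<Prod>x\<leftarrow>replicate n b. blinfun_apply \<xi> x))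
      \<in> {\<lambda>(s, \<xi>). complex_of_real (\<Prod>\<eta>\<leftarrow>\<eta>s. frac (blinfun_apply \<eta> s)) * (\<Prod>x\<leftarrow>xs. blinfun_apply \<xi> x)
          |\<eta>s xs. set \<eta>s \<subseteq> \<Psi> \<and> length \<eta>s \<le> n \<and> length xs = n}"
      using assms b
      by (intro CollectI exI[of _ "replicate i (- coord B b)"] exI[of _ "replicate n b"] conjI refl) auto
  qed simp
  then show "(\<lambda>p. fps_nth (exp_quotient_fps (frac_coord (fst p) b) (blinfun_apply (snd p) b)) n) \<in> step_hom \<Psi> n"
    by (simp add: exp_quotient_fps_nth frac_coord_def blinfun.minus_left case_prod_unfold)
qed

text \<open>The fractional parts enter only through \<open>fps_exp\<close>, whose constant term is
  1, so each factor contributes the value -1 of \<open>todd_fps\<close>. This is why the lowest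
  component does not depend on s.\<close>

lemma gf_fps_nth_0: "fps_nth (gf_fps s \<xi>) 0 = (\<Prod>b\<in>B. - 1)"
  by (simp add: gf_fps_def fps_prod_nth_0 exp_quotient_fps_nth todd_fps_nth_0)

end

section \<open>The decomposition into unimodular cones\<close>

lemma intermediate_gf_valuation:
  assumes S: "intermediate_gf \<Lambda> L S" and "finite I"
    and p: "\<And>i. i \<in> I \<Longrightarrow> semi_rational_polyhedron \<Lambda> (p i)"
    and zero: "\<And>x. (\<Sum>i\<in>I. r i * indicat_real (p i) x) = 0"
  shows "generically (nhds 0) (\<lambda>\<xi>. (\<Sum>i\<in>I. complex_of_real (r i) * S (p i) \<xi>) = 0)"
proof -
  obtain h where h: "bij_betw h {..<card I} I"
    using ex_bij_betw_nat_finite[OF assms(2)] by (auto simp: lessThan_atLeast0)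
  have val: "\<forall>(n::nat) r p. (\<forall>i<n. semi_rational_polyhedron \<Lambda> (p i)) \<and>
        (\<forall>x. (\<Sum>i<n. r i * indicat_real (p i) x) = 0) \<longrightarrow>
        germ_eq (\<lambda>\<xi>. \<Sum>i<n. complex_of_real (r i) * S (p i) \<xi>) (\<lambda>_. 0)"
    using S by (simp add: intermediate_gf_def)
  have "germ_eq (\<lambda>\<xi>. \<Sum>i<card I. complex_of_real (r (h i)) * S (p (h i)) \<xi>) (\<lambda>_. 0)"
  proof (rule val[rule_format], intro conjI allI impI)
    show "semi_rational_polyhedron \<Lambda> (p (h i))" if "i < card I" for i
      using p bij_betwE[OF h] that by auto
    show "(\<Sum>i<card I. r (h i) * indicat_real (p (h i)) x) = 0" for x
      using zero[of x] sum.reindex_bij_betw[OF h, of "\<lambda>i. r i * indicat_real (p i) x"] by simp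
  qed
  moreover have "(\<Sum>i<card I. complex_of_real (r (h i)) * S (p (h i)) \<xi>) = (\<Sum>i\<in>I. complex_of_real (r i) * S (p i) \<xi>)" for \<xi>
    using sum.reindex_bij_betw[OF h, of "\<lambda>i. complex_of_real (r i) * S (p i) \<xi>"] by simp
  ultimately show ?thesis by (simp add: germ_eq_iff)
qed

lemma rational_cone_translate:
  assumes "rational_cone \<Lambda> k"
  shows "semi_rational_polyhedron \<Lambda> ((+) s ` k)"
proof -
  obtain H where H: "finite H" "H \<subseteq> dual_lattice \<Lambda>" "k = {x. \<forall>\<mu>\<in>H. blinfun_apply \<mu> x \<le> 0}"
    using assms unfolding rational_cone_def by blast
  have "x \<in> (+) s ` k \<longleftrightarrow> x - s \<in> k" for x
    by (auto simp: image_iff intro: bexI[of _ "x - s"])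
  then have "(+) s ` k = {x. \<forall>(\<mu>, b)\<in>(\<lambda>\<mu>. (\<mu>, blinfun_apply \<mu> s)) ` H. blinfun_apply \<mu> x \<le> b}"
    by (intro set_eqI) (simp add: H(3) blinfun.diff_right)
  then show ?thesis
    unfolding semi_rational_polyhedron_def using H
    by (intro exI[of _ "(\<lambda>\<mu>. (\<mu>, blinfun_apply \<mu> s)) ` H"]) (auto simp: image_iff)
qed

lemma contains_line_translate:
  assumes "contains_line k"
  shows "contains_line ((+) s ` k)"
proof -
  obtain a v where "v \<noteq> 0" "\<And>t. a + t *\<^sub>R v \<in> k" using assms by (auto simp: contains_line_def)
  then show ?thesis
    unfolding contains_line_def
    by (intro exI[of _ "s + a"] exI[of _ v] conjI allI) (auto simp: add.assoc)
qed

text \<open>Evaluating the relation of indicator functions at x - s translates all cones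
  simultaneously, and the translated cones with lines drop out as zero germs. It is stated for
  general L to serve both \<open>S\<close> and \<open>I\<close>.\<close>

lemma intermediate_gf_decomposition:
  assumes S: "intermediate_gf \<Lambda> L S" and c: "rational_cone \<Lambda> c"
    and dec: "unimodular_decomposition \<Lambda> c J \<epsilon> u"
    and B: "\<And>j. j \<in> J \<Longrightarrow> vs_lattice_basis (B j) \<Lambda>" "\<And>j. j \<in> J \<Longrightarrow> u j = convex_cone hull (B j)"
  shows "generically (nhds 0) (\<lambda>\<xi>. S ((+) s ` c) \<xi> = (\<Sum>j\<in>J. of_int (\<epsilon> j) * S ((+) s ` u j) \<xi>))"
proof -
  have J: "finite J" using dec by (simp add: unimodular_decomposition_def)
  obtain n :: nat and r f where
    f: "\<forall>i<n. f i \<in> {indicat_real k | k. rational_cone \<Lambda> k \<and> contains_line k}"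
    and eq: "(\<lambda>x. indicat_real c x - (\<Sum>j\<in>J. of_int (\<epsilon> j) * indicat_real (u j) x)) = (\<lambda>x. \<Sum>i<n. r i * f i x)"
    using dec unfolding unimodular_decomposition_def function_span_def by blast
  from f have "\<forall>i\<in>{..<n}. \<exists>k. f i = indicat_real k \<and> rational_cone \<Lambda> k \<and> contains_line k" by blast
  from bchoice[OF this] obtain k where
    k: "\<forall>i\<in>{..<n}. f i = indicat_real (k i) \<and> rational_cone \<Lambda> (k i) \<and> contains_line (k i)" ..
  \<comment> \<open>All cones are put into one family to apply the valuation property once:
    \<open>None\<close> for the given cone, \<open>Inl\<close> for the unimodular ones,
    \<open>Inr\<close> for those containing a line.\<close>
  define p where "p = case_option c (case_sum u k)"
  define q where "q = case_option 1 (case_sum (\<lambda>j. - real_of_int (\<epsilon> j)) (\<lambda>i. - r i))"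
  define I where "I = insert None (Some ` (J <+> {..<n}))"
  have I: "finite I" using J by (simp add: I_def)
  have sumI: "(\<Sum>i\<in>I. g i) = g None + ((\<Sum>j\<in>J. g (Some (Inl j))) + (\<Sum>i<n. g (Some (Inr i))))"
    for g :: "('b + nat) option \<Rightarrow> 'd::comm_monoid_add"
    using J by (simp add: I_def sum.reindex sum.Plus)
  have ind: "indicat_real ((+) s ` k) x = indicat_real k (x - s)" for k x
    by (auto simp: indicator_def image_iff intro: bexI[of _ "x - s"])
  have "generically (nhds 0) (\<lambda>\<xi>. (\<Sum>i\<in>I. complex_of_real (q i) * S ((+) s ` p i) \<xi>) = 0)"
  proof (rule intermediate_gf_valuation[OF S I])
    fix i assume "i \<in> I"
    then consider "i = None" | j where "j \<in> J" "i = Some (Inl j)" | l where "l < n" "i = Some (Inr l)"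
      by (auto simp: I_def)
    then show "semi_rational_polyhedron \<Lambda> ((+) s ` p i)"
    proof cases
      case 1
      then show ?thesis using rational_cone_translate[OF c] by (simp add: p_def)
    next
      case 2
      then show ?thesis using vs_lattice_basis.translate_polyhedron[OF B(1)] B(2) by (simp add: p_def)
    next
      case 3
      then show ?thesis using rational_cone_translate[of \<Lambda> "k l" s] k by (simp add: p_def)
    qed
  next
    fix x
    show "(\<Sum>i\<in>I. q i * indicat_real ((+) s ` p i) x) = 0"
      using fun_cong[OF eq, of "x - s"] k
      by (simp add: sumI p_def q_def ind sum_negf)
  qed
  moreover have "generically (nhds 0) (\<lambda>\<xi>. \<forall>i\<in>{..<n}. S ((+) s ` k i) \<xi> = 0)"
  proof (intro generically_ball finite_lessThan)
    fix i assume "i \<in> {..<n}"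
    then show "generically (nhds 0) (\<lambda>\<xi>. S ((+) s ` k i) \<xi> = 0)"
      using S k rational_cone_translate contains_line_translate
      unfolding intermediate_gf_def germ_eq_iff by blast
  qed
  ultimately show ?thesis
    by (rule generically_mono2) (simp add: sumI p_def q_def sum_negf)
qed

text \<open>The shifted generating function along \<tau> \<xi>, multiplied by \<tau> to the power d.
  The power is the same for all summands since every cone has d generators.\<close>

definition cone_fps ::
    "'j set \<Rightarrow> ('j \<Rightarrow> int) \<Rightarrow> ('j \<Rightarrow> 'a::euclidean_space set) \<Rightarrow> 'a \<Rightarrow> ('a \<Rightarrow>\<^sub>L complex) \<Rightarrow> complex fps" where
  "cone_fps J \<epsilon> B s \<xi> =
     (\<Sum>j\<in>J. fps_const (of_int (\<epsilon> j) / (\<Prod>b\<in>B j. \<xi> b)) * vs_lattice_basis.gf_fps (B j) s \<xi>)"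

lemma generically_nonzero_bases:
  assumes "finite J" "\<And>j. j \<in> J \<Longrightarrow> vs_lattice_basis (B j) \<Lambda>"
  shows "generically F (\<lambda>\<xi>. \<forall>j\<in>J. \<forall>b\<in>B j. blinfun_apply \<xi> b \<noteq> 0)"
proof (rule generically_ball[OF assms(1)])
  fix j assume "j \<in> J"
  then interpret vs_lattice_basis "B j" \<Lambda> by (rule assms(2))
  show "generically F (\<lambda>\<xi>. \<forall>b\<in>B j. blinfun_apply \<xi> b \<noteq> 0)"
    using nonzero by (intro generically_nonzero) auto
qed

text \<open>The germ identity for the whole cone is restricted to lines by
  \<open>generically_line\<close>; excluding the hyperplanes of all the bases makes every summand
  expandable.\<close>

lemma has_laurent_expansion_cone:
  fixes S :: "'a::euclidean_space set \<Rightarrow> ('a \<Rightarrow>\<^sub>L complex) \<Rightarrow> complex"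
  assumes S: "intermediate_gf \<Lambda> {0} S" and c: "rational_cone \<Lambda> c"
    and dec: "unimodular_decomposition \<Lambda> c J \<epsilon> u"
    and B: "\<And>j. j \<in> J \<Longrightarrow> vs_lattice_basis (B j) \<Lambda>" "\<And>j. j \<in> J \<Longrightarrow> u j = convex_cone hull (B j)"
  shows "generically top (\<lambda>\<xi>. (\<lambda>\<tau>. shifted_gf S s c (scaleC_dual \<tau> \<xi>)) has_laurent_expansion
           fls_shift (int DIM('a)) (fps_to_fls (cone_fps J \<epsilon> B s \<xi>)))"
proof -
  have J: "finite J" using dec by (simp add: unimodular_decomposition_def)
  have "generically (nhds 0) (\<lambda>\<xi>. \<forall>j\<in>J. S ((+) s ` u j) \<xi> = vs_lattice_basis.lattice_gf (B j) s \<xi>)"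
    using vs_lattice_basis.germ_eq_lattice_gf[OF B(1) S] B(2)
    by (intro generically_ball J) (simp add: germ_eq_iff)
  with intermediate_gf_decomposition[OF S c dec B, of s]
  have "generically (nhds 0) (\<lambda>\<xi>. shifted_gf S s c \<xi> =
      (\<Sum>j\<in>J. of_int (\<epsilon> j) * (exp (- \<xi> s) * vs_lattice_basis.lattice_gf (B j) s \<xi>)))"
    by (rule generically_mono2) (auto simp: shifted_gf_def sum_distrib_left mult_ac)
  from generically_line[OF this] generically_nonzero_bases[OF J B(1)]
  show ?thesis
  proof (rule generically_mono2)
    fix \<xi> :: "'a \<Rightarrow>\<^sub>L complex"
    assume ev: "\<forall>\<^sub>F \<tau> in at 0. shifted_gf S s c (scaleC_dual \<tau> \<xi>) =
        (\<Sum>j\<in>J. of_int (\<epsilon> j) * (exp (- scaleC_dual \<tau> \<xi> s) * vs_lattice_basis.lattice_gf (B j) s (scaleC_dual \<tau> \<xi>)))"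
      and nz: "\<forall>j\<in>J. \<forall>b\<in>B j. blinfun_apply \<xi> b \<noteq> 0"
    have "(\<lambda>\<tau>. \<Sum>j\<in>J. of_int (\<epsilon> j) * (exp (- scaleC_dual \<tau> \<xi> s) * vs_lattice_basis.lattice_gf (B j) s (scaleC_dual \<tau> \<xi>)))
      has_laurent_expansion (\<Sum>j\<in>J. fls_const (of_int (\<epsilon> j)) *
        fls_shift (int DIM('a)) (fps_to_fls (fps_const (1 / (\<Prod>b\<in>B j. \<xi> b)) * vs_lattice_basis.gf_fps (B j) s \<xi>)))"
      using nz by (intro has_laurent_expansion_sum has_laurent_expansion_cmult_left
        vs_lattice_basis.has_laurent_expansion_shifted_lattice_gf[OF B(1)]) auto
    then show "(\<lambda>\<tau>. shifted_gf S s c (scaleC_dual \<tau> \<xi>)) has_laurent_expansion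
           fls_shift (int DIM('a)) (fps_to_fls (cone_fps J \<epsilon> B s \<xi>))"
    proof (rule has_laurent_expansion_cong[THEN iffD2, rotated 2, OF _ ev])
      show "fls_shift (int DIM('a)) (fps_to_fls (cone_fps J \<epsilon> B s \<xi>)) = (\<Sum>j\<in>J. fls_const (of_int (\<epsilon> j)) *
        fls_shift (int DIM('a)) (fps_to_fls (fps_const (1 / (\<Prod>b\<in>B j. \<xi> b)) * vs_lattice_basis.gf_fps (B j) s \<xi>)))"
        by (rule fls_eqI) (simp add: cone_fps_def fps_sum_nth fls_nth_sum)
    qed
  qed
qed

section \<open>Homogeneous components and their tensor decompositions\<close>

lemma hom_component_shifted_gf:
  fixes S :: "'a::euclidean_space set \<Rightarrow> ('a \<Rightarrow>\<^sub>L complex) \<Rightarrow> complex"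
  assumes "(\<lambda>\<tau>. shifted_gf S s c (scaleC_dual \<tau> \<xi>)) has_laurent_expansion
           fls_shift (int DIM('a)) (fps_to_fls F)"
  shows "hom_component (shifted_gf S s c) k \<xi> =
           (if k + int DIM('a) < 0 then 0 else fps_nth F (nat (k + int DIM('a))))"
  using hom_component_eqI[OF assms, of k] by simp

text \<open>Undoing the shift multiplies the expansion by the exponential series of
  \<tau>\<langle>\<xi>, s\<rangle>, and the sum is the Cauchy product. It stops at r = k + d because
  the shifted function has no components below degree -d.\<close>

lemma hom_component_gf:
  fixes S :: "'a::euclidean_space set \<Rightarrow> ('a \<Rightarrow>\<^sub>L complex) \<Rightarrow> complex"
  assumes F: "(\<lambda>\<tau>. shifted_gf S s c (scaleC_dual \<tau> \<xi>)) has_laurent_expansion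
           fls_shift (int DIM('a)) (fps_to_fls F)"
  shows "hom_component (S ((+) s ` c)) k \<xi> = (\<Sum>r | int r \<le> k + int DIM('a).
           blinfun_apply \<xi> s ^ r / fact r * hom_component (shifted_gf S s c) (k - int r) \<xi>)"
proof -
  let ?d = "int DIM('a)"
  have "(\<lambda>\<tau>. exp (\<xi> s * \<tau>) * shifted_gf S s c (scaleC_dual \<tau> \<xi>)) has_laurent_expansion
      fps_to_fls (fps_exp (\<xi> s)) * fls_shift ?d (fps_to_fls F)"
    by (intro has_laurent_expansion_mult has_laurent_expansion_fps has_fps_expansion_exp F)
  also have "(\<lambda>\<tau>. exp (\<xi> s * \<tau>) * shifted_gf S s c (scaleC_dual \<tau> \<xi>)) = (\<lambda>\<tau>. S ((+) s ` c) (scaleC_dual \<tau> \<xi>))"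
    by (simp add: fun_eq_iff shifted_gf_def exp_minus mult_ac)
  also have "fps_to_fls (fps_exp (\<xi> s)) * fls_shift ?d (fps_to_fls F) = fls_shift ?d (fps_to_fls (fps_exp (\<xi> s) * F))"
    by (simp add: fls_times_fps_to_fls fls_shifted_times_simps)
  finally have S: "hom_component (S ((+) s ` c)) k \<xi> =
      (if k + ?d < 0 then 0 else fps_nth (fps_exp (\<xi> s) * F) (nat (k + ?d)))"
    using hom_component_eqI[of "S ((+) s ` c)" \<xi> _ k] by simp
  show ?thesis
  proof (cases "k + ?d < 0")
    case True
    then have "{r. int r \<le> k + ?d} = {}" by auto
    with True S show ?thesis by simp
  next
    case False
    define n where "n = nat (k + ?d)"
    have n: "int n = k + ?d" using False by (simp add: n_def)
    have "{r. int r \<le> k + ?d} = {0..n}" using n by auto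
    moreover have "hom_component (shifted_gf S s c) (k - int r) \<xi> = fps_nth F (n - r)" if "r \<le> n" for r
    proof -
      have "k - int r + ?d = int (n - r)" using that n by simp
      then show ?thesis by (simp add: hom_component_shifted_gf[OF F])
    qed
    ultimately show ?thesis
      using S False by (simp add: fps_mult_nth n_def[symmetric])
  qed
qed

text \<open>The scalar is complex and the s-factors are real, so it has to be absorbed by the
  \<xi>-factors.\<close>

lemma in_tensor_cmult:
  assumes "in_tensor A B F" "\<And>b. b \<in> B \<Longrightarrow> (\<lambda>\<xi>. c * b \<xi>) \<in> B"
  shows "in_tensor A B (\<lambda>s \<xi>. c * F s \<xi>)"
proof -
  have "in_tensor {\<lambda>_. 1} {\<lambda>_. c} (\<lambda>s \<xi>. complex_of_real 1 * c)"
    by (rule in_tensor_single) simp_all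
  then have "in_tensor {\<lambda>_. 1} {\<lambda>_. c} (\<lambda>s \<xi>. c)" by simp
  then show ?thesis
    by (rule in_tensor_mult[OF _ assms(1)]) (use assms(2) in auto)
qed

lemma hom_poly_dual_cmult: "f \<in> hom_poly_dual k \<Longrightarrow> (\<lambda>\<xi>. c * f \<xi>) \<in> hom_poly_dual k"
  using function_span_sum[of "{()}" "\<lambda>_. f" _ "\<lambda>_. c"] by (simp add: hom_poly_dual_def)

lemma step_hom_cmult: "f \<in> step_hom \<Psi> k \<Longrightarrow> (\<lambda>p. c * f p) \<in> step_hom \<Psi> k"
  using function_span_sum[of "{()}" "\<lambda>_. f" _ "\<lambda>_. c"] by (simp add: step_hom_def)

lemma in_tensor_hom_component_shifted_gf:
  fixes S :: "'a::euclidean_space set \<Rightarrow> ('a \<Rightarrow>\<^sub>L complex) \<Rightarrow> complex"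
  assumes J: "finite J" and B: "\<And>j. j \<in> J \<Longrightarrow> vs_lattice_basis (B j) \<Lambda>"
    and \<Psi>: "\<And>j. j \<in> J \<Longrightarrow> uminus ` coord (B j) ` B j \<subseteq> \<Psi>"
    and F: "\<And>s. generically top (\<lambda>\<xi>. (\<lambda>\<tau>. shifted_gf S s c (scaleC_dual \<tau> \<xi>)) has_laurent_expansion
           fls_shift (int DIM('a)) (fps_to_fls (cone_fps J \<epsilon> B s \<xi>)))"
  shows "in_tensor (step_poly \<Psi> (k + int DIM('a))) (hom_rational k)
           (\<lambda>s. hom_component (shifted_gf S s c) k)"
proof (cases "k + int DIM('a) < 0")
  case True
  \<comment> \<open>Below degree -d the component vanishes, and zero is represented by the empty
    sum; \<open>undefined\<close> is never evaluated.\<close>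
  have "in_tensor (step_poly \<Psi> (k + int DIM('a))) (hom_rational k) (\<lambda>s \<xi>. \<Sum>i\<in>{}. undefined i s \<xi>)"
    by (rule in_tensor_sum) auto
  then show ?thesis
  proof (rule in_tensor_cong)
    show "rational_eq (hom_component (shifted_gf S s c) k) (\<lambda>\<xi>. \<Sum>i\<in>{}. undefined i s \<xi>)" for s
      unfolding rational_eq_iff
      by (rule generically_mono[OF F[of s]]) (simp add: hom_component_shifted_gf True)
  qed
next
  case False
  define n where "n = nat (k + int DIM('a))"
  have n: "int n = k + int DIM('a)" using False by (simp add: n_def)
  have "in_tensor (step_poly \<Psi> (k + int DIM('a))) (hom_rational k)
      (\<lambda>s \<xi>. \<Sum>j\<in>J. (of_int (\<epsilon> j) * fps_nth (vs_lattice_basis.gf_fps (B j) s \<xi>) n) / (\<Prod>b\<in>B j. blinfun_apply \<xi> b))"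
  proof (rule in_tensor_sum[OF J])
    fix j assume j: "j \<in> J"
    interpret vs_lattice_basis "B j" \<Lambda> by (rule B[OF j])
    have "in_tensor (step_poly \<Psi> (k + int (card (B j)))) (hom_rational k)
        (\<lambda>s \<xi>. (\<lambda>p. of_int (\<epsilon> j) * fps_nth (gf_fps (fst p) (snd p)) n) (s, \<xi>) / (\<Prod>b\<in>B j. blinfun_apply \<xi> b))"
      by (rule step_hom_in_tensor[OF step_hom_cmult[OF gf_fps_step_hom[OF \<Psi>[OF j]]]])
        (use n nonzero in \<open>auto simp: card_B\<close>)
    then show "in_tensor (step_poly \<Psi> (k + int DIM('a))) (hom_rational k)
        (\<lambda>s \<xi>. (of_int (\<epsilon> j) * fps_nth (gf_fps s \<xi>) n) / (\<Prod>b\<in>B j. blinfun_apply \<xi> b))"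
      by (simp add: card_B)
  qed
  then show ?thesis
  proof (rule in_tensor_cong)
    show "rational_eq (hom_component (shifted_gf S s c) k)
        (\<lambda>\<xi>. \<Sum>j\<in>J. (of_int (\<epsilon> j) * fps_nth (vs_lattice_basis.gf_fps (B j) s \<xi>) n) / (\<Prod>b\<in>B j. blinfun_apply \<xi> b))" for s
      unfolding rational_eq_iff
      by (rule generically_mono[OF F[of s]])
        (use False in \<open>simp add: hom_component_shifted_gf n_def[symmetric] cone_fps_def fps_sum_nth\<close>)
  qed
qed

text \<open>Degrees add on both sides: r and m - r + d give m + d in s, while r and m - r give m in
  \<xi>.\<close>

lemma in_tensor_pairing_power_mult:
  assumes "in_tensor (step_poly \<Psi> (m - int r + d)) (hom_rational (m - int r)) F"
  shows "in_tensor (quasi_poly \<Psi> (m + d)) (hom_rational m)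
           (\<lambda>s \<xi>. blinfun_apply \<xi> s ^ r / fact r * F s \<xi>)"
proof -
  have "in_tensor (hom_poly r) (hom_poly_dual (int r)) (\<lambda>s \<xi>. (1 / fact r) * blinfun_apply \<xi> s ^ r)"
    by (rule in_tensor_cmult[OF in_tensor_pairing_power hom_poly_dual_cmult])
  then have "in_tensor (quasi_poly \<Psi> (m + d)) (hom_rational m)
      (\<lambda>s \<xi>. ((1 / fact r) * blinfun_apply \<xi> s ^ r) * F s \<xi>)"
  proof (rule in_tensor_mult[OF _ assms _ hom_rational_mult])
    fix p f :: "'a \<Rightarrow> real" assume "p \<in> hom_poly r" "f \<in> step_poly \<Psi> (m - int r + d)"
    then have "(\<lambda>s. 1 * (f s * p s)) \<in> quasi_poly \<Psi> (m + d)"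
      unfolding quasi_poly_def by (intro function_span_base CollectI exI conjI refl) auto
    then show "(\<lambda>s. p s * f s) \<in> quasi_poly \<Psi> (m + d)" by (simp add: mult.commute)
  qed
  then show ?thesis by simp
qed

theorem theorem22:
  fixes \<Lambda> c :: "'a::euclidean_space set"
    and S I :: "'a set \<Rightarrow> ('a \<Rightarrow>\<^sub>L complex) \<Rightarrow> complex"
    and J :: "'j set" and \<epsilon> :: "'j \<Rightarrow> int" and u :: "'j \<Rightarrow> 'a set"
    and m :: int
  assumes "lattice_in UNIV \<Lambda>"
    and "intermediate_gf \<Lambda> {0} S"
    and "intermediate_gf \<Lambda> UNIV I"
    and "rational_cone \<Lambda> c" and "full_dimensional c"
    and "unimodular_decomposition \<Lambda> c J \<epsilon> u"
  defines "d \<equiv> int DIM('a)"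
    and "M \<equiv> shifted_gf S"
    and "\<Psi> \<equiv> Psi_neg \<Lambda> J u"
  shows
    "in_tensor (step_poly \<Psi> (m + d)) (hom_rational m) (\<lambda>s. hom_component (M s c) m)
     \<and> (in_tensor (quasi_poly \<Psi> (m + d)) (hom_rational m)
          (\<lambda>s. hom_component (S ((+) s ` c)) m)
        \<and> (\<forall>s. rational_eq (hom_component (S ((+) s ` c)) m)
              (\<lambda>\<xi>. \<Sum>r | int r \<le> m + d.
                 blinfun_apply \<xi> s ^ r / fact r * hom_component (M s c) (m - int r) \<xi>)))
     \<and> ((m < - d \<longrightarrow> (\<forall>s. rational_eq (hom_component (S ((+) s ` c)) m) (\<lambda>_. 0)))
        \<and> (\<forall>s s'. rational_eq (hom_component (S ((+) s ` c)) (- d))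
                              (hom_component (S ((+) s' ` c)) (- d)))
        \<and> (\<forall>s. rational_eq (hom_component (S ((+) s ` c)) (- d)) (hom_component (M s c) (- d))
             \<and> germ_eq (hom_component (M s c) (- d)) (I c)))"
proof -
  have J: "finite J" using assms(6) by (simp add: unimodular_decomposition_def)
  have "\<forall>j\<in>J. \<exists>B. vs_lattice_basis B \<Lambda> \<and> u j = convex_cone hull B"
  proof
    fix j assume "j \<in> J"
    then have "unimodular_cone \<Lambda> (u j)" "full_dimensional (u j)"
      using assms(6) by (auto simp: unimodular_decomposition_def)
    then obtain B where "vs_lattice_basis B \<Lambda>" "u j = convex_cone hull B"
      by (rule unimodular_cone_basis)
    then show "\<exists>B. vs_lattice_basis B \<Lambda> \<and> u j = convex_cone hull B" by blast
  qed
  from bchoice[OF this] obtain B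
    where B: "\<And>j. j \<in> J \<Longrightarrow> vs_lattice_basis (B j) \<Lambda>" "\<And>j. j \<in> J \<Longrightarrow> u j = convex_cone hull (B j)"
    by blast
  \<comment> \<open>The edge generators of \<open>u j\<close> are the basis \<open>B j\<close>, so
    its coordinate functionals lie in \<open>Psi\<close>; their negatives are the ones under the
    fractional part.\<close>
  have \<Psi>: "uminus ` coord (B j) ` B j \<subseteq> \<Psi>" if "j \<in> J" for j
    unfolding \<Psi>_def Psi_neg_def Psi_def
    by (intro image_mono image_subsetI UN_I[OF that])
      (simp add: B(2)[OF that] vs_lattice_basis.coord_in_dual_basis[OF B(1)[OF that]])
  have F: "generically top (\<lambda>\<xi>. (\<lambda>\<tau>. M s c (scaleC_dual \<tau> \<xi>)) has_laurent_expansion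
           fls_shift (int DIM('a)) (fps_to_fls (cone_fps J \<epsilon> B s \<xi>)))" for s
    unfolding M_def by (rule has_laurent_expansion_cone[OF assms(2,4,6) B])
  have tensor_M: "in_tensor (step_poly \<Psi> (k + d)) (hom_rational k) (\<lambda>s. hom_component (M s c) k)" for k
    unfolding d_def M_def
    by (rule in_tensor_hom_component_shifted_gf[OF J B(1) \<Psi> F[unfolded M_def]])
  have S_eq: "generically top (\<lambda>\<xi>. hom_component (S ((+) s ` c)) k \<xi> = (\<Sum>r | int r \<le> k + d.
                 blinfun_apply \<xi> s ^ r / fact r * hom_component (M s c) (k - int r) \<xi>))" for s k
    using F[of s] unfolding M_def d_def by (rule generically_mono) (rule hom_component_gf)
  have fin: "finite {r. int r \<le> k}" for k
    by (rule finite_subset[of _ "{..nat k}"]) auto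
  have "in_tensor (quasi_poly \<Psi> (m + d)) (hom_rational m) (\<lambda>s \<xi>. \<Sum>r | int r \<le> m + d.
      blinfun_apply \<xi> s ^ r / fact r * hom_component (M s c) (m - int r) \<xi>)"
    by (intro in_tensor_sum fin in_tensor_pairing_power_mult tensor_M)
  then have tensor_S: "in_tensor (quasi_poly \<Psi> (m + d)) (hom_rational m) (\<lambda>s. hom_component (S ((+) s ` c)) m)"
    by (rule in_tensor_cong) (unfold rational_eq_iff, rule S_eq)
  have S_zero: "rational_eq (hom_component (S ((+) s ` c)) m) (\<lambda>_. 0)" if "m < - d" for s
  proof -
    have "{r. int r \<le> m + d} = {}" using that by auto
    then show ?thesis using S_eq[of s m] by (simp add: rational_eq_iff)
  qed
  have S_M: "generically top (\<lambda>\<xi>. hom_component (S ((+) s ` c)) (- d) \<xi> = hom_component (M s c) (- d) \<xi>)" for s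
  proof -
    have "{r. int r \<le> - d + d} = {0}" by auto
    then show ?thesis using S_eq[of s "- d"] by simp
  qed
  \<comment> \<open>The component of degree -d is the constant coefficient of
    \<open>cone_fps\<close>, an expression free of s.\<close>
  have M_low: "generically top (\<lambda>\<xi>. hom_component (M s c) (- d) \<xi> =
      (\<Sum>j\<in>J. of_int (\<epsilon> j) * (\<Prod>b\<in>B j. - 1 / \<xi> b)))" for s
  proof (rule generically_mono[OF F[of s]])
    fix \<xi> :: "'a \<Rightarrow>\<^sub>L complex"
    assume "(\<lambda>\<tau>. M s c (scaleC_dual \<tau> \<xi>)) has_laurent_expansion
           fls_shift (int DIM('a)) (fps_to_fls (cone_fps J \<epsilon> B s \<xi>))"
    from hom_component_shifted_gf[OF this[unfolded M_def], of "- d"]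
    have "hom_component (M s c) (- d) \<xi> = fps_nth (cone_fps J \<epsilon> B s \<xi>) 0"
      by (simp add: d_def M_def)
    also have "\<dots> = (\<Sum>j\<in>J. of_int (\<epsilon> j) * (\<Prod>b\<in>B j. - 1 / \<xi> b))"
      unfolding cone_fps_def fps_sum_nth prod_dividef
      by (rule sum.cong) (simp_all add: vs_lattice_basis.gf_fps_nth_0[OF B(1)])
    finally show "hom_component (M s c) (- d) \<xi> = (\<Sum>j\<in>J. of_int (\<epsilon> j) * (\<Prod>b\<in>B j. - 1 / \<xi> b))" .
  qed
  have S_low: "rational_eq (hom_component (S ((+) s ` c)) (- d)) (hom_component (S ((+) s' ` c)) (- d))" for s s'
    unfolding rational_eq_iff
    by (rule generically_mono2[OF generically_conj[OF S_M[of s] S_M[of s']] generically_conj[OF M_low[of s] M_low[of s']]])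
      simp
  \<comment> \<open>The same decomposition with s = 0, applied to the integral, leads to the same
    sum as in \<open>M_low\<close>.\<close>
  have "generically (nhds 0) (\<lambda>\<xi>. \<forall>j\<in>J. I (u j) \<xi> = (\<Prod>b\<in>B j. - 1 / \<xi> b))"
    using vs_lattice_basis.germ_eq_cone_integral[OF B(1) assms(3)] B(2)
    by (intro generically_ball J) (simp add: germ_eq_iff)
  with intermediate_gf_decomposition[OF assms(3,4,6) B, of 0]
  have I_low: "generically (nhds 0) (\<lambda>\<xi>. I c \<xi> = (\<Sum>j\<in>J. of_int (\<epsilon> j) * (\<Prod>b\<in>B j. - 1 / \<xi> b)))"
    by (rule generically_mono2) (auto intro!: sum.cong)
  \<comment> \<open>\<open>I c\<close> is controlled only near 0, so the rational identity
    \<open>M_low\<close> is weakened to a germ identity before the comparison.\<close>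
  have M_I: "germ_eq (hom_component (M s c) (- d)) (I c)" for s
    unfolding germ_eq_iff
    by (rule generically_mono2[OF generically_nhdsI[OF M_low[of s]] I_low]) simp
  show ?thesis
    by (intro conjI allI impI tensor_M tensor_S S_zero S_low M_I
        S_eq[folded rational_eq_iff] S_M[folded rational_eq_iff])
qed

end
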